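(* Let $(E,d)$ be a locally compact, complete separable metric space, and let $X=\{X(t)\}_{t\ge0}$ be a time-homogeneous Markov process on $E$ with càdlàg paths, with law $\mathbb{P}$ on $D_E(\mathbb{R}^+)$ and initial law $\mathbb{P}_0$, whose transition semigroup $S(t)f(x)=\mathbb{E}[f(X(t))\,|\,X(0)=x]$ is strongly continuous on $(C_0(E),\|\cdot\|)$ with generator $(A,\mathcal{D}(A))$. Suppose that $A$ has a core $D$ equipped with a topology $\tau_D$ such that $(D,\tau_D)$ satisfies the core conditions (1)–(8) of the context. Let $I$ be the good rate function of the large deviation principle on $D_{\mathcal{P}(E)}(\mathbb{R}^+)$ for $L_n=\{\frac1n\sum_{i=1}^n\delta_{X^i(t)}\}_{t\ge0}$, where $X^1,X^2,\dots$ are independent copies of $X$, i.e. $$I(\nu)=\begin{cases} H(\nu(0)\,|\,\mathbb{P}_0)+\sup_{0=t_0<t_1<\dots<t_k}\sum_{i=1}^k I_{t_i-t_{i-1}}(\nu(t_i)\,|\,\nu(t_{i-1})) & \text{if }\nu\in C_{\mathcal{P}(E)}(\mathbb{R}^+),\\ \infty&\text{otherwise,}\end{cases}$$ with $I_t(\nu_2\,|\,\nu_1)=\sup_{f\in C_b(E)}\{\langle f,\nu_2\rangle-\langle V(t)f,\nu_1\rangle\}$ and $V(t)f(x)=\log\mathbb{E}[e^{f(X(t))}\,|\,X(0)=x]$. Then $$I(\nu)=\begin{cases}H(\nu(0)\,|\,\mathbb{P}_0)+\int_0^\infty\mathcal{L}(\nu(s),\dot\nu(s))\,ds&\text{if }\nu\in\mathcal{AC},\\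 \infty&\text{otherwise,}\end{cases}$$ where $\mathcal{L}:\mathcal{P}(E)\times D'\to[0,\infty]$ is given by $\mathcal{L}(\mu,u):=\sup_{f\in D}\{\langle f,u\rangle-\langle Hf,\mu\rangle\}$.
   Context: $\mathbb{R}^+=[0,\infty)$; $C_0(E)$ is the space of continuous real functions vanishing at infinity ($C(E)$ if $E$ is compact), with sup norm $\|\cdot\|$. $\mathcal{P}(E)$ carries the weak topology; $D_{\mathcal{P}(E)}(\mathbb{R}^+)$ is the Skorokhod space of càdlàg $\mathcal{P}(E)$-valued paths and $C_{\mathcal{P}(E)}(\mathbb{R}^+)$ its subspace of continuous paths. $\langle f,\mu\rangle=\int f\,d\mu$. $H(\mu\,|\,\nu)$ (two arguments) denotes relative entropy: $\int\log\frac{d\mu}{d\nu}d\mu$ if $\mu\ll\nu$, else $\infty$. A rate function is good if its level sets are compact. For $f\in D$ (with $D$ as in (1)–(3)) put $Hf=e^{-f}Ae^f$; when $E$ is non-compact this is understood by extending $A$ to the one-point compactification with $A\mathbf{1}=0$, i.e. $Hf=e^{-f}A(e^f-1)$. Core conditions for $(D,\tau_D)$, $D\subseteq\mathcal{D}(A)$: (1) $D$ is a core: $D$ is dense in $C_0(E)$ and for every $f\in\mathcal{D}(A)$ there are $f_n\in D$ with $f_n\to f$ and $Af_n\to Af$ in sup norm; (2) $D$ is an algebra: $f,g\in D$ implies $fg\in D$; (3) if $f\in D$ and $\phi:\mathbb{R}\to\mathbb{R}$ is smooth on the closure of the range of $f$, then $\phi\circ f-\phi(0)\in D$ (if $E$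 is compact this can be replaced by: $\phi\circ f\in D$ whenever $f \in D$ and $\phi$ is smooth on the range of $f$); (4) $(D,\tau_D)$ is a separable barrelled locally convex Hausdorff space; (5) $\tau_D$ is finer than the sup norm topology restricted to $D$; (6) if $\phi:[a,b]\to\mathbb{R}$ is smooth with $\phi(0)=0$, then $f\mapsto\phi\circ f$, from $\{f\in D: f(E)\subseteq[a,b]\}$ to $D$, is $\tau_D$-to-$\tau_D$ continuous; (7) $A:(D,\tau_D)\to(C_0(E),\|\cdot\|)$ is continuous; (8) there is a barrel $\mathcal{N}\subseteq(D,\tau_D)$ (closed, convex, balanced, absorbing set) such that $\sup_{f\in c\mathcal{N}}\|Hf\|<\infty$ for every $c>0$. $D'$ is the continuous dual of $(D,\tau_D)$ with the weak* topology. $\mathcal{AC}$ is the set of $\nu\in C_{\mathcal{P}(E)}(\mathbb{R}^+)$ for which there is a weak*-measurable curve $s\mapsto u(s)$ in $D'$ with (i) $\int_0^t|\langle f,u(s)\rangle|\,ds<\infty$ for all $f\in D$, $t\ge0$, and (ii) $\langle f,\nu(t)\rangle-\langle f,\nu(0)\rangle=\int_0^t\langle f,u(s)\rangle\,ds$ for all $f\in D$, $t\ge0$; one writes $\dot\nu(s):=u(s)$. *)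

theory Defs
  imports "HOL-Probability.Probability"
begin

section \<open>Path spaces\<close>

text \<open>A path is an element of \<^term>\<open>extensional {0..}\<close>, so that it carries no information
  outside of its time domain.\<close>

definition cadlag :: "'b topology \<Rightarrow> (real \<Rightarrow> 'b) \<Rightarrow> bool" where
  "cadlag T x \<longleftrightarrow>
     (\<forall>t\<ge>0. limitin T x (x t) (at_right t)) \<and> (\<forall>t>0. \<exists>l. limitin T x l (at_left t))"

definition cadlag_paths :: "'b topology \<Rightarrow> (real \<Rightarrow> 'b) set" where
  "cadlag_paths T = {x \<in> extensional {0..}. cadlag T x}"

definition continuous_paths :: "'b topology \<Rightarrow> (real \<Rightarrow> 'b) set" where
  "continuous_paths T = {x \<in> extensional {0..}. continuous_map (top_of_set {0..}) T x}"

text \<open>Convergence in the Skorokhod (J1) topology over a metrizable space: there are time changes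
  \<open>l n\<close> of the half line, converging to the identity uniformly on bounded time intervals, along
  which the distance of \<open>xs n\<close> and the time-changed limit tends to zero uniformly on bounded
  time intervals. The notion does not depend on the compatible metric \<open>m\<close>.\<close>

definition skorokhod_conv :: "'b topology \<Rightarrow> (nat \<Rightarrow> real \<Rightarrow> 'b) \<Rightarrow> (real \<Rightarrow> 'b) \<Rightarrow> bool" where
  "skorokhod_conv T xs x \<longleftrightarrow>
     (\<exists>m l. Metric_space (topspace T) m \<and> Metric_space.mtopology (topspace T) m = T \<and>
        (\<forall>n. bij_betw (l n) {0..} {0..} \<and> strict_mono_on {0..} (l n)) \<and>
        (\<forall>b\<ge>0. \<forall>e>0. \<forall>\<^sub>F n in sequentially. \<forall>t\<in>{0..b}.
            \<bar>l n t - t\<bar> < e \<and> m (xs n t) (x (l n t)) < e))"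

text \<open>The Skorokhod topology is metrizable, hence its open sets are the sequentially open ones.\<close>

definition skorokhod_topology :: "'b topology \<Rightarrow> (real \<Rightarrow> 'b) topology" where
  "skorokhod_topology T = topology (\<lambda>U. U \<subseteq> cadlag_paths T \<and>
     (\<forall>x\<in>U. \<forall>xs. range xs \<subseteq> cadlag_paths T \<and> skorokhod_conv T xs x \<longrightarrow>
        (\<forall>\<^sub>F n in sequentially. xs n \<in> U)))"

lemma openin_skorokhod_topology:
  "openin (skorokhod_topology T) U \<longleftrightarrow> U \<subseteq> cadlag_paths T \<and>
     (\<forall>x\<in>U. \<forall>xs. range xs \<subseteq> cadlag_paths T \<and> skorokhod_conv T xs x \<longrightarrow>
        (\<forall>\<^sub>F n in sequentially. xs n \<in> U))"
proof -
  have "istopology (\<lambda>U. U \<subseteq> cadlag_paths T \<and>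
     (\<forall>x\<in>U. \<forall>xs. range xs \<subseteq> cadlag_paths T \<and> skorokhod_conv T xs x \<longrightarrow>
        (\<forall>\<^sub>F n in sequentially. xs n \<in> U)))" (is "istopology ?L")
    unfolding istopology_def
  proof (rule conjI; intro allI impI)
    fix S U assume S: "?L S" and U: "?L U"
    show "?L (S \<inter> U)"
      using S U by (auto simp: eventually_conj_iff)
  next
    fix K assume K: "\<forall>S\<in>K. ?L S"
    have "\<forall>\<^sub>F n in sequentially. xs n \<in> \<Union>K"
      if "x \<in> \<Union>K" "range xs \<subseteq> cadlag_paths T" "skorokhod_conv T xs x" for x xs
    proof -
      from that(1) obtain S where S: "S \<in> K" "x \<in> S" by blast
      with K that(2,3) have "\<forall>\<^sub>F n in sequentially. xs n \<in> S" by blast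
      then show ?thesis
        by (rule eventually_mono) (use S in blast)
    qed
    with K show "?L (\<Union>K)" by blast
  qed
  then show ?thesis
    unfolding skorokhod_topology_def by (simp add: topology_inverse')
qed

lemma topspace_skorokhod_topology [simp]: "topspace (skorokhod_topology T) = cadlag_paths T"
proof (rule antisym)
  show "topspace (skorokhod_topology T) \<subseteq> cadlag_paths T"
    using openin_topspace[of "skorokhod_topology T"] by (simp only: openin_skorokhod_topology)
  have "openin (skorokhod_topology T) (cadlag_paths T)"
    unfolding openin_skorokhod_topology by (auto intro!: always_eventually)
  then show "cadlag_paths T \<subseteq> topspace (skorokhod_topology T)"
    by (rule openin_subset)
qed

section \<open>Probability measures\<close>

text \<open>The set of Borel probability measures is \<^term>\<open>space (prob_algebra borel)\<close>; the weak
  topology is the coarsest one making integration of bounded continuous functions continuous.\<close>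

definition weak_topology :: "'a::metric_space measure topology" where
  "weak_topology = topology_generated_by
     {{\<mu> \<in> space (prob_algebra borel). (\<integral>x. apply_bcontfun f x \<partial>\<mu>) \<in> U} |
        (f :: 'a \<Rightarrow>\<^sub>C real) U. open U}"

text \<open>The negative part of the log-density is always \<open>\<mu>\<close>-integrable, so that failure of
  integrability means that the integral is \<open>\<infinity>\<close>. The library's \<^const>\<open>KL_divergence\<close> is
  real-valued and takes its arguments in the opposite order.\<close>

definition relative_entropy :: "'a measure \<Rightarrow> 'a measure \<Rightarrow> ereal" where
  "relative_entropy \<mu> \<nu> =
     (if absolutely_continuous \<nu> \<mu> \<and> integrable \<mu> (entropy_density (exp 1) \<nu> \<mu>)
      then ereal (KL_divergence (exp 1) \<nu> \<mu>) else \<infinity>)"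

section \<open>Large deviation principles\<close>

definition good_rate_function :: "'b topology \<Rightarrow> ('b \<Rightarrow> ereal) \<Rightarrow> bool" where
  "good_rate_function T I \<longleftrightarrow> (\<forall>x\<in>topspace T. 0 \<le> I x) \<and>
     (\<forall>c::real. compactin T {x \<in> topspace T. I x \<le> ereal c})"

definition eln :: "real \<Rightarrow> ereal" where
  "eln p = (if p = 0 then - \<infinity> else ereal (ln p))"

definition large_deviation_principle ::
  "'b topology \<Rightarrow> 'v measure \<Rightarrow> (nat \<Rightarrow> 'v \<Rightarrow> 'b) \<Rightarrow> ('b \<Rightarrow> ereal) \<Rightarrow> bool" where
  "large_deviation_principle T N L I \<longleftrightarrow>
     (\<forall>F. closedin T F \<longrightarrow>
        limsup (\<lambda>n. ereal (1 / real n) * eln (measure N {\<omega> \<in> space N. L n \<omega> \<in> F}))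
          \<le> - (INF x\<in>F. I x)) \<and>
     (\<forall>G. openin T G \<longrightarrow>
        - (INF x\<in>G. I x) \<le>
        liminf (\<lambda>n. ereal (1 / real n) * eln (measure N {\<omega> \<in> space N. L n \<omega> \<in> G})))"

section \<open>Feller processes\<close>

definition C0 :: "('a::metric_space \<Rightarrow>\<^sub>C real) set" where
  "C0 = {f. \<forall>e>0. \<exists>K. compact K \<and> (\<forall>x. x \<notin> K \<longrightarrow> \<bar>apply_bcontfun f x\<bar> < e)}"

definition transition_function :: "(real \<Rightarrow> 'a::metric_space \<Rightarrow> 'a measure) \<Rightarrow> bool" where
  "transition_function P \<longleftrightarrow>
     (\<forall>t\<ge>0. P t \<in> borel \<rightarrow>\<^sub>M prob_algebra borel) \<and>
     (\<forall>x. P 0 x = return borel x) \<and>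
     (\<forall>s\<ge>0. \<forall>t\<ge>0. \<forall>x. P (s + t) x = P s x \<bind> P t)"

definition natural_filtration ::
  "'w measure \<Rightarrow> (real \<Rightarrow> 'w \<Rightarrow> 'a::metric_space) \<Rightarrow> real \<Rightarrow> 'w measure" where
  "natural_filtration M X s =
     sigma (space M) {X r -` B \<inter> space M | r B. 0 \<le> r \<and> r \<le> s \<and> B \<in> sets borel}"

text \<open>\<open>X\<close> is a time-homogeneous cadlag Markov process with transition function \<open>P\<close>. The measure
  \<open>P t x\<close> is the law of \<open>X t\<close> given \<open>X 0 = x\<close>, for every starting point \<open>x\<close>.\<close>

definition cadlag_markov_process ::
  "'w measure \<Rightarrow> (real \<Rightarrow> 'w \<Rightarrow> 'a::metric_space) \<Rightarrow> (real \<Rightarrow> 'a \<Rightarrow> 'a measure) \<Rightarrow> bool" where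
  "cadlag_markov_process M X P \<longleftrightarrow> prob_space M \<and> transition_function P \<and>
     (\<forall>t\<ge>0. X t \<in> borel_measurable M) \<and>
     (\<forall>\<omega>\<in>space M. cadlag euclidean (\<lambda>t. X t \<omega>)) \<and>
     (\<forall>s\<ge>0. \<forall>t\<ge>0. \<forall>f :: 'a \<Rightarrow> real. f \<in> borel_measurable borel \<and> bounded (range f) \<longrightarrow>
        (AE \<omega> in M. real_cond_exp M (natural_filtration M X s) (\<lambda>\<omega>. f (X (s + t) \<omega>)) \<omega>
                     = (\<integral>y. f y \<partial>P t (X s \<omega>))))"

text \<open>\<^const>\<open>Bcontfun\<close> is only meaningful on bounded continuous functions; for the semigroup this
  is part of \<open>strongly_continuous_on_C0\<close>.\<close>

definition transition_semigroup ::
  "(real \<Rightarrow> 'a::metric_space \<Rightarrow> 'a measure) \<Rightarrow> real \<Rightarrow> ('a \<Rightarrow>\<^sub>C real) \<Rightarrow> ('a \<Rightarrow>\<^sub>C real)" where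
  "transition_semigroup P t f = Bcontfun (\<lambda>x. \<integral>y. apply_bcontfun f y \<partial>P t x)"

definition strongly_continuous_on_C0 :: "(real \<Rightarrow> 'a::metric_space \<Rightarrow> 'a measure) \<Rightarrow> bool" where
  "strongly_continuous_on_C0 P \<longleftrightarrow>
     (\<forall>t\<ge>0. \<forall>f\<in>C0. (\<lambda>x. \<integral>y. apply_bcontfun f y \<partial>P t x) \<in> bcontfun \<and> transition_semigroup P t f \<in> C0) \<and>
     (\<forall>f\<in>C0. continuous_on {0..} (\<lambda>t. transition_semigroup P t f))"

definition generator_domain :: "(real \<Rightarrow> 'a::metric_space \<Rightarrow> 'a measure) \<Rightarrow> ('a \<Rightarrow>\<^sub>C real) set" where
  "generator_domain P =
     {f \<in> C0. \<exists>g\<in>C0. ((\<lambda>t. (1 / t) *\<^sub>R (transition_semigroup P t f - f)) \<longlongrightarrow> g) (at_right 0)}"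

definition generator ::
  "(real \<Rightarrow> 'a::metric_space \<Rightarrow> 'a measure) \<Rightarrow> ('a \<Rightarrow>\<^sub>C real) \<Rightarrow> ('a \<Rightarrow>\<^sub>C real)" where
  "generator P f = Lim (at_right 0) (\<lambda>t. (1 / t) *\<^sub>R (transition_semigroup P t f - f))"

text \<open>\<open>Hf = e\<^sup>-\<^sup>f A e\<^sup>f\<close>, read as \<open>e\<^sup>-\<^sup>f A (e\<^sup>f - 1)\<close> on a non-compact space.\<close>

definition hamiltonian ::
  "(real \<Rightarrow> 'a::metric_space \<Rightarrow> 'a measure) \<Rightarrow> ('a \<Rightarrow>\<^sub>C real) \<Rightarrow> ('a \<Rightarrow>\<^sub>C real)" where
  "hamiltonian P f =
     (let h = (if compact (UNIV :: 'a set) then Bcontfun (\<lambda>y. exp (apply_bcontfun f y))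
               else Bcontfun (\<lambda>y. exp (apply_bcontfun f y) - 1))
      in Bcontfun (\<lambda>x. exp (- apply_bcontfun f x) * apply_bcontfun (generator P h) x))"

section \<open>The core conditions\<close>

text \<open>Smoothness on a set that need not be open is smoothness on some open neighbourhood.\<close>

definition smooth_on :: "real set \<Rightarrow> (real \<Rightarrow> real) \<Rightarrow> bool" where
  "smooth_on S \<phi> \<longleftrightarrow>
     (\<exists>U. open U \<and> S \<subseteq> U \<and> (\<forall>n. \<forall>x\<in>U. (deriv ^^ n) \<phi> differentiable at x))"

definition locally_convex_space :: "'b::real_vector topology \<Rightarrow> bool" where
  "locally_convex_space T \<longleftrightarrow> subspace (topspace T) \<and>
     continuous_map (prod_topology T T) T (\<lambda>(f, g). f + g) \<and>
     continuous_map (prod_topology euclideanreal T) T (\<lambda>(c, f). c *\<^sub>R f) \<and>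
     (\<forall>U. openin T U \<and> 0 \<in> U \<longrightarrow> (\<exists>V. openin T V \<and> convex V \<and> 0 \<in> V \<and> V \<subseteq> U))"

definition barrel :: "'b::real_vector topology \<Rightarrow> 'b set \<Rightarrow> bool" where
  "barrel T B \<longleftrightarrow> closedin T B \<and> convex B \<and>
     (\<forall>c f. \<bar>c\<bar> \<le> 1 \<and> f \<in> B \<longrightarrow> c *\<^sub>R f \<in> B) \<and>
     (\<forall>f\<in>topspace T. \<exists>r>0. \<forall>c. r \<le> \<bar>c\<bar> \<longrightarrow> f \<in> (\<lambda>g. c *\<^sub>R g) ` B)"

definition barrelled :: "'b::real_vector topology \<Rightarrow> bool" where
  "barrelled T \<longleftrightarrow> (\<forall>B. barrel T B \<longrightarrow> (\<exists>U. openin T U \<and> 0 \<in> U \<and> U \<subseteq> B))"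

definition core_conditions ::
  "(real \<Rightarrow> 'a::metric_space \<Rightarrow> 'a measure) \<Rightarrow> ('a \<Rightarrow>\<^sub>C real) set \<Rightarrow> ('a \<Rightarrow>\<^sub>C real) topology \<Rightarrow> bool"
where
  "core_conditions P D \<tau> \<longleftrightarrow>
     topspace \<tau> = D \<and> D \<subseteq> generator_domain P \<and>
     C0 \<subseteq> closure D \<and>
     (\<forall>f\<in>generator_domain P. \<exists>F. range F \<subseteq> D \<and> F \<longlonglongrightarrow> f \<and>
        (\<lambda>n. generator P (F n)) \<longlonglongrightarrow> generator P f) \<and>
     \<comment> \<open>linearity of \<open>D\<close> is part of \<^const>\<open>locally_convex_space\<close>\<close>
     (\<forall>f\<in>D. \<forall>g\<in>D. Bcontfun (\<lambda>x. apply_bcontfun f x * apply_bcontfun g x) \<in> D) \<and>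
     ((\<forall>f\<in>D. \<forall>\<phi>. smooth_on (closure (range (apply_bcontfun f))) \<phi> \<longrightarrow>
         Bcontfun (\<lambda>x. \<phi> (apply_bcontfun f x) - \<phi> 0) \<in> D) \<or>
      (compact (UNIV :: 'a set) \<and>
       (\<forall>f\<in>D. \<forall>\<phi>. smooth_on (range (apply_bcontfun f)) \<phi> \<longrightarrow>
         Bcontfun (\<lambda>x. \<phi> (apply_bcontfun f x)) \<in> D))) \<and>
     locally_convex_space \<tau> \<and> Hausdorff_space \<tau> \<and> separable_space \<tau> \<and> barrelled \<tau> \<and>
     (\<forall>U. openin (top_of_set D) U \<longrightarrow> openin \<tau> U) \<and>
     (\<forall>a b \<phi>. 0 \<in> {a..b} \<and> smooth_on {a..b} \<phi> \<and> \<phi> 0 = 0 \<longrightarrow>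
        continuous_map (subtopology \<tau> {f \<in> D. range (apply_bcontfun f) \<subseteq> {a..b}}) \<tau>
          (\<lambda>f. Bcontfun (\<lambda>x. \<phi> (apply_bcontfun f x)))) \<and>
     continuous_map \<tau> (top_of_set C0) (generator P) \<and>
     (\<exists>B. barrel \<tau> B \<and>
        (\<forall>c>0. bdd_above ((\<lambda>f. norm (hamiltonian P f)) ` ((\<lambda>g. c *\<^sub>R g) ` B))))"

section \<open>The empirical process and its rate function\<close>

definition path_of :: "(real \<Rightarrow> 'w \<Rightarrow> 'a) \<Rightarrow> 'w \<Rightarrow> real \<Rightarrow> 'a" where
  "path_of X \<omega> = (\<lambda>t\<in>{0..}. X t \<omega>)"

text \<open>The Borel sets of the Skorokhod space of a separable metric space are generated by the
  evaluations, so the law of a cadlag process is its law on the product space.\<close>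

definition independent_copies ::
  "'w measure \<Rightarrow> (real \<Rightarrow> 'w \<Rightarrow> 'a::metric_space) \<Rightarrow>
   'v measure \<Rightarrow> (nat \<Rightarrow> real \<Rightarrow> 'v \<Rightarrow> 'a) \<Rightarrow> bool" where
  "independent_copies M X N Y \<longleftrightarrow> prob_space N \<and>
     (\<forall>i. \<forall>\<omega>\<in>space N. cadlag euclidean (\<lambda>t. Y i t \<omega>)) \<and>
     prob_space.indep_vars N (\<lambda>_. PiM {0..} (\<lambda>_. borel)) (\<lambda>i. path_of (Y i)) UNIV \<and>
     (\<forall>i. distr N (PiM {0..} (\<lambda>_. borel)) (path_of (Y i)) =
          distr M (PiM {0..} (\<lambda>_. borel)) (path_of X))"

text \<open>The image of the uniform distribution on the indices \<open>i < n\<close> under \<open>i \<mapsto> Y i t \<omega>\<close>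
  is the average of the Dirac measures at the points \<open>Y i t \<omega>\<close>.\<close>

definition empirical_process ::
  "(nat \<Rightarrow> real \<Rightarrow> 'v \<Rightarrow> 'a::metric_space) \<Rightarrow> nat \<Rightarrow> 'v \<Rightarrow> real \<Rightarrow> 'a measure" where
  "empirical_process Y n \<omega> =
     (\<lambda>t\<in>{0..}. distr (uniform_count_measure {..<n}) borel (\<lambda>i. Y i t \<omega>))"

definition log_semigroup ::
  "(real \<Rightarrow> 'a::metric_space \<Rightarrow> 'a measure) \<Rightarrow> real \<Rightarrow> ('a \<Rightarrow>\<^sub>C real) \<Rightarrow> 'a \<Rightarrow> real" where
  "log_semigroup P t f x = ln (\<integral>y. exp (apply_bcontfun f y) \<partial>P t x)"

text \<open>\<open>conditional_rate P t \<nu>\<^sub>2 \<nu>\<^sub>1\<close> is \<open>I\<^sub>t(\<nu>\<^sub>2 | \<nu>\<^sub>1)\<close>.\<close>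

definition conditional_rate ::
  "(real \<Rightarrow> 'a::metric_space \<Rightarrow> 'a measure) \<Rightarrow> real \<Rightarrow> 'a measure \<Rightarrow> 'a measure \<Rightarrow> ereal" where
  "conditional_rate P t \<nu>\<^sub>2 \<nu>\<^sub>1 =
     (SUP f. ereal ((\<integral>x. apply_bcontfun f x \<partial>\<nu>\<^sub>2) - (\<integral>x. log_semigroup P t f x \<partial>\<nu>\<^sub>1)))"

definition partitions :: "(nat \<times> (nat \<Rightarrow> real)) set" where
  "partitions = {(k, t). t 0 = 0 \<and> strict_mono_on {..k} t}"

definition path_rate ::
  "(real \<Rightarrow> 'a::metric_space \<Rightarrow> 'a measure) \<Rightarrow> 'a measure \<Rightarrow> (real \<Rightarrow> 'a measure) \<Rightarrow> ereal" where
  "path_rate P P0 \<nu> =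
     (if \<nu> \<in> continuous_paths weak_topology
      then relative_entropy (\<nu> 0) P0 +
        (SUP (k, t)\<in>partitions.
           \<Sum>i=1..k. conditional_rate P (t i - t (i - 1)) (\<nu> (t i)) (\<nu> (t (i - 1))))
      else \<infinity>)"

section \<open>The Lagrangian\<close>

text \<open>Only the values on \<open>topspace \<tau>\<close> of an element of the dual matter.\<close>

definition dual_space :: "'b::real_vector topology \<Rightarrow> ('b \<Rightarrow> real) set" where
  "dual_space \<tau> = {u. continuous_map \<tau> euclideanreal u \<and>
     (\<forall>f\<in>topspace \<tau>. \<forall>g\<in>topspace \<tau>. u (f + g) = u f + u g) \<and>
     (\<forall>c. \<forall>f\<in>topspace \<tau>. u (c *\<^sub>R f) = c * u f)}"

text \<open>\<open>has_velocity \<tau> \<nu> u\<close>: the curve \<open>u\<close> qualifies as \<open>\<nu>\<close>'s derivative \<open>s \<mapsto> \<nu>'(s)\<close>.\<close>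

definition has_velocity ::
  "('a::metric_space \<Rightarrow>\<^sub>C real) topology \<Rightarrow> (real \<Rightarrow> 'a measure) \<Rightarrow>
   (real \<Rightarrow> ('a \<Rightarrow>\<^sub>C real) \<Rightarrow> real) \<Rightarrow> bool" where
  "has_velocity \<tau> \<nu> u \<longleftrightarrow>
     (\<forall>s\<ge>0. u s \<in> dual_space \<tau>) \<and>
     (\<forall>f\<in>topspace \<tau>. (\<lambda>s. u s f) \<in> borel_measurable (lebesgue_on {0..})) \<and>
     (\<forall>f\<in>topspace \<tau>. \<forall>t\<ge>0. (\<integral>\<^sup>+s\<in>{0..t}. ennreal \<bar>u s f\<bar> \<partial>lebesgue) < \<infinity>) \<and>
     (\<forall>f\<in>topspace \<tau>. \<forall>t\<ge>0.
        (\<integral>x. apply_bcontfun f x \<partial>\<nu> t) - (\<integral>x. apply_bcontfun f x \<partial>\<nu> 0)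
          = (LINT s:{0..t}|lebesgue. u s f))"

definition AC_paths :: "('a::metric_space \<Rightarrow>\<^sub>C real) topology \<Rightarrow> (real \<Rightarrow> 'a measure) set" where
  "AC_paths \<tau> = {\<nu> \<in> continuous_paths weak_topology. \<exists>u. has_velocity \<tau> \<nu> u}"

definition lagrangian ::
  "(real \<Rightarrow> 'a::metric_space \<Rightarrow> 'a measure) \<Rightarrow> ('a \<Rightarrow>\<^sub>C real) set \<Rightarrow>
   'a measure \<Rightarrow> (('a \<Rightarrow>\<^sub>C real) \<Rightarrow> real) \<Rightarrow> ereal" where
  "lagrangian P D \<mu> u = (SUP f\<in>D. ereal (u f - (\<integral>x. apply_bcontfun (hamiltonian P f) x \<partial>\<mu>)))"

end

theory Submission
  imports Defs
begin

text \<open>Both \<open>\<integral> \<L>(\<nu>, \<nu>') ds\<close> and the supremum over partitions (the action below) are compared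
  increment by increment with a monotone function of time, using that \<open>V(t) f = ln (S(t) e\<^sup>f)\<close>.

  Lower bound. For \<open>f \<in> D\<close> one has \<open>V(t) f = f + t Hf + o(t)\<close> uniformly, so the action of \<open>\<nu>\<close> on
  \<open>[x, y]\<close> dominates \<open>\<langle>f, \<nu>(y)\<rangle> - \<langle>f, \<nu>(x)\<rangle> - \<integral> \<langle>Hf, \<nu>(r)\<rangle> dr\<close>. The Henstock lemma turns these bounds
  into one for the integral of the supremum over a countable dense set of \<open>f\<close>, which is the
  Lagrangian. If the action is finite, the bounds for \<open>c f\<close> with \<open>c \<rightarrow> \<infinity>\<close> show that \<open>\<langle>f, \<nu>(t)\<rangle>\<close> has a
  density; the barrel bounds the densities by an integrable function of time, so that at almost every
  time they extend to an element of the dual of \<open>D\<close>.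

  Upper bound. Although \<open>V(t) f\<close> need not lie in \<open>D\<close>, the function \<open>exp (V(t) f) - 1 = S(t) (exp f - 1)\<close> lies in
  the domain of the generator, and is approximated in graph norm by elements of \<open>D\<close>. Hence
  \<open>r \<mapsto> \<langle>V(t - r) f, \<nu>(r)\<rangle>\<close> increases by at most the integral of the Lagrangian, first for \<open>f \<in> D\<close>
  and then, by density, for all bounded continuous \<open>f\<close>.\<close>

section \<open>Real analysis\<close>

text \<open>The action is at first known only as an increasing function of time, with no continuity,
  so its derivative cannot simply be compared with the Lagrangian. All comparisons are therefore
  between increments over intervals. The same obstacle governs the construction of a velocity:
  domination of \<open>c F\<close> by a bounded increasing function plus a linear one, for a single
  \<open>c\<close>, leaves room for a singular part of \<open>F\<close>, of size at most a constant
  over \<open>c\<close>. Only the bounds for all \<open>c\<close> together exclude it.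

  The second obstacle is that \<open>e^f\<close> need not vanish at infinity and
  \<open>V(t) f\<close> need not lie in \<open>D\<close>. Everything is thus written through
  \<open>g = e^f - 1\<close>: \<open>V(t) f = ln (1 + S(t) g)\<close> and
  \<open>Hf = A g / (1 + g)\<close>, expressions that make sense whenever \<open>g\<close> is in the
  domain of the generator and \<open>1 + g\<close> has a positive lower bound.

  The third is that the density of \<open><f, \<nu> t>\<close> is determined only up to a null set
  depending on \<open>f\<close>. Linearity in \<open>f\<close> is therefore secured first on a
  countable rational vector space, and only then extended to \<open>D\<close>, with the barrel as
  substitute for the unit ball of a norm.\<close>

lemma mono_if_locally_mono:
  fixes G :: "real \<Rightarrow> real"
  assumes "0 < d" "a \<le> b"
    and loc: "\<And>x y. a \<le> x \<Longrightarrow> x \<le> y \<Longrightarrow> y \<le> b \<Longrightarrow> y - x < d \<Longrightarrow> G x \<le> G y"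
  shows "G a \<le> G b"
proof -
  have "G x \<le> G y" if "a \<le> x" "x \<le> y" "y \<le> b" "y - x < real n * (d / 2)" for n x y
    using that
  proof (induction n arbitrary: y)
    case 0
    then show ?case by simp
  next
    case (Suc n)
    \<comment> \<open>Half steps keep each local increment strictly below \<open>d\<close>, and
      clipping at \<open>x\<close> ends the recursion. In both action bounds the lemma sums
      estimates over short intervals, whose errors a linear term of \<open>G\<close>
      absorbs.\<close>
    define z where "z = max x (y - d / 2)"
    have "G x \<le> G z"
    proof (cases "z = x")
      case False
      then show ?thesis
        using Suc.prems assms(1) by (intro Suc.IH) (auto simp: z_def algebra_simps)
    qed simp
    also have "G z \<le> G y"
      using Suc.prems assms(1) by (intro loc) (auto simp: z_def)
    finally show ?case .
  qed
  moreover obtain n where "b - a < real n * (d / 2)"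
    using assms(1) by (metis half_gt_zero reals_Archimedean3)
  ultimately show ?thesis using assms(2) by blast
qed

lemma absolutely_integrable_MAX:
  fixes g :: "'i \<Rightarrow> real \<Rightarrow> real"
  assumes "finite I" "I \<noteq> {}" and "\<And>i. i \<in> I \<Longrightarrow> g i absolutely_integrable_on S"
  shows "(\<lambda>x. MAX i\<in>I. g i x) absolutely_integrable_on S"
  using assms
proof (induction I rule: finite_ne_induct)
  case (singleton i)
  then show ?case by simp
next
  case (insert i I)
  have "(\<lambda>x. max (g i x) (MAX i\<in>I. g i x)) absolutely_integrable_on S"
    using insert by (intro absolutely_integrable_max_1) auto
  then show ?case using insert by simp
qed

text \<open>On a division that is fine for every \<open>g i\<close> the Henstock lemma lets the index attaining the
  maximum be chosen separately on each interval.\<close>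

lemma integral_MAX_le:
  fixes g :: "'i \<Rightarrow> real \<Rightarrow> real" and m :: "real \<Rightarrow> real"
  assumes I: "finite I" "I \<noteq> {}" and "a \<le> b"
    and int: "\<And>i. i \<in> I \<Longrightarrow> g i absolutely_integrable_on {a..b}"
    and le: "\<And>i x y. i \<in> I \<Longrightarrow> a \<le> x \<Longrightarrow> x \<le> y \<Longrightarrow> y \<le> b \<Longrightarrow> integral {x..y} (g i) \<le> m y - m x"
  shows "integral {a..b} (\<lambda>x. MAX i\<in>I. g i x) \<le> m b - m a"
proof (rule field_le_epsilon)
  fix e :: real assume "0 < e"
  \<comment> \<open>One error for each \<open>g i\<close> and one for their maximum.\<close>
  define d where "d = e / (real (card I) + 1)"
  have "0 < d" using \<open>0 < e\<close> by (simp add: d_def add_pos_nonneg)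
  let ?G = "\<lambda>x. MAX i\<in>I. g i x"
  define fine_for where "fine_for f \<gamma> \<longleftrightarrow> gauge \<gamma> \<and>
      (\<forall>p. p tagged_partial_division_of {a..b} \<longrightarrow> \<gamma> fine p \<longrightarrow>
        (\<Sum>(x,k)\<in>p. \<bar>measure lborel k * f x - integral k f\<bar>) < d)"
    for f :: "real \<Rightarrow> real" and \<gamma>
  have hk: "\<exists>\<gamma>. fine_for f \<gamma>" if "f absolutely_integrable_on {a..b}" for f :: "real \<Rightarrow> real"
  proof -
    have "f integrable_on cbox a b"
      using that by (simp add: absolutely_integrable_on_def)
    then show ?thesis
    proof (rule Henstock_lemma[OF _ \<open>0 < d\<close>])
      fix \<gamma> assume "gauge \<gamma>" and "\<And>p. p tagged_partial_division_of cbox a b \<Longrightarrow> \<gamma> fine p \<Longrightarrow>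
        (\<Sum>(x,k)\<in>p. norm (measure lborel k *\<^sub>R f x - integral k f)) < d"
      then have "fine_for f \<gamma>"
        by (simp only: fine_for_def box_real real_norm_def real_scaleR_def) simp
      then show ?thesis by (intro exI[of _ \<gamma>])
    qed
  qed
  have G: "?G absolutely_integrable_on {a..b}"
    by (intro absolutely_integrable_MAX I int)
  obtain \<gamma>G where \<gamma>G: "fine_for ?G \<gamma>G"
    using hk[OF G] by auto
  obtain \<gamma> where \<gamma>: "\<And>i. i \<in> I \<Longrightarrow> fine_for (g i) (\<gamma> i)"
    using hk[OF int] by metis
  have "gauge (\<lambda>x. \<gamma>G x \<inter> (\<Inter>i\<in>I. \<gamma> i x))"
    using \<gamma>G \<gamma> I(1) unfolding fine_for_def gauge_def by (auto intro!: open_Int open_INT)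
  from fine_division_exists_real[OF this] obtain p where
    p: "p tagged_division_of {a..b}" "(\<lambda>x. \<gamma>G x \<inter> (\<Inter>i\<in>I. \<gamma> i x)) fine p" by blast
  have p': "p tagged_partial_division_of {a..b}" using p(1) by (simp add: tagged_division_of_def)
  have "\<gamma>G fine p" "\<And>i. i \<in> I \<Longrightarrow> \<gamma> i fine p"
    using p(2) by (fastforce simp: fine_def)+
  then have bG: "(\<Sum>(x,k)\<in>p. \<bar>measure lborel k * ?G x - integral k ?G\<bar>) < d"
    and bg: "\<And>i. i \<in> I \<Longrightarrow> (\<Sum>(x,k)\<in>p. \<bar>measure lborel k * g i x - integral k (g i)\<bar>) < d"
    using \<gamma>G \<gamma> p' by (simp_all add: fine_for_def)
  have fin: "finite p" using p(1) by auto
  have K: "x \<in> K \<and> K = {Inf K..Sup K} \<and> a \<le> Inf K \<and> Inf K \<le> Sup K \<and> Sup K \<le> b" if "(x, K) \<in> p" for x K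
  proof -
    from that p(1) obtain u v where "K = cbox u v" "x \<in> K" "K \<subseteq> {a..b}"
      by (metis tagged_division_ofD(2,3,4))
    then show ?thesis by auto
  qed
  have "integral {a..b} ?G = (\<Sum>(x,k)\<in>p. integral k ?G)"
    using G p(1)
    by (intro integral_combine_tagged_division_topdown[of _ a b, simplified])
       (auto simp: absolutely_integrable_on_def)
  also have "\<dots> \<le> (\<Sum>(x,k)\<in>p. (m (Sup k) - m (Inf k)) + ((\<Sum>i\<in>I. \<bar>measure lborel k * g i x - integral k (g i)\<bar>)
      + \<bar>measure lborel k * ?G x - integral k ?G\<bar>))"
  proof (rule sum_mono, clarify)
    fix x k assume xk: "(x, k) \<in> p"
    \<comment> \<open>At the tag \<open>x\<close> the maximum is the value of one
      \<open>g j\<close>, so the integral of the maximum over \<open>k\<close> is within two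
      Henstock errors of the integral of \<open>g j\<close>. As \<open>j\<close> varies with the
      interval, its error is bounded by the sum over all \<open>i\<close>.\<close>
    have "Max ((\<lambda>i. g i x) ` I) \<in> (\<lambda>i. g i x) ` I" using I by (intro Max_in) auto
    then obtain j where j: "j \<in> I" "?G x = g j x" by auto
    have "\<bar>measure lborel k * g j x - integral k (g j)\<bar> \<le> (\<Sum>i\<in>I. \<bar>measure lborel k * g i x - integral k (g i)\<bar>)"
      using j(1) I(1) by (intro member_le_sum) auto
    moreover have "integral k (g j) \<le> m (Sup k) - m (Inf k)"
      using le[OF j(1), of "Inf k" "Sup k"] K[OF xk] by metis
    ultimately show "integral k ?G \<le> (m (Sup k) - m (Inf k)) + ((\<Sum>i\<in>I. \<bar>measure lborel k * g i x - integral k (g i)\<bar>)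
      + \<bar>measure lborel k * ?G x - integral k ?G\<bar>)"
      unfolding j(2) by linarith
  qed
  also have "\<dots> = (m b - m a) + ((\<Sum>i\<in>I. \<Sum>(x,k)\<in>p. \<bar>measure lborel k * g i x - integral k (g i)\<bar>)
      + (\<Sum>(x,k)\<in>p. \<bar>measure lborel k * ?G x - integral k ?G\<bar>))"
    using additive_tagged_division_1[OF \<open>a \<le> b\<close> p(1), of m]
    by (subst sum.swap) (simp add: split_def sum.distrib)
  also have "\<dots> \<le> (m b - m a) + ((\<Sum>i\<in>I. d) + d)"
    using bG bg by (intro add_mono sum_mono order_refl less_imp_le) auto
  also have "(\<Sum>i\<in>I. d) + d = (real (card I) + 1) * d"
    by (simp add: algebra_simps)
  also have "\<dots> = e"
    using of_nat_0_le_iff[of "card I", where ?'a = real] by (simp add: d_def del: of_nat_0_le_iff)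
  finally show "integral {a..b} ?G \<le> m b - m a + e" .
qed

section \<open>Stieltjes measures and their densities\<close>

lemma emeasure_interval_measure_lincomb:
  fixes F G :: "real \<Rightarrow> real"
  assumes F: "mono F" "\<And>x. continuous (at_right x) F"
    and G: "mono G" "\<And>x. continuous (at_right x) G"
    and c: "0 \<le> c" "0 \<le> d" and A: "A \<in> sets borel"
  shows "emeasure (interval_measure (\<lambda>x. c * F x + d * G x)) A
    = ennreal c * emeasure (interval_measure F) A + ennreal d * emeasure (interval_measure G) A"
proof -
  let ?\<mu> = "\<lambda>A. ennreal c * emeasure (interval_measure F) A + ennreal d * emeasure (interval_measure G) A"
  \<comment> \<open>The right-hand side as a measure, built by hand so that the uniqueness theorem
    can compare it with the Stieltjes measure on half-open intervals.\<close>
  define N where "N = measure_of (UNIV :: real set) (sets borel) ?\<mu>"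
  have [simp]: "sets N = sets borel"
    unfolding N_def by (metis sets.sigma_sets_eq sets_measure_of space_borel subset_UNIV Pow_UNIV)
  have N: "emeasure N A = ?\<mu> A" if "A \<in> sets borel" for A
    unfolding N_def
  proof (rule emeasure_measure_of_sigma[OF _ _ _ that])
    show "sigma_algebra UNIV (sets (borel :: real measure))"
      using sets.sigma_algebra_axioms[of "borel :: real measure"] by simp
    show "positive (sets borel) ?\<mu>"
      by (simp add: positive_def)
    show "countably_additive (sets borel) ?\<mu>"
    proof (rule countably_additiveI)
      fix A :: "nat \<Rightarrow> real set" assume A: "range A \<subseteq> sets borel" "disjoint_family A"
      have "(\<Sum>i. ?\<mu> (A i)) = (\<Sum>i. ennreal c * emeasure (interval_measure F) (A i))
          + (\<Sum>i. ennreal d * emeasure (interval_measure G) (A i))"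
        by (intro suminf_add[symmetric] summableI)
      also have "\<dots> = ?\<mu> (\<Union>i. A i)"
        using A by (simp add: suminf_emeasure)
      finally show "(\<Sum>i. ?\<mu> (A i)) = ?\<mu> (\<Union>i. A i)" .
    qed
  qed
  have FG: "mono (\<lambda>x. c * F x + d * G x)" "\<And>x. continuous (at_right x) (\<lambda>x. c * F x + d * G x)"
    using F G c by (auto intro!: monoI add_mono mult_left_mono continuous_intros dest: monoD)
  have Ioc: "emeasure (interval_measure (\<lambda>x. c * F x + d * G x)) {x<..y} = emeasure N {x<..y}" for x y
  proof -
    have "ennreal ((c * F y + d * G y) - (c * F x + d * G x)) =
        ennreal c * ennreal (F y - F x) + ennreal d * ennreal (G y - G x)" if "x \<le> y"
    proof -
      have "0 \<le> F y - F x" "0 \<le> G y - G x" using F(1) G(1) that by (simp_all add: monoD)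
      moreover have "(c * F y + d * G y) - (c * F x + d * G x) = c * (F y - F x) + d * (G y - G x)"
        by (simp add: algebra_simps)
      ultimately show ?thesis
        using c by (simp only: ennreal_plus ennreal_mult mult_nonneg_nonneg)
    qed
    then show ?thesis
      using emeasure_interval_measure_Ioc_eq[OF monoD[OF F(1)] F(2)]
        emeasure_interval_measure_Ioc_eq[OF monoD[OF G(1)] G(2)]
        emeasure_interval_measure_Ioc_eq[OF monoD[OF FG(1)] FG(2)]
      by (cases "x \<le> y") (simp_all add: N)
  qed
  have "interval_measure (\<lambda>x. c * F x + d * G x) = N"
  proof (rule measure_eqI_generator_eq[where \<Omega> = UNIV and E = "range (\<lambda>(x, y). {x<..y::real})"
        and A = "\<lambda>n. {- real n<..real n}"])
    show "range (\<lambda>(x, y). {x<..y::real}) \<subseteq> Pow UNIV" by simp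
    show "emeasure (interval_measure (\<lambda>x. c * F x + d * G x)) X = emeasure N X"
      if "X \<in> range (\<lambda>(x, y). {x<..y::real})" for X
      using that Ioc by auto
    show "range (\<lambda>n. {- real n<..real n}) \<subseteq> range (\<lambda>(x, y). {x<..y::real})" by auto
    show "Int_stable (range (\<lambda>(x, y). {x<..y::real}))"
      by (auto simp: Int_stable_def image_iff)
    show "(\<Union>n. {- real n<..real n}) = UNIV"
    proof safe
      fix x :: real
      obtain n where "\<bar>x\<bar> < real n" using reals_Archimedean2 by blast
      then show "x \<in> (\<Union>n. {- real n<..real n})" by (intro UN_I[of n]) auto
    qed simp
    show "emeasure (interval_measure (\<lambda>x. c * F x + d * G x)) {- real n<..real n} \<noteq> \<infinity>" for n
      using emeasure_interval_measure_Ioc_eq[OF monoD[OF FG(1)] FG(2)] by simp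
  qed (auto simp: borel_sigma_sets_Ioc)
  then show ?thesis using N[OF A] by simp
qed

lemma emeasure_interval_measure_add:
  fixes F G :: "real \<Rightarrow> real"
  assumes "mono F" "\<And>x. continuous (at_right x) F" "mono G" "\<And>x. continuous (at_right x) G"
    and "A \<in> sets borel"
  shows "emeasure (interval_measure (\<lambda>x. F x + G x)) A
    = emeasure (interval_measure F) A + emeasure (interval_measure G) A"
  using emeasure_interval_measure_lincomb[of F G 1 1 A] assms by simp

text \<open>A Stieltjes measure requires right-continuity, which is not known for the action as a
  function of time. Passing to the right limit \<open>r\<close> repairs this, and \<open>r\<close>
  stays squeezed between values of \<open>m\<close>.\<close>

lemma right_limit_mono:
  fixes m r :: "real \<Rightarrow> real"
  assumes "mono m" and r_def: "r = (\<lambda>t. INF s\<in>{t<..}. m s)"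
  shows "mono r" "\<And>x. continuous (at_right x) r" "\<And>x. m x \<le> r x" "\<And>x y. x < y \<Longrightarrow> r x \<le> m y"
    "\<And>x. (m \<longlongrightarrow> r x) (at_right x)"
proof -
  have bdd: "bdd_below (m ` {x<..})" for x
    using assms(1) by (auto intro!: bdd_belowI[of _ "m x"] simp: monoD)
  show 1: "m x \<le> r x" for x
    unfolding r_def using assms(1) by (intro cINF_greatest) (auto simp: monoD gt_ex)
  show 2: "r x \<le> m y" if "x < y" for x y
    unfolding r_def using bdd that by (intro cINF_lower) auto
  show 3: "mono r"
    by (rule monoI) (metis 1 2 order.trans order_le_less)
  have ex: "\<exists>s>x. m s < r x + e" if "0 < e" for x e
    using cINF_less_iff[OF _ bdd, of x "r x + e"] that by (auto simp: r_def gt_ex)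
  show lim: "(m \<longlongrightarrow> r x) (at_right x)" for x
  proof (rule order_tendstoI)
    fix a assume "a < r x"
    then show "\<forall>\<^sub>F y in at_right x. a < m y"
      by (auto simp: eventually_at_right_field intro!: exI[of _ "x + 1"] dest: 2 less_le_trans)
  next
    fix a assume "r x < a"
    then obtain s where "s > x" "m s < a" using ex[of "a - r x" x] by auto
    then show "\<forall>\<^sub>F y in at_right x. m y < a"
      using monoD[OF assms(1)]
      by (auto simp: eventually_at_right_field intro!: exI[of _ s] intro: le_less_trans less_imp_le)
  qed
  show "continuous (at_right x) r" for x
    unfolding continuous_within
  proof (rule order_tendstoI)
    fix a assume "a < r x"
    then show "\<forall>\<^sub>F y in at_right x. a < r y"
      using 3 by (auto simp: eventually_at_right_field intro!: exI[of _ "x + 1"] dest: monoD intro: less_le_trans less_imp_le)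
  next
    fix a assume "r x < a"
    then obtain s where "s > x" "m s < a" using ex[of "a - r x" x] by auto
    then show "\<forall>\<^sub>F y in at_right x. r y < a"
      using 2 by (auto simp: eventually_at_right_field intro!: exI[of _ s] intro: le_less_trans)
  qed
qed


lemma obtain_real_density:
  assumes "sigma_finite_measure M" "sigma_finite_measure N" "absolutely_continuous M N" "sets N = sets M"
  obtains l :: "'a \<Rightarrow> real" where "l \<in> borel_measurable M" "\<And>x. 0 \<le> l x"
    "density M (\<lambda>x. ennreal (l x)) = N"
proof
  interpret sigma_finite_measure M by fact
  show "density M (\<lambda>x. ennreal (enn2real (RN_deriv M N x))) = N"
  proof -
    have "AE x in M. RN_deriv M N x = ennreal (enn2real (RN_deriv M N x))"
      using RN_deriv_finite[OF assms(2-4)] by eventually_elim (simp add: less_top)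
    then have "density M (\<lambda>x. ennreal (enn2real (RN_deriv M N x))) = density M (RN_deriv M N)"
      by (intro density_cong) (auto elim!: eventually_mono)
    then show ?thesis using density_RN_deriv[OF assms(3,4)] by simp
  qed
qed auto

text \<open>The function \<open>m\<close> need not be absolutely continuous here. With \<open>\<mu>\<close> the Stieltjes measure of
  \<open>M = m + (C + 1) t\<close>, both \<open>\<mu>\<close> and that of \<open>M + F\<close> may have a singular part, but letting
  \<open>c \<rightarrow> \<infinity>\<close> shows that the singular parts coincide.\<close>

lemma density_of_superlinearly_dominated:
  fixes F m :: "real \<Rightarrow> real"
  assumes m: "mono m" "\<And>x. m x \<le> J" "\<And>x. 0 \<le> m x"
    and F: "\<And>x. continuous (at_right x) F"
    and ac: "\<And>c. 0 < c \<Longrightarrow> \<exists>C\<ge>0. \<forall>x y. x \<le> y \<longrightarrow> c * \<bar>F y - F x\<bar> \<le> m y - m x + C * (y - x)"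
  obtains w :: "real \<Rightarrow> real" where "w \<in> borel_measurable borel"
    "\<And>x y. x \<le> y \<Longrightarrow> set_integrable lborel {x<..y} w"
    "\<And>x y. x \<le> y \<Longrightarrow> F y - F x = (LINT s:{x<..y}|lborel. w s)"
proof -
  define r where "r = (\<lambda>t. INF s\<in>{t<..}. m s)"
  note r = right_limit_mono[OF m(1) r_def]
  have rJ: "0 \<le> r x" "r x \<le> J" for x
    using r(3)[of x] m(3)[of x] r(4)[of x "x+1"] m(2)[of "x+1"] by auto
  \<comment> \<open>The bound for \<open>m\<close> is applied at \<open>x + h\<close> and
    \<open>y + h\<close>. As \<open>h\<close> tends to 0 from the right, \<open>m\<close> turns into
    \<open>r\<close>, while the right-continuous \<open>F\<close> keeps its values.\<close>
  have ac_r: "\<exists>C\<ge>0. \<forall>x y. x \<le> y \<longrightarrow> c * \<bar>F y - F x\<bar> \<le> r y - r x + C * (y - x)" if "0 < c" for c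
  proof -
    obtain C where C: "0 \<le> C" "\<And>x y. x \<le> y \<Longrightarrow> c * \<bar>F y - F x\<bar> \<le> m y - m x + C * (y - x)"
      using ac[OF \<open>0 < c\<close>] by blast
    have "c * \<bar>F y - F x\<bar> \<le> r y - r x + C * (y - x)" if "x \<le> y" for x y
    proof (cases "x = y")
      case False
      have sh: "((\<lambda>h. f (z + h)) \<longlongrightarrow> l) (at_right 0)" if "(f \<longlongrightarrow> l) (at_right z)" for f :: "real \<Rightarrow> real" and z l
        using that by (subst (asm) at_right_to_0) (simp add: filterlim_filtermap add.commute)
      have Fc: "(F \<longlongrightarrow> F z) (at_right z)" for z using F[of z] by (simp add: continuous_within)
      have "((\<lambda>h. m (y + h) - m (x + h) + C * (y - x)) \<longlongrightarrow> r y - r x + C * (y - x)) (at_right 0)"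
        by (intro tendsto_intros sh r(5))
      moreover have "((\<lambda>h. c * \<bar>F (y + h) - F (x + h)\<bar>) \<longlongrightarrow> c * \<bar>F y - F x\<bar>) (at_right 0)"
        by (intro tendsto_intros sh Fc)
      moreover have "c * \<bar>F (y + h) - F (x + h)\<bar> \<le> m (y + h) - m (x + h) + C * (y - x)" for h
        using C(2)[of "x + h" "y + h"] that by simp
      ultimately show ?thesis
        by (intro tendsto_le[OF trivial_limit_at_right_real]) (auto intro: always_eventually)
    qed simp
    with C(1) show ?thesis by blast
  qed
  obtain C where C: "0 \<le> C" "\<And>x y. x \<le> y \<Longrightarrow> \<bar>F y - F x\<bar> \<le> r y - r x + C * (y - x)"
    using ac_r[of 1] by auto
  \<comment> \<open>The slope \<open>C\<close> makes both \<open>M + F\<close> and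
    \<open>M - F\<close> increasing; the extra slope 1 makes Lebesgue measure absolutely continuous
    with respect to the measure of \<open>M\<close> even for \<open>C = 0\<close>.\<close>
  define M where "M = (\<lambda>x. r x + (C + 1) * x)"
  define H where "H = (\<lambda>x. M x + F x)"
  let ?\<mu> = interval_measure
  have contM: "continuous (at_right x) M" for x
    unfolding M_def using r(2) by (intro continuous_intros) auto
  have contH: "continuous (at_right x) H" for x
    unfolding H_def using contM F by (intro continuous_intros) auto
  have contD: "continuous (at_right x) (\<lambda>x. M x - F x)" for x
    using contM F by (intro continuous_intros) auto
  have monoM: "mono M"
    unfolding M_def using C(1) by (intro monoI add_mono mult_left_mono) (auto intro: monoD[OF r(1)])
  have MF: "\<bar>F y - F x\<bar> \<le> M y - M x" if "x \<le> y" for x y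
    using C(2)[OF that] that by (simp add: M_def algebra_simps)
  have monoH: "mono H" and monoDiff: "mono (\<lambda>x. M x - F x)"
    using MF by (auto intro!: monoI simp: H_def abs_le_iff) (smt (verit) MF)+
  have sfM: "sigma_finite_measure (?\<mu> M)" and sfH: "sigma_finite_measure (?\<mu> H)"
    using sigma_finite_interval_measure[OF monoD[OF monoM] contM]
      sigma_finite_interval_measure[OF monoD[OF monoH] contH] by auto
  note IocM = emeasure_interval_measure_Ioc_eq[OF monoD[OF monoM] contM]
    and IocH = emeasure_interval_measure_Ioc_eq[OF monoD[OF monoH] contH]
  interpret \<mu>: sigma_finite_measure "?\<mu> M" by fact
  have id: "mono (\<lambda>x::real. x)" "\<And>x::real. continuous (at_right x) (\<lambda>x. x)"
    by (auto intro!: monoI)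
  have M_eq: "emeasure (?\<mu> M) A = emeasure (?\<mu> r) A + ennreal (C + 1) * emeasure lborel A"
    if "A \<in> sets borel" for A
    using emeasure_interval_measure_lincomb[OF r(1,2) id, of 1 "C + 1" A] C(1) that
    by (simp add: M_def lborel_eq_real)
  have "absolutely_continuous (?\<mu> M) lborel"
  unfolding absolutely_continuous_def
  proof
    fix A assume "A \<in> null_sets (?\<mu> M)"
    then show "A \<in> null_sets lborel"
      using M_eq[of A] C(1) by (auto simp: null_sets_def)
  qed
  then obtain l where l: "l \<in> borel_measurable borel" "\<And>x. 0 \<le> l x" "density (?\<mu> M) (\<lambda>x. ennreal (l x)) = lborel"
    using obtain_real_density[OF sfM lborel.sigma_finite_measure_axioms] by (auto simp: measurable_def)
  \<comment> \<open>The measures of \<open>M + F\<close> and \<open>M - F\<close> add up to twice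
    that of \<open>M\<close>, so a null set of the latter is null for
    \<open>H = M + F\<close>.\<close>
  have "absolutely_continuous (?\<mu> M) (?\<mu> H)"
  unfolding absolutely_continuous_def
  proof
    fix A assume A: "A \<in> null_sets (?\<mu> M)"
    then have [measurable]: "A \<in> sets borel" by auto
    have "emeasure (?\<mu> H) A + emeasure (?\<mu> (\<lambda>x. M x - F x)) A = emeasure (?\<mu> (\<lambda>x. 1 * M x + 1 * M x)) A"
      using monoH contH monoDiff contD by (subst emeasure_interval_measure_add[symmetric]) (auto simp: H_def algebra_simps)
    also have "\<dots> = 0"
      using A monoM contM by (subst emeasure_interval_measure_lincomb) auto
    finally show "A \<in> null_sets (?\<mu> H)" by (auto simp: null_sets_def)
  qed
  then obtain g where g: "g \<in> borel_measurable borel" "\<And>x. 0 \<le> g x" "density (?\<mu> M) (\<lambda>x. ennreal (g x)) = ?\<mu> H"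
    using obtain_real_density[OF sfM sfH] by (auto simp: measurable_def)
  \<comment> \<open>For each \<open>c\<close>, with its constant \<open>K\<close>, the measures of
    \<open>M + F\<close> and \<open>M\<close> differ by at most the Stieltjes measure of
    \<open>(r + K t) / c\<close>. On a Lebesgue null set the latter has mass at most
    \<open>J / c\<close>.\<close>
  have eq: "emeasure (?\<mu> H) A = emeasure (?\<mu> M) A" if A: "A \<in> sets borel" and A0: "emeasure lborel A = 0" for A
  proof -
    have rA: "emeasure (?\<mu> r) A \<le> ennreal J"
    proof -
      have "emeasure (?\<mu> r) A \<le> emeasure (?\<mu> r) (\<Union>n. {- real n<..real n})"
      proof (rule emeasure_mono)
        show "A \<subseteq> (\<Union>n. {- real n<..real n})"
        proof
          fix x :: real
          obtain n where "\<bar>x\<bar> < real n" using reals_Archimedean2 by blast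
          then show "x \<in> (\<Union>n. {- real n<..real n})" by (intro UN_I[of n]) auto
        qed
      qed simp
      also have "\<dots> = (SUP n. emeasure (?\<mu> r) {- real n<..real n})"
        by (intro SUP_emeasure_incseq[symmetric]) (auto simp: incseq_def)
      also have "\<dots> \<le> ennreal J"
      proof (rule SUP_least)
        fix n
        have "r (real n) - r (- real n) \<le> J" using rJ(1)[of "- real n"] rJ(2)[of "real n"] by linarith
        then show "emeasure (?\<mu> r) {- real n<..real n} \<le> ennreal J"
          using emeasure_interval_measure_Ioc[OF _ monoD[OF r(1)] r(2), of "- real n" "real n"]
          by (simp add: ennreal_leI)
      qed
      finally show ?thesis .
    qed
    have "emeasure (?\<mu> H) A \<le> emeasure (?\<mu> M) A + ennreal e \<and> emeasure (?\<mu> M) A \<le> emeasure (?\<mu> H) A + ennreal e"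
      if "0 < e" for e
    proof -
      have J0: "0 \<le> J" using rJ[of 0] by linarith
      \<comment> \<open>Adding 1 to \<open>J\<close> keeps \<open>c\<close> positive when
        \<open>J = 0\<close>, while \<open>J / c\<close> is at most \<open>e\<close>.\<close>
      define c where "c = (J + 1) / e"
      have "0 < c" "1 / c * J \<le> e"
        using that J0 by (simp_all add: c_def field_simps)
      then have c: "0 < c" "ennreal (1 / c) * ennreal J \<le> ennreal e"
        using J0 by (simp_all add: ennreal_mult[symmetric] ennreal_leI)
      from ac_r[OF c(1)] obtain K where K: "0 \<le> K" "\<And>x y. x \<le> y \<Longrightarrow> c * \<bar>F y - F x\<bar> \<le> r y - r x + K * (y - x)" by blast
      define R where "R = (\<lambda>x. 1 / c * r x + K / c * x)"
      have R: "mono R" "\<And>x. continuous (at_right x) R"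
        unfolding R_def using c(1) K(1) r(2)
        by (auto intro!: monoI add_mono mult_left_mono continuous_intros monoD[OF r(1)] divide_right_mono)
      have RF: "\<bar>F y - F x\<bar> \<le> R y - R x" if "x \<le> y" for x y
      proof -
        have "\<bar>F y - F x\<bar> \<le> (r y - r x + K * (y - x)) / c"
          using K(2)[OF that] c(1) by (simp add: pos_le_divide_eq mult.commute)
        also have "\<dots> = R y - R x" by (simp add: R_def add_divide_distrib diff_divide_distrib algebra_simps)
        finally show ?thesis .
      qed
      have "emeasure (?\<mu> R) A = ennreal (1 / c) * emeasure (?\<mu> r) A + ennreal (K / c) * emeasure lborel A"
        unfolding R_def lborel_eq_real
        using c K(1) A by (intro emeasure_interval_measure_lincomb r id) auto
      also have "\<dots> \<le> ennreal e"
        using A0 mult_left_mono[OF rA, of "ennreal (1 / c)"] c(2) by simp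
      finally have Re: "emeasure (?\<mu> R) A \<le> ennreal e" .
      have RF': "mono (\<lambda>x. R x + F x)" "mono (\<lambda>x. R x - F x)"
        "\<And>x. continuous (at_right x) (\<lambda>x. R x + F x)" "\<And>x. continuous (at_right x) (\<lambda>x. R x - F x)"
        using R(2) F by (auto intro!: monoI continuous_intros) (smt (verit) RF)+
      \<comment> \<open>This rests on \<open>H + (R - F) = M + R\<close>, an identity between sums
        of increasing functions; \<open>h2\<close> rests on
        \<open>M + (R + F) = H + R\<close>.\<close>
      have h1: "emeasure (?\<mu> H) A + emeasure (?\<mu> (\<lambda>x. R x - F x)) A = emeasure (?\<mu> M) A + emeasure (?\<mu> R) A"
        using monoH contH monoM contM R RF' A
        by (simp add: emeasure_interval_measure_add[symmetric]) (simp add: H_def algebra_simps)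
      have h2: "emeasure (?\<mu> M) A + emeasure (?\<mu> (\<lambda>x. R x + F x)) A = emeasure (?\<mu> H) A + emeasure (?\<mu> R) A"
        using monoH contH monoM contM R RF' A
        by (simp add: emeasure_interval_measure_add[symmetric]) (simp add: H_def algebra_simps)
      have "emeasure (?\<mu> H) A \<le> emeasure (?\<mu> M) A + emeasure (?\<mu> R) A"
        unfolding h1[symmetric] by simp
      moreover have "emeasure (?\<mu> M) A \<le> emeasure (?\<mu> H) A + emeasure (?\<mu> R) A"
        unfolding h2[symmetric] by simp
      ultimately show ?thesis
        using order_trans[OF _ add_left_mono[OF Re]] by blast
    qed
    note le = this
    show ?thesis
    proof (rule antisym)
      show "emeasure (?\<mu> H) A \<le> emeasure (?\<mu> M) A"
        by (rule ennreal_le_epsilon) (use le in blast)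
      show "emeasure (?\<mu> M) A \<le> emeasure (?\<mu> H) A"
        by (rule ennreal_le_epsilon) (use le in blast)
    qed
  qed
  have [measurable]: "l \<in> borel_measurable borel" "g \<in> borel_measurable borel" by fact+
  \<comment> \<open>The set \<open>Z\<close> is Lebesgue null and carries the part of the measure of
    \<open>M\<close> that is singular to Lebesgue measure. By \<open>eq\<close> the density
    \<open>g\<close> equals 1 almost everywhere on it, so \<open>F\<close> has no singular
    part.\<close>
  define Z where "Z = {x. l x = 0}"
  have Z [measurable]: "Z \<in> sets borel" unfolding Z_def by measurable
  have Z0: "emeasure lborel Z = 0"
  proof -
    have "(\<lambda>x. ennreal (l x) * indicator Z x) = (\<lambda>_. 0)"
      by (auto simp: Z_def fun_eq_iff split: split_indicator)
    then show ?thesis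
      unfolding l(3)[symmetric] by (simp add: emeasure_density)
  qed
  have "density (?\<mu> M) (\<lambda>x. ennreal (g x) * indicator Z x) = density (?\<mu> M) (indicator Z)"
  proof (rule measure_eqI)
    fix A assume "A \<in> sets (density (?\<mu> M) (\<lambda>x. ennreal (g x) * indicator Z x))"
    then have [measurable]: "A \<in> sets borel" by simp
    have "emeasure (density (?\<mu> M) (\<lambda>x. ennreal (g x) * indicator Z x)) A
        = emeasure (density (?\<mu> M) (\<lambda>x. ennreal (g x))) (A \<inter> Z)"
      by (simp add: emeasure_density indicator_inter_arith mult.assoc mult.commute mult.left_commute)
    also have "\<dots> = emeasure (?\<mu> M) (A \<inter> Z)"
      unfolding g(3) using emeasure_mono[of "A \<inter> Z" Z lborel] Z0 by (intro eq) auto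
    also have "\<dots> = emeasure (density (?\<mu> M) (indicator Z)) A"
      by (simp add: emeasure_density indicator_inter_arith[symmetric] Int_commute)
    finally show "emeasure (density (?\<mu> M) (\<lambda>x. ennreal (g x) * indicator Z x)) A
        = emeasure (density (?\<mu> M) (indicator Z)) A" .
  qed simp
  then have gZ: "AE x in ?\<mu> M. ennreal (g x) * indicator Z x = indicator Z x"
    by (subst (asm) \<mu>.density_unique_iff) auto
  \<comment> \<open>Relative to the measure of \<open>M\<close>, the increments of \<open>F\<close>
    have density \<open>g - 1\<close> and Lebesgue measure has density \<open>l\<close>. On
    \<open>Z\<close> the quotient is 0, since division by zero gives 0, in agreement with
    \<open>g = 1\<close> there.\<close>
  define w where "w = (\<lambda>x. (g x - 1) / l x)"
  have [measurable]: "w \<in> borel_measurable borel" unfolding w_def by measurable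
  have "set_integrable lborel {x<..y} w \<and> F y - F x = (LINT s:{x<..y}|lborel. w s)" if "x \<le> y" for x y
  proof -
    have i1: "integrable (?\<mu> M) (indicator {x<..y} :: real \<Rightarrow> real)"
      by (simp add: IocM)
    have mM: "measure (?\<mu> M) {x<..y} = M y - M x" and mH: "measure (?\<mu> H) {x<..y} = H y - H x"
      using measure_interval_measure_Ioc[OF that monoD[OF monoM] contM]
          measure_interval_measure_Ioc[OF that monoD[OF monoH] contH] by auto
    have iH: "integrable (?\<mu> H) (indicator {x<..y} :: real \<Rightarrow> real)"
      by (simp add: IocH)
    then have ig: "integrable (?\<mu> M) (\<lambda>s. g s * indicator {x<..y} s)"
      unfolding g(3)[symmetric] using g(2) by (subst (asm) integrable_density) auto
    have "H y - H x = (\<integral>s. indicator {x<..y} s \<partial>?\<mu> H)"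
      using mH by simp
    also have "\<dots> = (\<integral>s. g s * indicator {x<..y} s \<partial>?\<mu> M)"
      unfolding g(3)[symmetric] using g(2) by (subst integral_density) auto
    finally have Hg: "H y - H x = (\<integral>s. g s * indicator {x<..y} s \<partial>?\<mu> M)" .
    have ae: "AE s in ?\<mu> M. l s * (indicator {x<..y} s * w s) = g s * indicator {x<..y} s - indicator {x<..y} s"
      using gZ
    proof eventually_elim
      case (elim s)
      then show ?case
        by (cases "s \<in> Z") (auto simp: Z_def w_def indicator_def ennreal_eq_1)
    qed
    have "integrable (?\<mu> M) (\<lambda>s. l s * (indicator {x<..y} s * w s))"
      using Bochner_Integration.integrable_diff[OF ig i1] by (subst integrable_cong_AE[OF _ _ ae]) auto
    then have "integrable (density (?\<mu> M) (\<lambda>x. ennreal (l x))) (\<lambda>s. indicator {x<..y} s * w s)"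
      using l(2) by (subst integrable_density) auto
    then have "set_integrable lborel {x<..y} w"
      unfolding l(3) by (simp add: set_integrable_def)
    moreover have "(LINT s:{x<..y}|lborel. w s) = (\<integral>s. indicator {x<..y} s * w s \<partial>density (?\<mu> M) (\<lambda>x. ennreal (l x)))"
      unfolding l(3) by (simp add: set_lebesgue_integral_def)
    then have "(LINT s:{x<..y}|lborel. w s) = (\<integral>s. l s * (indicator {x<..y} s * w s) \<partial>?\<mu> M)"
      using l(2) by (subst (asm) integral_density) auto
    then have "(LINT s:{x<..y}|lborel. w s) = (\<integral>s. g s * indicator {x<..y} s - indicator {x<..y} s \<partial>?\<mu> M)"
      using integral_cong_AE[OF _ _ ae] by simp
    then have "(LINT s:{x<..y}|lborel. w s) = (H y - H x) - (M y - M x)"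
      using ig i1 mM Hg by simp
    ultimately show ?thesis by (simp add: H_def)
  qed
  note w = this
  show ?thesis
    by (rule that[of w]) (use w in simp_all)
qed

section \<open>Bounded continuous functions\<close>

lemma bcontfunI:
  fixes f :: "'a::topological_space \<Rightarrow> real"
  assumes "continuous_on UNIV f" "\<And>x. \<bar>f x\<bar> \<le> c"
  shows "f \<in> bcontfun"
  using assms by (intro bcontfun_normI) auto

lemma abs_apply_le_norm: "\<bar>apply_bcontfun f x\<bar> \<le> norm f" for f :: "'a::topological_space \<Rightarrow>\<^sub>C real"
  using norm_bounded[of f x] by simp

lemma norm_bcontfun_le:
  fixes f :: "'a::topological_space \<Rightarrow>\<^sub>C real"
  shows "(\<And>x. \<bar>apply_bcontfun f x\<bar> \<le> c) \<Longrightarrow> norm f \<le> c"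
  by (rule norm_bound) simp

lemma abs_diff_apply_le: "\<bar>apply_bcontfun f x - apply_bcontfun g x\<bar> \<le> norm (f - g)"
  for f g :: "'a::topological_space \<Rightarrow>\<^sub>C real"
  using abs_apply_le_norm[of "f - g" x] by simp

text \<open>\<open>Bcontfun\<close> returns the intended function only if the composite is bounded
  and continuous. Hence \<open>apply_bcomp\<close> asks for a compact interval that contains the
  range of \<open>f\<close> and on which \<phi> is continuous; for \<open>ln (1 + y)\<close> this
  keeps \<open>f\<close> away from -1.\<close>

definition bcomp :: "(real \<Rightarrow> real) \<Rightarrow> ('a::topological_space \<Rightarrow>\<^sub>C real) \<Rightarrow> 'a \<Rightarrow>\<^sub>C real" where
  "bcomp \<phi> f = Bcontfun (\<lambda>x. \<phi> (apply_bcontfun f x))"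

lemma bcomp_in_bcontfun:
  fixes f :: "'a::topological_space \<Rightarrow>\<^sub>C real" and \<phi> :: "real \<Rightarrow> real"
  assumes "range (apply_bcontfun f) \<subseteq> {a..b}" "continuous_on {a..b} \<phi>"
  shows "(\<lambda>x. \<phi> (apply_bcontfun f x)) \<in> bcontfun"
proof -
  have "bounded (\<phi> ` {a..b})"
    using assms(2) by (intro compact_imp_bounded compact_continuous_image) auto
  then obtain c where "\<forall>y\<in>\<phi> ` {a..b}. norm y \<le> c" unfolding bounded_iff by blast
  then have "\<bar>\<phi> y\<bar> \<le> c" if "y \<in> {a..b}" for y using that by simp
  moreover have "continuous_on UNIV (\<lambda>x. \<phi> (apply_bcontfun f x))"
    by (rule continuous_on_compose2[OF assms(2)]) (use assms(1) in auto)
  ultimately show ?thesis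
    using assms(1) by (intro bcontfunI[where c = c]) (auto simp: image_subset_iff)
qed

lemma apply_bcomp:
  fixes f :: "'a::topological_space \<Rightarrow>\<^sub>C real" and \<phi> :: "real \<Rightarrow> real"
  assumes "range (apply_bcontfun f) \<subseteq> {a..b}" "continuous_on {a..b} \<phi>"
  shows "apply_bcontfun (bcomp \<phi> f) x = \<phi> (apply_bcontfun f x)"
  unfolding bcomp_def using bcomp_in_bcontfun[OF assms] by (simp add: Bcontfun_inverse)

lemma range_subset_norm: "range (apply_bcontfun f) \<subseteq> {- norm f..norm f}" for f :: "'a::topological_space \<Rightarrow>\<^sub>C real"
proof clarify
  fix x show "apply_bcontfun f x \<in> {- norm f..norm f}"
    using abs_apply_le_norm[of f x] by (auto simp: abs_le_iff)
qed

lemma apply_bcomp_continuous: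
  fixes f :: "'a::topological_space \<Rightarrow>\<^sub>C real"
  assumes "continuous_on UNIV \<phi>"
  shows "apply_bcontfun (bcomp \<phi> f) x = \<phi> (apply_bcontfun f x)"
  using range_subset_norm by (rule apply_bcomp) (rule continuous_on_subset[OF assms subset_UNIV])

lemma continuous_on_bcomp:
  fixes a b :: real
  assumes "continuous_on {a..b} \<phi>"
  shows "continuous_on {f :: 'a::topological_space \<Rightarrow>\<^sub>C real. range (apply_bcontfun f) \<subseteq> {a..b}} (bcomp \<phi>)"
proof (rule continuous_onI)
  fix f :: "'a \<Rightarrow>\<^sub>C real" and e :: real
  assume f: "f \<in> {f. range (apply_bcontfun f) \<subseteq> {a..b}}" and "0 < e"
  have "uniformly_continuous_on {a..b} \<phi>"
    using assms by (intro compact_uniformly_continuous) auto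
  then obtain d where d: "0 < d" "\<And>x y. x \<in> {a..b} \<Longrightarrow> y \<in> {a..b} \<Longrightarrow> dist y x < d \<Longrightarrow> dist (\<phi> y) (\<phi> x) < e"
    using \<open>0 < e\<close> unfolding uniformly_continuous_on_def by metis
  show "\<exists>d>0. \<forall>g\<in>{f. range (apply_bcontfun f) \<subseteq> {a..b}}. dist g f < d \<longrightarrow> dist (bcomp \<phi> g) (bcomp \<phi> f) \<le> e"
  proof (intro exI[of _ d] conjI ballI impI d(1))
    fix g :: "'a \<Rightarrow>\<^sub>C real" assume g: "g \<in> {f. range (apply_bcontfun f) \<subseteq> {a..b}}" "dist g f < d"
    show "dist (bcomp \<phi> g) (bcomp \<phi> f) \<le> e"
    proof (rule dist_bound)
      fix x
      have "dist (\<phi> (apply_bcontfun g x)) (\<phi> (apply_bcontfun f x)) < e"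
        using f g dist_fun_lt_imp_dist_val_lt[OF g(2), of x]
        by (intro d(2)) (simp_all add: image_subset_iff)
      then show "dist (apply_bcontfun (bcomp \<phi> g) x) (apply_bcontfun (bcomp \<phi> f) x) \<le> e"
        using f g assms by (simp add: apply_bcomp)
    qed
  qed
qed

text \<open>With \<open>g = e^f - 1\<close> and \<open>h = A g\<close> this is \<open>Hf\<close>;
  with \<open>S t\<close> applied to both it is the time derivative of \<open>V(t) f\<close>. A
  positive lower bound of \<open>1 + g\<close> makes the quotient bounded and stable under
  perturbations of \<open>h\<close> and \<open>g\<close> in sup norm.\<close>

definition quot :: "('a::topological_space \<Rightarrow>\<^sub>C real) \<Rightarrow> ('a \<Rightarrow>\<^sub>C real) \<Rightarrow> 'a \<Rightarrow>\<^sub>C real" where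
  "quot h g = Bcontfun (\<lambda>x. apply_bcontfun h x / (1 + apply_bcontfun g x))"

lemma apply_quot:
  fixes h g :: "'a::topological_space \<Rightarrow>\<^sub>C real"
  assumes "0 < c" "\<And>x. c \<le> 1 + apply_bcontfun g x"
  shows "apply_bcontfun (quot h g) x = apply_bcontfun h x / (1 + apply_bcontfun g x)"
proof -
  have pos: "0 < 1 + apply_bcontfun g x" for x using assms(1) assms(2)[of x] by linarith
  have "(\<lambda>x. apply_bcontfun h x / (1 + apply_bcontfun g x)) \<in> bcontfun"
  proof (rule bcontfunI)
    show "continuous_on UNIV (\<lambda>x. apply_bcontfun h x / (1 + apply_bcontfun g x))"
      using pos by (intro continuous_intros) (auto simp: less_imp_neq[symmetric])
    show "\<bar>apply_bcontfun h x / (1 + apply_bcontfun g x)\<bar> \<le> norm h / c" for x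
      unfolding abs_divide using abs_apply_le_norm[of h x] assms(2)[of x] pos[of x] assms(1)
      by (intro frac_le) auto
  qed
  then show ?thesis unfolding quot_def by (simp add: Bcontfun_inverse)
qed

lemma norm_quot_diff_le:
  fixes h g h' g' :: "'a::topological_space \<Rightarrow>\<^sub>C real"
  assumes c: "0 < c" "\<And>x. c \<le> 1 + apply_bcontfun g x" "\<And>x. c \<le> 1 + apply_bcontfun g' x"
  shows "norm (quot h g - quot h' g') \<le> norm (h - h') / c + norm h' * norm (g - g') / c\<^sup>2"
proof (rule norm_bcontfun_le)
  fix x
  define p q where "p = 1 + apply_bcontfun g x" "q = 1 + apply_bcontfun g' x"
  have pq: "c \<le> p" "c \<le> q" "0 < p" "0 < q" using c(2)[of x] c(3)[of x] c(1) by (auto simp: p_q_def)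
  let ?a = "apply_bcontfun h x" and ?b = "apply_bcontfun h' x"
  have "?a / p - ?b / q = (?a - ?b) / p + ?b * (q - p) / (p * q)"
    using pq by (simp add: field_simps)
  then have "\<bar>?a / p - ?b / q\<bar> \<le> \<bar>(?a - ?b) / p\<bar> + \<bar>?b * (q - p) / (p * q)\<bar>"
    by linarith
  also have "\<bar>(?a - ?b) / p\<bar> \<le> norm (h - h') / c"
    unfolding abs_divide using pq c(1) by (intro frac_le abs_diff_apply_le) auto
  also have "\<bar>?b * (q - p) / (p * q)\<bar> \<le> norm h' * norm (g - g') / c\<^sup>2"
  proof -
    have "\<bar>q - p\<bar> \<le> norm (g - g')"
      using abs_diff_apply_le[of g x g'] by (simp add: p_q_def)
    moreover have "c\<^sup>2 \<le> \<bar>p * q\<bar>"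
      using mult_mono[OF pq(1,2)] pq c(1) by (simp add: power2_eq_square)
    ultimately show ?thesis
      unfolding abs_divide abs_mult[of ?b] using c(1) abs_apply_le_norm[of h' x]
      by (intro frac_le mult_mono) auto
  qed
  finally show "\<bar>apply_bcontfun (quot h g - quot h' g') x\<bar> \<le> norm (h - h') / c + norm h' * norm (g - g') / c\<^sup>2"
    using c by (simp add: apply_quot[of c] p_q_def)
qed

lemma tendsto_quot:
  fixes h g :: "'i \<Rightarrow> 'a::topological_space \<Rightarrow>\<^sub>C real"
  assumes "(h \<longlongrightarrow> h') F" "(g \<longlongrightarrow> g') F" and c: "0 < c" "\<And>x. c \<le> 1 + apply_bcontfun g' x"
    "\<forall>\<^sub>F i in F. \<forall>x. c \<le> 1 + apply_bcontfun (g i) x"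
  shows "((\<lambda>i. quot (h i) (g i)) \<longlongrightarrow> quot h' g') F"
proof (subst LIM_zero_iff[symmetric], rule Lim_null_comparison)
  have "((\<lambda>i. norm (h i - h') / c + norm h' * norm (g i - g') / c\<^sup>2) \<longlongrightarrow> norm (h' - h') / c + norm h' * norm (g' - g') / c\<^sup>2) F"
    using assms(1,2) c(1) by (intro tendsto_intros) auto
  then show "((\<lambda>i. norm (h i - h') / c + norm h' * norm (g i - g') / c\<^sup>2) \<longlongrightarrow> 0) F" by simp
  show "\<forall>\<^sub>F i in F. norm (quot (h i) (g i) - quot h' g') \<le> norm (h i - h') / c + norm h' * norm (g i - g') / c\<^sup>2"
    using c(3) by eventually_elim (intro norm_quot_diff_le c(1,2), auto)
qed

lemma continuous_on_quot:
  fixes h g :: "real \<Rightarrow> 'a::topological_space \<Rightarrow>\<^sub>C real"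
  assumes "continuous_on T h" "continuous_on T g" and "0 < c" "\<And>t x. t \<in> T \<Longrightarrow> c \<le> 1 + apply_bcontfun (g t) x"
  shows "continuous_on T (\<lambda>t. quot (h t) (g t))"
  unfolding continuous_on_def
proof
  fix t assume "t \<in> T"
  show "((\<lambda>t. quot (h t) (g t)) \<longlongrightarrow> quot (h t) (g t)) (at t within T)"
    using assms \<open>t \<in> T\<close>
    by (intro tendsto_quot[where c = c]) (auto simp: continuous_on_def eventually_at_filter)
qed

section \<open>Pairing of bounded continuous functions with probability measures\<close>

lemma prob_algebraD:
  assumes "\<mu> \<in> space (prob_algebra borel)"
  shows "prob_space \<mu>" "sets \<mu> = sets borel" "space \<mu> = UNIV"
  using assms sets_eq_imp_space_eq[of \<mu> borel] by (auto simp: space_prob_algebra)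

abbreviation pairing :: "('a::topological_space \<Rightarrow>\<^sub>C real) \<Rightarrow> 'a measure \<Rightarrow> real"
  (\<open>\<langle>_, _\<rangle>\<close>) where
  "\<langle>f, \<mu>\<rangle> \<equiv> \<integral>x. apply_bcontfun f x \<partial>\<mu>"

lemma borel_measurable_bcontfun [measurable]:
  "apply_bcontfun f \<in> borel_measurable borel" for f :: "'a::topological_space \<Rightarrow>\<^sub>C real"
  by (intro borel_measurable_continuous_onI) simp

context
  fixes \<mu> :: "'a::topological_space measure"
  assumes \<mu>: "\<mu> \<in> space (prob_algebra borel)"
begin

lemma borel_measurable_bcontfun_prob [measurable]:
  "apply_bcontfun f \<in> borel_measurable \<mu>" for f :: "'a \<Rightarrow>\<^sub>C real"
  using borel_measurable_bcontfun measurable_cong_sets[OF prob_algebraD(2)[OF \<mu>] refl] by blast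

lemma integrable_bcontfun: "integrable \<mu> (apply_bcontfun f)" for f :: "'a \<Rightarrow>\<^sub>C real"
proof -
  interpret prob_space \<mu> by (rule prob_algebraD[OF \<mu>])
  show ?thesis
    by (rule integrable_const_bound[where B = "norm f"]) (auto simp: abs_apply_le_norm borel_measurable_bcontfun_prob)
qed

lemma integral_bcontfun_add:
  "\<langle>f + g, \<mu>\<rangle> = \<langle>f, \<mu>\<rangle> + \<langle>g, \<mu>\<rangle>"
  for f g :: "'a \<Rightarrow>\<^sub>C real"
  using integrable_bcontfun by simp

lemma integral_bcontfun_diff:
  "\<langle>f - g, \<mu>\<rangle> = \<langle>f, \<mu>\<rangle> - \<langle>g, \<mu>\<rangle>"
  for f g :: "'a \<Rightarrow>\<^sub>C real"
  using integrable_bcontfun by simp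

lemma integral_bcontfun_scaleR:
  "\<langle>c *\<^sub>R f, \<mu>\<rangle> = c * \<langle>f, \<mu>\<rangle>"
  for f :: "'a \<Rightarrow>\<^sub>C real"
  by simp

lemma integral_prob_bounds:
  fixes f :: "'a \<Rightarrow> real"
  assumes "\<And>x. f x \<le> c" "f \<in> borel_measurable \<mu>" "\<And>x. d \<le> f x"
  shows "(\<integral>x. f x \<partial>\<mu>) \<le> c" "d \<le> (\<integral>x. f x \<partial>\<mu>)"
proof -
  interpret prob_space \<mu> by (rule prob_algebraD[OF \<mu>])
  have "integrable \<mu> f"
    using assms by (intro integrable_const_bound[where B = "max \<bar>c\<bar> \<bar>d\<bar>"] assms(2) AE_I2) (smt (verit) real_norm_def)
  then show "(\<integral>x. f x \<partial>\<mu>) \<le> c" "d \<le> (\<integral>x. f x \<partial>\<mu>)"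
    using assms by (auto intro!: integral_le_const integral_ge_const)
qed

lemma abs_integral_bcontfun_le: "\<bar>\<langle>f, \<mu>\<rangle>\<bar> \<le> norm f" for f :: "'a \<Rightarrow>\<^sub>C real"
proof -
  have "- norm f \<le> apply_bcontfun f x" "apply_bcontfun f x \<le> norm f" for x
    using abs_apply_le_norm[of f x] by (auto simp: abs_le_iff)
  from integral_prob_bounds[OF this(2) _ this(1)] show ?thesis
    using borel_measurable_bcontfun_prob by (auto simp: abs_le_iff minus_le_iff)
qed

lemma abs_integral_bcontfun_diff_le:
  "\<bar>\<langle>f, \<mu>\<rangle> - \<langle>g, \<mu>\<rangle>\<bar> \<le> norm (f - g)" for f g :: "'a \<Rightarrow>\<^sub>C real"
  using abs_integral_bcontfun_le[of "f - g"] integral_bcontfun_diff[of f g] by simp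

lemma integral_bind_bcontfun:
  fixes f :: "'b::topological_space \<Rightarrow>\<^sub>C real"
  assumes K: "K \<in> borel \<rightarrow>\<^sub>M prob_algebra borel"
  shows "(\<integral>y. apply_bcontfun f y \<partial>(\<mu> \<bind> K)) = (\<integral>x. \<langle>f, K x\<rangle> \<partial>\<mu>)"
proof -
  interpret prob_space \<mu> by (rule prob_algebraD[OF \<mu>])
  have K': "K \<in> \<mu> \<rightarrow>\<^sub>M prob_algebra borel" "K \<in> \<mu> \<rightarrow>\<^sub>M subprob_algebra borel"
    using K measurable_cong_sets[OF prob_algebraD(2)[OF \<mu>] refl] measurable_prob_algebraD by blast+
  note [measurable] = K'(2)
  have Kx: "K x \<in> space (prob_algebra borel)" for x
    using measurable_space[OF K] by simp
  have sp: "space \<mu> \<noteq> {}" using prob_algebraD(3)[OF \<mu>] by simp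
  have "(\<integral>y. apply_bcontfun f y \<partial>(\<mu> \<bind> K)) = (\<integral>M'. (\<integral>y. apply_bcontfun f y \<partial>M') \<partial>distr \<mu> (subprob_algebra borel) K)"
    unfolding bind_nonempty''[OF K'(2) sp]
  proof (rule integral_join[where N = borel and B = "norm f" and B' = 1])
    show "finite_measure (distr \<mu> (subprob_algebra borel) K)"
      by (intro prob_space.finite_measure prob_space_distr K'(2))
    show "AE M' in distr \<mu> (subprob_algebra borel) K. emeasure M' (space M') \<le> ennreal 1"
      by (rule AE_I2) (auto simp: space_subprob_algebra intro: subprob_space.emeasure_space_le_1)
  qed (auto simp: abs_apply_le_norm)
  also have "\<dots> = (\<integral>x. \<langle>f, K x\<rangle> \<partial>\<mu>)"
    by (intro integral_distr K'(2)) measurable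
  finally show ?thesis .
qed

end

section \<open>Feller semigroups and their generators\<close>

lemma C0D:
  assumes "f \<in> C0" "0 < e"
  shows "\<exists>K. compact K \<and> (\<forall>x. x \<notin> K \<longrightarrow> \<bar>apply_bcontfun f x\<bar> < e)"
  using assms unfolding C0_def by simp

lemma C0I:
  assumes "\<And>e. 0 < e \<Longrightarrow> \<exists>K. compact K \<and> (\<forall>x. x \<notin> K \<longrightarrow> \<bar>apply_bcontfun f x\<bar> < e)"
  shows "f \<in> C0"
  using assms unfolding C0_def by simp

lemma C0_subspace: "subspace (C0 :: ('a::metric_space \<Rightarrow>\<^sub>C real) set)"
proof (rule subspaceI)
  show "0 \<in> (C0 :: ('a::metric_space \<Rightarrow>\<^sub>C real) set)"
    by (rule C0I, rule exI[of _ "{}"]) simp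
next
  fix f g :: "'a::metric_space \<Rightarrow>\<^sub>C real" assume fg: "f \<in> C0" "g \<in> C0"
  show "f + g \<in> C0"
  proof (rule C0I)
    fix e :: real assume "0 < e"
    then have e: "0 < e / 2" by simp
    obtain K where K: "compact K" "\<forall>x. x \<notin> K \<longrightarrow> \<bar>apply_bcontfun f x\<bar> < e / 2"
      using C0D[OF fg(1) e] by blast
    obtain L where L: "compact L" "\<forall>x. x \<notin> L \<longrightarrow> \<bar>apply_bcontfun g x\<bar> < e / 2"
      using C0D[OF fg(2) e] by blast
    have "\<bar>apply_bcontfun (f + g) x\<bar> < e" if "x \<notin> K \<union> L" for x
      using spec[OF K(2), of x] spec[OF L(2), of x] that by simp
    with K(1) L(1) show "\<exists>K. compact K \<and> (\<forall>x. x \<notin> K \<longrightarrow> \<bar>apply_bcontfun (f + g) x\<bar> < e)"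
      by (intro exI[of _ "K \<union> L"]) (simp add: compact_Un)
  qed
next
  fix c :: real and f :: "'a::metric_space \<Rightarrow>\<^sub>C real" assume f: "f \<in> C0"
  show "c *\<^sub>R f \<in> C0"
  proof (rule C0I)
    fix e :: real assume "0 < e"
    then have e: "0 < e / (\<bar>c\<bar> + 1)" by simp
    obtain K where K: "compact K" "\<forall>x. x \<notin> K \<longrightarrow> \<bar>apply_bcontfun f x\<bar> < e / (\<bar>c\<bar> + 1)"
      using C0D[OF f e] by blast
    have "\<bar>apply_bcontfun (c *\<^sub>R f) x\<bar> < e" if "x \<notin> K" for x
    proof -
      have "\<bar>apply_bcontfun (c *\<^sub>R f) x\<bar> \<le> (\<bar>c\<bar> + 1) * \<bar>apply_bcontfun f x\<bar>"
        by (simp add: abs_mult mult_right_mono)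
      also have "\<dots> < e"
        using K(2) that by (simp add: pos_less_divide_eq mult.commute)
      finally show ?thesis .
    qed
    with K(1) show "\<exists>K. compact K \<and> (\<forall>x. x \<notin> K \<longrightarrow> \<bar>apply_bcontfun (c *\<^sub>R f) x\<bar> < e)"
      by (intro exI[of _ K]) simp
  qed
qed

lemmas C0_add = subspace_add[OF C0_subspace]
  and C0_diff = subspace_diff[OF C0_subspace]
  and C0_scale = subspace_scale[OF C0_subspace]

locale feller =
  fixes P :: "real \<Rightarrow> 'a::polish_space \<Rightarrow> 'a measure"
  assumes tf: "transition_function P"
    and sc: "strongly_continuous_on_C0 P"
begin

abbreviation S where "S \<equiv> transition_semigroup P"
abbreviation A where "A \<equiv> generator P"

lemma P_measurable: "0 \<le> t \<Longrightarrow> P t \<in> borel \<rightarrow>\<^sub>M prob_algebra borel"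
  using tf by (simp add: transition_function_def)

lemma P_prob: "0 \<le> t \<Longrightarrow> P t x \<in> space (prob_algebra borel)"
  using measurable_space[OF P_measurable] by simp

lemma apply_S: "f \<in> C0 \<Longrightarrow> 0 \<le> t \<Longrightarrow> apply_bcontfun (S t f) x = \<langle>f, P t x\<rangle>"
  using sc unfolding strongly_continuous_on_C0_def transition_semigroup_def
  by (simp add: Bcontfun_inverse)

lemma S_C0: "f \<in> C0 \<Longrightarrow> 0 \<le> t \<Longrightarrow> S t f \<in> C0"
  using sc unfolding strongly_continuous_on_C0_def by blast

lemma S_add: "f \<in> C0 \<Longrightarrow> g \<in> C0 \<Longrightarrow> 0 \<le> t \<Longrightarrow> S t (f + g) = S t f + S t g"
proof (rule bcontfun_eqI)
  fix x assume *: "f \<in> C0" "g \<in> C0" "0 \<le> t"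
  then have "apply_bcontfun (S t (f + g)) x = \<langle>f + g, P t x\<rangle>"
    by (intro apply_S C0_add)
  also have "\<dots> = apply_bcontfun (S t f) x + apply_bcontfun (S t g) x"
    using * by (simp only: integral_bcontfun_add[OF P_prob] apply_S)
  finally show "apply_bcontfun (S t (f + g)) x = apply_bcontfun (S t f + S t g) x" by simp
qed

lemma S_diff: "f \<in> C0 \<Longrightarrow> g \<in> C0 \<Longrightarrow> 0 \<le> t \<Longrightarrow> S t (f - g) = S t f - S t g"
proof -
  assume *: "f \<in> C0" "g \<in> C0" "0 \<le> t"
  have "S t f = S t (f - g) + S t g"
    using S_add[OF C0_diff[OF *(1,2)] *(2,3)] by simp
  then show ?thesis by simp
qed

lemma S_scale: "f \<in> C0 \<Longrightarrow> 0 \<le> t \<Longrightarrow> S t (c *\<^sub>R f) = c *\<^sub>R S t f"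
  by (rule bcontfun_eqI) (simp add: apply_S C0_scale)

lemma norm_S_le: "f \<in> C0 \<Longrightarrow> 0 \<le> t \<Longrightarrow> norm (S t f) \<le> norm f"
  by (rule norm_bcontfun_le) (simp add: apply_S abs_integral_bcontfun_le[OF P_prob])

lemma S_semigroup: "f \<in> C0 \<Longrightarrow> 0 \<le> s \<Longrightarrow> 0 \<le> t \<Longrightarrow> S (s + t) f = S s (S t f)"
proof (rule bcontfun_eqI)
  fix x assume *: "f \<in> C0" "0 \<le> s" "0 \<le> t"
  then have "P (s + t) x = P s x \<bind> P t" using tf by (simp add: transition_function_def)
  then show "apply_bcontfun (S (s + t) f) x = apply_bcontfun (S s (S t f)) x"
    using * by (simp add: apply_S S_C0 integral_bind_bcontfun[OF P_prob P_measurable])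
qed

lemma S_0: "f \<in> C0 \<Longrightarrow> S 0 f = f"
  using tf by (intro bcontfun_eqI) (simp add: apply_S transition_function_def integral_return)

lemma continuous_on_S: "f \<in> C0 \<Longrightarrow> continuous_on {0..} (\<lambda>t. S t f)"
  using sc unfolding strongly_continuous_on_C0_def by blast

lemma domD:
  assumes "g \<in> generator_domain P"
  shows "g \<in> C0" "A g \<in> C0" "((\<lambda>t. (1 / t) *\<^sub>R (S t g - g)) \<longlongrightarrow> A g) (at_right 0)"
proof -
  obtain h where h: "g \<in> C0" "h \<in> C0" "((\<lambda>t. (1 / t) *\<^sub>R (S t g - g)) \<longlongrightarrow> h) (at_right 0)"
    using assms unfolding generator_domain_def by blast
  then have "A g = h" unfolding generator_def by (intro tendsto_Lim) auto
  with h show "g \<in> C0" "A g \<in> C0" "((\<lambda>t. (1 / t) *\<^sub>R (S t g - g)) \<longlongrightarrow> A g) (at_right 0)" by auto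
qed

lemma generator_eqI:
  assumes "((\<lambda>t. (1 / t) *\<^sub>R (S t g - g)) \<longlongrightarrow> h) (at_right 0)"
  shows "A g = h"
  unfolding generator_def using assms by (intro tendsto_Lim) auto

lemma generator_add:
  assumes f: "f \<in> generator_domain P" and g: "g \<in> generator_domain P"
  shows "A (f + g) = A f + A g"
proof (rule generator_eqI)
  have "((\<lambda>t. (1 / t) *\<^sub>R (S t f - f) + (1 / t) *\<^sub>R (S t g - g)) \<longlongrightarrow> A f + A g) (at_right 0)"
    by (intro tendsto_add domD f g)
  then show "((\<lambda>t. (1 / t) *\<^sub>R (S t (f + g) - (f + g))) \<longlongrightarrow> A f + A g) (at_right 0)"
  proof (rule Lim_transform_eventually)
    show "\<forall>\<^sub>F t in at_right 0. (1 / t) *\<^sub>R (S t f - f) + (1 / t) *\<^sub>R (S t g - g) = (1 / t) *\<^sub>R (S t (f + g) - (f + g))"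
      using eventually_at_right_less[of "0::real"]
      by eventually_elim (simp add: S_add domD(1)[OF f] domD(1)[OF g] scaleR_diff_right scaleR_add_right)
  qed
qed

text \<open>The generator gives a right derivative at 0, which \<open>S r\<close> transports to a
  right derivative at \<open>r\<close>. From the left the difference quotient is
  \<open>S (r - h) (q h)\<close>: contractivity replaces \<open>q h\<close> by \<open>A g\<close>,
  and strong continuity lets \<open>r - h\<close> tend to \<open>r\<close>.\<close>

lemma has_derivative_S:
  assumes g: "g \<in> generator_domain P" and r: "0 < r"
  shows "((\<lambda>r. apply_bcontfun (S r g) x) has_real_derivative apply_bcontfun (S r (A g)) x) (at r)"
proof -
  note d = domD[OF g]
  define q where "q h = (1 / h) *\<^sub>R (S h g - g)" for h
  have qC0: "q h \<in> C0" if "0 < h" for h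
    unfolding q_def using that d by (intro C0_scale C0_diff S_C0) auto
  have diff: "(apply_bcontfun (S (u + h) g) x - apply_bcontfun (S u g) x) / h = apply_bcontfun (S u (q h)) x"
    if "0 < h" "0 \<le> u" for u h
    using that d by (simp add: q_def S_scale S_diff C0_diff S_C0 S_semigroup)
  have close: "\<bar>apply_bcontfun (S u (q h)) x - apply_bcontfun (S u (A g)) x\<bar> \<le> norm (q h - A g)"
    if "0 < h" "0 \<le> u" for u h
  proof -
    have "\<bar>apply_bcontfun (S u (q h)) x - apply_bcontfun (S u (A g)) x\<bar> \<le> norm (S u (q h - A g))"
      using abs_diff_apply_le[of "S u (q h)" x "S u (A g)"] that d qC0 by (simp add: S_diff)
    also have "\<dots> \<le> norm (q h - A g)" using that d qC0 by (intro norm_S_le C0_diff) auto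
    finally show ?thesis .
  qed
  have q0: "((\<lambda>h. norm (q h - A g)) \<longlongrightarrow> 0) (at_right 0)"
    using tendsto_norm[OF tendsto_diff[OF d(3)[folded q_def] tendsto_const[of "A g"]]] by simp
  let ?D = "apply_bcontfun (S r (A g)) x"
  let ?f = "\<lambda>h. (apply_bcontfun (S (r + h) g) x - apply_bcontfun (S r g) x) / h"
  have right: "(?f \<longlongrightarrow> ?D) (at_right 0)"
  proof (subst LIM_zero_iff[symmetric], rule Lim_null_comparison[OF _ q0])
    show "\<forall>\<^sub>F h in at_right 0. norm (?f h - ?D) \<le> norm (q h - A g)"
      using eventually_at_right_less[of "0::real"]
      by eventually_elim (use diff close r in auto)
  qed
  have Scont: "((\<lambda>h. apply_bcontfun (S (r - h) (A g)) x) \<longlongrightarrow> ?D) (at_right 0)"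
  proof -
    have "continuous (at r) (\<lambda>t. S t (A g))"
      using continuous_on_interior[OF continuous_on_S[OF d(2)], of r] r by simp
    moreover have "((\<lambda>h. r - h) \<longlongrightarrow> r) (at_right 0)" by (auto intro!: tendsto_eq_intros)
    ultimately have "((\<lambda>h. S (r - h) (A g)) \<longlongrightarrow> S r (A g)) (at_right 0)"
      by (rule isCont_tendsto_compose)
    from tendsto_norm[OF tendsto_diff[OF this tendsto_const[of "S r (A g)"]]]
    have "((\<lambda>h. norm (S (r - h) (A g) - S r (A g))) \<longlongrightarrow> 0) (at_right 0)" by simp
    then show ?thesis
      by (subst LIM_zero_iff[symmetric], rule Lim_null_comparison[rotated])
         (auto intro!: always_eventually simp: abs_diff_apply_le)
  qed
  have left: "(?f \<longlongrightarrow> ?D) (at_left 0)"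
    unfolding filterlim_at_left_to_right
  proof -
    have "((\<lambda>h. apply_bcontfun (S (r - h) (q h)) x - apply_bcontfun (S (r - h) (A g)) x) \<longlongrightarrow> 0) (at_right 0)"
    proof (rule Lim_null_comparison[OF _ q0])
      show "\<forall>\<^sub>F h in at_right 0. norm (apply_bcontfun (S (r - h) (q h)) x - apply_bcontfun (S (r - h) (A g)) x) \<le> norm (q h - A g)"
        using eventually_at_right_real[OF r] by eventually_elim (use close in auto)
    qed
    from tendsto_add[OF this Scont]
    have "((\<lambda>h. apply_bcontfun (S (r - h) (q h)) x) \<longlongrightarrow> ?D) (at_right 0)" by simp
    then show "((\<lambda>h. ?f (- h)) \<longlongrightarrow> ?D) (at_right (- 0))"
    proof (simp, rule Lim_transform_eventually)
      show "\<forall>\<^sub>F h in at_right 0. apply_bcontfun (S (r - h) (q h)) x = - ((apply_bcontfun (S (r - h) g) x - apply_bcontfun (S r g) x) / h)"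
        using eventually_at_right_real[OF r]
      proof eventually_elim
        case (elim h)
        then show ?case using diff[of h "r - h"] by (simp add: minus_divide_left)
      qed
    qed
  qed
  show ?thesis
    unfolding DERIV_def using left right by (simp add: filterlim_split_at)
qed

lemma one_plus_S_ge:
  assumes "g \<in> C0" "0 \<le> t" "\<And>x. c \<le> 1 + apply_bcontfun g x"
  shows "c \<le> 1 + apply_bcontfun (S t g) x"
proof -
  have "c - 1 \<le> \<langle>g, P t x\<rangle>"
  proof (rule integral_prob_bounds(2)[OF P_prob[OF assms(2)]])
    show "apply_bcontfun g y \<le> norm g" for y using abs_apply_le_norm[of g y] by simp
    show "c - 1 \<le> apply_bcontfun g y" for y using assms(3)[of y] by simp
    show "apply_bcontfun g \<in> borel_measurable (P t x)" by (rule borel_measurable_bcontfun_prob[OF P_prob[OF assms(2)]])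
  qed
  then show ?thesis using assms by (simp add: apply_S)
qed

text \<open>For \<open>g = e\<^sup>f - 1\<close> the function \<open>ln (1 + S t g)\<close> is \<open>V(t) f\<close>.\<close>

lemma log_S_mean_value:
  assumes g: "g \<in> generator_domain P" and c: "0 < c" "\<And>x. c \<le> 1 + apply_bcontfun g x"
    and ab: "0 \<le> a" "a < b"
  shows "\<exists>\<xi>. a < \<xi> \<and> \<xi> < b \<and> ln (1 + apply_bcontfun (S b g) x) - ln (1 + apply_bcontfun (S a g) x)
    = (b - a) * apply_bcontfun (quot (S \<xi> (A g)) (S \<xi> g)) x"
proof -
  note d = domD[OF g]
  have pos: "c \<le> 1 + apply_bcontfun (S t g) x" if "0 \<le> t" for t x
    using one_plus_S_ge[OF d(1) that c(2)] .
  have pos': "0 < 1 + apply_bcontfun (S t g) x" if "0 \<le> t" for t x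
    using pos[OF that, of x] c(1) by linarith
  have cont: "continuous_on {a..b} (\<lambda>t. apply_bcontfun (S t g) x)"
  proof (rule continuous_onI)
    fix t and e :: real assume t: "t \<in> {a..b}" and "0 < e"
    have "continuous_on {a..b} (\<lambda>t. S t g)"
      using ab by (intro continuous_on_subset[OF continuous_on_S[OF d(1)]]) auto
    then obtain \<delta> where "0 < \<delta>" "\<forall>s\<in>{a..b}. dist s t < \<delta> \<longrightarrow> dist (S s g) (S t g) < e"
      using t \<open>0 < e\<close> unfolding continuous_on_iff by meson
    then show "\<exists>\<delta>>0. \<forall>s\<in>{a..b}. dist s t < \<delta> \<longrightarrow> dist (apply_bcontfun (S s g) x) (apply_bcontfun (S t g) x) \<le> e"
      by (intro exI[of _ \<delta>]) (auto intro: order_trans[OF dist_bounded] less_imp_le)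
  qed
  have "continuous_on {a..b} (\<lambda>t. ln (1 + apply_bcontfun (S t g) x))"
    using cont pos' ab by (intro continuous_intros) (auto simp: less_imp_neq[symmetric])
  moreover have "((\<lambda>t. ln (1 + apply_bcontfun (S t g) x)) has_derivative
      (*) (apply_bcontfun (S t (A g)) x / (1 + apply_bcontfun (S t g) x))) (at t)" if "a < t" "t < b" for t
  proof -
    have "((\<lambda>t. ln (1 + apply_bcontfun (S t g) x)) has_real_derivative
        1 / (1 + apply_bcontfun (S t g) x) * (0 + apply_bcontfun (S t (A g)) x)) (at t)"
      using that ab pos'[of t x] by (intro DERIV_chain2[OF DERIV_ln_divide] DERIV_add DERIV_const has_derivative_S g) auto
    then show ?thesis by (simp add: has_field_derivative_def)
  qed
  ultimately show ?thesis
  proof (rule mvt[OF ab(2)])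
    fix \<xi> assume "a < \<xi>" "\<xi> < b" "ln (1 + apply_bcontfun (S b g) x) - ln (1 + apply_bcontfun (S a g) x)
      = apply_bcontfun (S \<xi> (A g)) x / (1 + apply_bcontfun (S \<xi> g) x) * (b - a)"
    moreover have "apply_bcontfun (quot (S \<xi> (A g)) (S \<xi> g)) x
        = apply_bcontfun (S \<xi> (A g)) x / (1 + apply_bcontfun (S \<xi> g) x)"
      using ab \<open>a < \<xi>\<close> by (intro apply_quot[OF c(1)] pos) simp
    ultimately show ?thesis by (intro exI[of _ \<xi>]) simp
  qed
qed

end

section \<open>The core conditions\<close>

lemma smooth_onI:
  assumes U: "open U" "S \<subseteq> U" and eq: "\<And>x. x \<in> U \<Longrightarrow> \<phi> x = F 0 x"
    and deriv: "\<And>n x. x \<in> U \<Longrightarrow> (F n has_real_derivative F (Suc n) x) (at x)"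
  shows "smooth_on S \<phi>"
proof -
  \<comment> \<open>\<open>F\<close> lists the successive derivatives. The induction needs the
    identity on all of the open set \<open>U\<close>, because \<open>deriv\<close> at
    \<open>x\<close> depends on a neighbourhood of \<open>x\<close>.\<close>
  have *: "(deriv ^^ n) \<phi> x = F n x" if "x \<in> U" for n x
    using that
  proof (induction n arbitrary: x)
    case (Suc n)
    have "((deriv ^^ n) \<phi> has_real_derivative F (Suc n) x) (at x)"
      using deriv[OF Suc.prems] Suc U(1)
      by (rule_tac has_field_derivative_transform_within_open[of "F n"]) auto
    then show ?case by (simp add: DERIV_imp_deriv)
  qed (use eq in simp)
  have "((deriv ^^ n) \<phi> has_real_derivative F (Suc n) x) (at x)" if "x \<in> U" for n x
    by (rule has_field_derivative_transform_within_open[OF deriv[OF that] U(1) that]) (use * in auto)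
  then show ?thesis
    unfolding smooth_on_def using U
    by (intro exI[of _ U]) (auto simp: real_differentiable_def)
qed

lemma smooth_on_minus_const:
  assumes "smooth_on S \<phi>"
  shows "smooth_on S (\<lambda>y. \<phi> y - c)"
proof -
  obtain U where U: "open U" "S \<subseteq> U" "\<forall>n. \<forall>x\<in>U. (deriv ^^ n) \<phi> differentiable at x"
    using assms unfolding smooth_on_def by blast
  show ?thesis
  proof (rule smooth_onI[OF U(1,2), where F = "\<lambda>n x. if n = 0 then \<phi> x - c else (deriv ^^ n) \<phi> x"])
    fix n x assume "x \<in> U"
    then have "((deriv ^^ n) \<phi> has_real_derivative (deriv ^^ Suc n) \<phi> x) (at x)"
      using U(3) by (simp add: DERIV_deriv_iff_real_differentiable)
    then show "((\<lambda>x. if n = 0 then \<phi> x - c else (deriv ^^ n) \<phi> x) has_real_derivative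
        (if Suc n = 0 then \<phi> x - c else (deriv ^^ Suc n) \<phi> x)) (at x)"
      by (cases "n = 0") (auto intro!: derivative_eq_intros)
  qed simp
qed

lemma smooth_on_exp: "smooth_on S (\<lambda>y. exp y - 1)"
proof (rule smooth_onI[where U = UNIV and F = "\<lambda>n x. if n = 0 then exp x - 1 else exp x"])
  fix n and x :: real
  show "((\<lambda>x. if n = 0 then exp x - 1 else exp x) has_real_derivative
      (if Suc n = 0 then exp x - 1 else exp x)) (at x)"
    by (cases "n = 0") (auto intro!: derivative_eq_intros)
qed auto

lemma smooth_on_ln:
  assumes "S \<subseteq> {-1<..}"
  shows "smooth_on S (\<lambda>y. ln (1 + y))"
proof (rule smooth_onI[where U = "{-1<..}"
      and F = "\<lambda>n x. case n of 0 \<Rightarrow> ln (1 + x) | Suc k \<Rightarrow> (- 1) ^ k * fact k * inverse (1 + x) ^ Suc k"])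
  fix n and x :: real assume "x \<in> {-1<..}"
  then have x: "0 < 1 + x" by simp
  show "((\<lambda>x. case n of 0 \<Rightarrow> ln (1 + x) | Suc k \<Rightarrow> (- 1) ^ k * fact k * inverse (1 + x) ^ Suc k)
      has_real_derivative (case Suc n of 0 \<Rightarrow> ln (1 + x) | Suc k \<Rightarrow> (- 1) ^ k * fact k * inverse (1 + x) ^ Suc k)) (at x)"
  proof (cases n)
    case 0
    then show ?thesis using x by (auto intro!: derivative_eq_intros simp: field_simps)
  next
    case (Suc k)
    have "((\<lambda>x. inverse (1 + x)) has_real_derivative - (inverse (1 + x) * (0 + 1) * inverse (1 + x))) (at x)"
      using x by (intro DERIV_inverse' DERIV_add DERIV_const DERIV_ident) auto
    from DERIV_cmult[OF DERIV_power[OF this, of "Suc k"], of "(- 1) ^ k * fact k"]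
    show ?thesis using Suc by (simp add: algebra_simps)
  qed
qed (use assms in auto)

text \<open>The value at 0 is 0, yet the function is constantly 1 on \<open>{1/4<..}\<close>;
  subtracting \<open>\<phi> 0\<close>, as core condition (3) does, therefore changes
  nothing.\<close>

lemma smooth_on_step: "S \<subseteq> {1/4<..} \<Longrightarrow> smooth_on S (\<lambda>y. if 1 / 4 < y then 1 else 0)"
  by (rule smooth_onI[where U = "{1/4<..}" and F = "\<lambda>n x. if n = 0 then 1 else 0"])
     (auto intro!: derivative_eq_intros split: if_splits)

text \<open>On a non-compact space \<open>e^f\<close> does not vanish at infinity for
  \<open>f\<close> in \<open>C0\<close>, but \<open>e^f - 1\<close> does. This is the form in which
  exponentials are fed to the semigroup and to the generator.\<close>

definition expm1 :: "('a::topological_space \<Rightarrow>\<^sub>C real) \<Rightarrow> 'a \<Rightarrow>\<^sub>C real" where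
  "expm1 = bcomp (\<lambda>y. exp y - 1)"

definition log1p :: "('a::topological_space \<Rightarrow>\<^sub>C real) \<Rightarrow> 'a \<Rightarrow>\<^sub>C real" where
  "log1p = bcomp (\<lambda>y. ln (1 + y))"

lemma apply_expm1: "apply_bcontfun (expm1 f) x = exp (apply_bcontfun f x) - 1"
  unfolding expm1_def by (intro apply_bcomp_continuous continuous_intros)

lemma expm1_ge: "exp (- norm f) \<le> 1 + apply_bcontfun (expm1 f) x"
  using abs_apply_le_norm[of f x] by (simp add: apply_expm1 abs_le_iff)

lemma apply_log1p:
  fixes g :: "'a::topological_space \<Rightarrow>\<^sub>C real"
  assumes "0 < c" "\<And>x. c \<le> 1 + apply_bcontfun g x"
  shows "apply_bcontfun (log1p g) x = ln (1 + apply_bcontfun g x)"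
proof -
  have "range (apply_bcontfun g) \<subseteq> {c - 1..norm g}"
  proof clarify
    fix x show "apply_bcontfun g x \<in> {c - 1..norm g}"
      using assms(2)[of x] abs_apply_le_norm[of g x] by simp
  qed
  moreover have "continuous_on {c - 1..norm g} (\<lambda>y. ln (1 + y))"
    using assms(1) by (auto intro!: continuous_intros)
  ultimately show ?thesis
    unfolding log1p_def by (rule apply_bcomp)
qed

lemma expm1_log1p:
  fixes g :: "'a::topological_space \<Rightarrow>\<^sub>C real"
  assumes "0 < c" "\<And>x. c \<le> 1 + apply_bcontfun g x"
  shows "expm1 (log1p g) = g"
proof (rule bcontfun_eqI)
  fix x
  have "0 < 1 + apply_bcontfun g x" using assms(1) assms(2)[of x] by linarith
  then show "apply_bcontfun (expm1 (log1p g)) x = apply_bcontfun g x"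
    by (simp add: apply_expm1 apply_log1p[OF assms])
qed

lemma log1p_expm1: "log1p (expm1 f) = f" for f :: "'a::topological_space \<Rightarrow>\<^sub>C real"
  by (rule bcontfun_eqI) (simp add: apply_log1p[OF exp_gt_zero expm1_ge] apply_expm1)

lemma tendsto_log1p:
  fixes g :: "'i \<Rightarrow> 'a::topological_space \<Rightarrow>\<^sub>C real"
  assumes lim: "(g \<longlongrightarrow> h) F" and c: "0 < c" "\<And>x. c \<le> 1 + apply_bcontfun h x"
    "\<forall>\<^sub>F i in F. \<forall>x. c \<le> 1 + apply_bcontfun (g i) x"
  shows "((\<lambda>i. log1p (g i)) \<longlongrightarrow> log1p h) F"
proof -
  \<comment> \<open>A compact interval to the right of -1 that contains the range of
    \<open>h\<close> and eventually those of all \<open>g i\<close>, so that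
    \<open>ln (1 + y)\<close> is continuous on it.\<close>
  let ?B = "{f :: 'a \<Rightarrow>\<^sub>C real. range (apply_bcontfun f) \<subseteq> {c - 1..norm h + 1}}"
  have B: "f \<in> ?B" if "norm f \<le> norm h + 1" "\<forall>x. c \<le> 1 + apply_bcontfun f x" for f :: "'a \<Rightarrow>\<^sub>C real"
  proof (rule CollectI, clarify)
    fix x show "apply_bcontfun f x \<in> {c - 1..norm h + 1}"
      using that(1) spec[OF that(2), of x] abs_apply_le_norm[of f x] by simp
  qed
  have "\<forall>\<^sub>F i in F. norm (g i) < norm h + 1"
    by (rule order_tendstoD(2)[OF tendsto_norm[OF lim]]) simp
  then have "\<forall>\<^sub>F i in F. g i \<in> ?B"
    using c(3) by eventually_elim (intro B, auto)
  moreover have "h \<in> ?B" using c(2) by (intro B) auto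
  moreover have "continuous_on ?B log1p"
    unfolding log1p_def using c(1) by (intro continuous_on_bcomp continuous_intros) auto
  ultimately show ?thesis
    using lim by (intro continuous_on_tendsto_compose[of ?B log1p])
qed

context feller
begin

text \<open>The time derivative of \<open>ln (1 + S t g)\<close>, that is, of \<open>V(t) f\<close>
  for \<open>g = e^f - 1\<close>. At \<open>t = 0\<close> it is \<open>Hf\<close>, and it keeps its
  meaning for \<open>f\<close> outside \<open>D\<close> as long as \<open>g\<close> is in the domain
  of the generator.\<close>

definition log_rate :: "('a \<Rightarrow>\<^sub>C real) \<Rightarrow> real \<Rightarrow> 'a \<Rightarrow>\<^sub>C real" where
  "log_rate g t = quot (S t (A g)) (S t g)"

lemma continuous_on_log_rate:
  assumes "g \<in> generator_domain P" "0 < c" "\<And>x. c \<le> 1 + apply_bcontfun g x"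
  shows "continuous_on {0..} (log_rate g)"
  unfolding log_rate_def using assms
  by (intro continuous_on_quot[where c = c] continuous_on_S domD one_plus_S_ge) auto

text \<open>The intermediate time given by the mean value theorem depends on the point
  \<open>x\<close>. Uniform continuity of \<open>log_rate g\<close> in sup norm on
  \<open>{0..T}\<close> replaces it by any \<open>r\<close> in \<open>{a..b}\<close>, uniformly in
  \<open>x\<close>.\<close>

lemma log_S_step:
  assumes g: "g \<in> generator_domain P" and c: "0 < c" "\<And>x. c \<le> 1 + apply_bcontfun g x" and "0 < e"
  shows "\<exists>d>0. \<forall>a b r x. 0 \<le> a \<and> a \<le> r \<and> r \<le> b \<and> b \<le> T \<and> b - a < d \<longrightarrow>
    \<bar>ln (1 + apply_bcontfun (S b g) x) - ln (1 + apply_bcontfun (S a g) x) - (b - a) * apply_bcontfun (log_rate g r) x\<bar>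
      \<le> e * (b - a)"
proof -
  have "uniformly_continuous_on {0..T} (log_rate g)"
    by (intro compact_uniformly_continuous continuous_on_subset[OF continuous_on_log_rate[OF g c]]) auto
  then obtain d where d: "0 < d" "\<forall>r\<in>{0..T}. \<forall>s\<in>{0..T}. dist s r < d \<longrightarrow> dist (log_rate g s) (log_rate g r) < e"
    using \<open>0 < e\<close> unfolding uniformly_continuous_on_def by meson
  have "\<bar>ln (1 + apply_bcontfun (S b g) x) - ln (1 + apply_bcontfun (S a g) x) - (b - a) * apply_bcontfun (log_rate g r) x\<bar>
      \<le> e * (b - a)" if *: "0 \<le> a" "a \<le> r" "r \<le> b" "b \<le> T" "b - a < d" for a b r x
  proof (cases "a = b")
    case False
    then have "a < b" using * by simp
    obtain \<xi> where \<xi>: "a < \<xi>" "\<xi> < b" "ln (1 + apply_bcontfun (S b g) x) - ln (1 + apply_bcontfun (S a g) x)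
        = (b - a) * apply_bcontfun (log_rate g \<xi>) x"
      using log_S_mean_value[OF g c *(1) \<open>a < b\<close>, of x] unfolding log_rate_def by auto
    have "dist (log_rate g \<xi>) (log_rate g r) < e"
      using d(2) * \<xi>(1,2) by (auto simp: dist_real_def)
    then have "\<bar>apply_bcontfun (log_rate g \<xi>) x - apply_bcontfun (log_rate g r) x\<bar> \<le> e"
      using abs_diff_apply_le[of "log_rate g \<xi>" x "log_rate g r"] by (simp add: dist_norm)
    moreover have "(b - a) * apply_bcontfun (log_rate g \<xi>) x - (b - a) * apply_bcontfun (log_rate g r) x
        = (b - a) * (apply_bcontfun (log_rate g \<xi>) x - apply_bcontfun (log_rate g r) x)"
      by (simp add: algebra_simps)
    ultimately show ?thesis
      using \<xi>(3) \<open>a < b\<close> by (simp add: abs_mult mult_left_mono mult.commute[of e])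
  qed simp
  with d(1) show ?thesis by (intro exI[of _ d]) auto
qed

end

locale feller_core = feller P for P :: "real \<Rightarrow> 'a::polish_space \<Rightarrow> 'a measure" +
  fixes D :: "('a \<Rightarrow>\<^sub>C real) set" and \<tau> :: "('a \<Rightarrow>\<^sub>C real) topology"
  assumes core: "core_conditions P D \<tau>"
begin

abbreviation H where "H \<equiv> hamiltonian P"

lemma topspace_\<tau>: "topspace \<tau> = D"
  using core unfolding core_conditions_def by (elim conjE) assumption

lemma D_domain: "D \<subseteq> generator_domain P"
  using core unfolding core_conditions_def by (elim conjE) assumption

lemma D_dense: "C0 \<subseteq> closure D"
  using core unfolding core_conditions_def by (elim conjE) assumption

lemma D_core: "f \<in> generator_domain P \<Longrightarrow>
    \<exists>F. range F \<subseteq> D \<and> F \<longlonglongrightarrow> f \<and> (\<lambda>n. A (F n)) \<longlonglongrightarrow> A f"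
  using core unfolding core_conditions_def by (elim conjE) (erule (1) bspec)

lemma \<tau>_lcs: "locally_convex_space \<tau>"
  using core unfolding core_conditions_def by (elim conjE) assumption

lemma \<tau>_separable: "separable_space \<tau>"
  using core unfolding core_conditions_def by (elim conjE) assumption

lemma \<tau>_barrelled: "barrelled \<tau>"
  using core unfolding core_conditions_def by (elim conjE) assumption

lemma \<tau>_finer: "openin (top_of_set D) U \<Longrightarrow> openin \<tau> U"
  using core unfolding core_conditions_def by (elim conjE) simp

lemma \<tau>_comp: "0 \<in> {a..b} \<Longrightarrow> smooth_on {a..b} \<phi> \<Longrightarrow> \<phi> 0 = 0 \<Longrightarrow>
    continuous_map (subtopology \<tau> {f \<in> D. range (apply_bcontfun f) \<subseteq> {a..b}}) \<tau> (bcomp \<phi>)"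
  using core unfolding core_conditions_def bcomp_def[abs_def] by (elim conjE) simp

lemma A_cont: "continuous_map \<tau> (top_of_set C0) A"
  using core unfolding core_conditions_def by (elim conjE) assumption

lemma ex_barrel: "\<exists>B. barrel \<tau> B \<and> (\<forall>c>0. bdd_above ((\<lambda>f. norm (H f)) ` ((\<lambda>g. c *\<^sub>R g) ` B)))"
  using core unfolding core_conditions_def by (elim conjE) assumption

lemma D_subspace: "subspace D"
  using \<tau>_lcs by (simp add: locally_convex_space_def topspace_\<tau>)

lemma D_C0: "f \<in> D \<Longrightarrow> f \<in> C0"
  using D_domain domD(1) by auto

text \<open>The first alternative of core condition (3) is the claim itself; the one for compact
  spaces gives it when applied to \<open>\<phi> - \<phi> 0\<close>.\<close>

lemma D_comp:
  assumes f: "f \<in> D" and \<phi>: "smooth_on (closure (range (apply_bcontfun f))) \<phi>"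
  shows "Bcontfun (\<lambda>x. \<phi> (apply_bcontfun f x) - \<phi> 0) \<in> D"
proof -
  have range: "smooth_on (range (apply_bcontfun f)) (\<lambda>y. \<phi> y - \<phi> 0)"
    using smooth_on_minus_const[OF \<phi>, of "\<phi> 0"] closure_subset[of "range (apply_bcontfun f)"]
    unfolding smooth_on_def by (meson order_trans)
  from core show ?thesis
    unfolding core_conditions_def
  proof (elim conjE disjE)
    assume "\<forall>f\<in>D. \<forall>\<phi>. smooth_on (closure (range (apply_bcontfun f))) \<phi> \<longrightarrow>
         Bcontfun (\<lambda>x. \<phi> (apply_bcontfun f x) - \<phi> 0) \<in> D"
    from this[rule_format, OF f \<phi>] show ?thesis .
  next
    assume "\<forall>f\<in>D. \<forall>\<phi>. smooth_on (range (apply_bcontfun f)) \<phi> \<longrightarrow>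
         Bcontfun (\<lambda>x. \<phi> (apply_bcontfun f x)) \<in> D"
    from this[rule_format, OF f range] show ?thesis .
  qed
qed

lemma expm1_D: "f \<in> D \<Longrightarrow> expm1 f \<in> D"
  using D_comp[OF _ smooth_on_exp, of f] by (simp add: expm1_def bcomp_def)

lemma log1p_D:
  assumes "g \<in> D" "0 < c" "\<And>x. c \<le> 1 + apply_bcontfun g x"
  shows "log1p g \<in> D"
proof -
  have "c - 1 \<le> apply_bcontfun g x" for x
    using assms(3)[of x] by simp
  then have "closure (range (apply_bcontfun g)) \<subseteq> {c - 1..}"
    by (intro closure_minimal) auto
  then have "closure (range (apply_bcontfun g)) \<subseteq> {-1<..}" using assms(2) by force
  from D_comp[OF assms(1) smooth_on_ln[OF this]] show ?thesis
    by (simp add: log1p_def bcomp_def)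
qed

text \<open>Density supplies an element of \<open>D\<close> within 1/2 of the constant 1. Its values
  are at least 1/2, so composing it with the function of \<open>smooth_on_step\<close> produces
  exactly 1.\<close>

lemma one_D:
  assumes "compact (UNIV :: 'a set)"
  shows "const_bcontfun 1 \<in> D"
proof -
  have "(const_bcontfun 1 :: 'a \<Rightarrow>\<^sub>C real) \<in> C0"
    using assms by (intro C0I exI[of _ UNIV]) simp
  then obtain f where f: "f \<in> D" "dist f (const_bcontfun 1) < 1 / 2"
    using D_dense closure_approachable[of "const_bcontfun 1" D] by (metis subsetD half_gt_zero_iff zero_less_one)
  have *: "1 / 2 \<le> apply_bcontfun f x" for x
    using dist_fun_lt_imp_dist_val_lt[OF f(2), of x] by (simp add: const_bcontfun.rep_eq dist_real_def abs_if split: if_splits)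
  have "closure (range (apply_bcontfun f)) \<subseteq> {1 / 2..}"
    by (rule closure_minimal) (use * in auto)
  then have "closure (range (apply_bcontfun f)) \<subseteq> {1 / 4<..}" by force
  from D_comp[OF f(1) smooth_on_step[OF this]]
  have "Bcontfun (\<lambda>x. (if 1 / 4 < apply_bcontfun f x then 1 else 0) - 0) \<in> D" by simp
  moreover have "(\<lambda>x. (if 1 / 4 < apply_bcontfun f x then 1 else 0) - 0 :: real) = (\<lambda>_. 1)"
  proof
    fix x show "(if 1 / 4 < apply_bcontfun f x then 1 else 0) - 0 = (1::real)" using *[of x] by simp
  qed
  ultimately show ?thesis by (simp add: const_bcontfun_def)
qed

text \<open>Reconciles the two readings of \<open>Hf\<close>: on a compact space \<open>e^f\<close>
  is \<open>e^f - 1\<close> plus the constant 1, which lies in \<open>D\<close> and is sent to 0 by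
  the generator.\<close>

lemma hamiltonian_eq:
  assumes f: "f \<in> D"
  shows "H f = quot (A (expm1 f)) (expm1 f)"
proof -
  have e: "A (if compact (UNIV :: 'a set) then Bcontfun (\<lambda>y. exp (apply_bcontfun f y))
               else Bcontfun (\<lambda>y. exp (apply_bcontfun f y) - 1)) = A (expm1 f)"
  proof (cases "compact (UNIV :: 'a set)")
    case True
    note one = one_D[OF True]
    have "A (const_bcontfun 1) = 0"
    proof (rule generator_eqI)
      have "S t (const_bcontfun 1) = const_bcontfun 1" if "0 < t" for t
      proof (rule bcontfun_eqI)
        fix x
        interpret prob_space "P t x" using prob_algebraD(1)[OF P_prob[of t x]] that by simp
        show "apply_bcontfun (S t (const_bcontfun 1)) x = apply_bcontfun (const_bcontfun 1) x"
          using that D_C0[OF one] by (simp add: apply_S const_bcontfun.rep_eq prob_space)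
      qed
      then have "\<forall>\<^sub>F t in at_right 0. 0 = (1 / t) *\<^sub>R (S t (const_bcontfun 1) - const_bcontfun 1)"
        by (auto simp: eventually_at_right_field intro!: exI[of _ 1])
      then show "((\<lambda>t. (1 / t) *\<^sub>R (S t (const_bcontfun 1) - const_bcontfun 1)) \<longlongrightarrow> 0) (at_right 0)"
        by (rule Lim_transform_eventually[OF tendsto_const])
    qed
    moreover have "Bcontfun (\<lambda>y. exp (apply_bcontfun f y)) = expm1 f + const_bcontfun 1"
    proof (rule bcontfun_eqI)
      fix x show "apply_bcontfun (Bcontfun (\<lambda>y. exp (apply_bcontfun f y))) x = apply_bcontfun (expm1 f + const_bcontfun 1) x"
        using apply_bcomp_continuous[of exp f x] unfolding bcomp_def
        by (simp add: apply_expm1 const_bcontfun.rep_eq continuous_on_exp)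
    qed
    ultimately show ?thesis
      using True generator_add[of "expm1 f" "const_bcontfun 1"] D_domain expm1_D[OF f] one by auto
  qed (simp add: expm1_def bcomp_def)
  have "(\<lambda>x. exp (- apply_bcontfun f x) * apply_bcontfun (A (expm1 f)) x)
      = (\<lambda>x. apply_bcontfun (A (expm1 f)) x / (1 + apply_bcontfun (expm1 f) x))"
    by (auto simp: apply_expm1 exp_minus divide_inverse)
  then show ?thesis
    unfolding hamiltonian_def Let_def e by (simp add: quot_def)
qed

lemma hamiltonian_log_rate: "f \<in> D \<Longrightarrow> H f = log_rate (expm1 f) 0"
  using expm1_D[of f] D_domain by (auto simp: hamiltonian_eq log_rate_def S_0 domD)

end

section \<open>Paths of measures\<close>

lemma topspace_weak_topology: "topspace weak_topology = space (prob_algebra (borel :: 'a::metric_space measure))"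
proof
  show "topspace weak_topology \<subseteq> space (prob_algebra (borel :: 'a measure))"
    unfolding weak_topology_def topology_generated_by_topspace by auto
  have "{\<mu> \<in> space (prob_algebra borel). \<langle>0 :: 'a \<Rightarrow>\<^sub>C real, \<mu>\<rangle> \<in> (UNIV :: real set)}
      \<in> {{\<mu> \<in> space (prob_algebra borel). \<langle>f, \<mu>\<rangle> \<in> U} | (f :: 'a \<Rightarrow>\<^sub>C real) U. open U}"
    using open_UNIV by blast
  then show "space (prob_algebra (borel :: 'a measure)) \<subseteq> topspace weak_topology"
    unfolding weak_topology_def topology_generated_by_topspace by auto
qed

lemma continuous_map_weak_integral:
  fixes f :: "'a::metric_space \<Rightarrow>\<^sub>C real"
  shows "continuous_map weak_topology euclideanreal (\<lambda>\<mu>. \<langle>f, \<mu>\<rangle>)"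
  unfolding continuous_map_def
proof (intro conjI allI impI)
  fix U :: "real set" assume "openin euclidean U"
  then have "open U" by simp
  then have "openin weak_topology {\<mu> \<in> space (prob_algebra borel). \<langle>f, \<mu>\<rangle> \<in> U}"
    unfolding weak_topology_def by (intro topology_generated_by_Basis) blast
  then show "openin weak_topology {\<mu> \<in> topspace weak_topology. \<langle>f, \<mu>\<rangle> \<in> U}"
    by (simp add: topspace_weak_topology)
qed simp

context
  fixes \<nu> :: "real \<Rightarrow> 'a::metric_space measure"
  assumes \<nu>: "\<nu> \<in> continuous_paths weak_topology"
begin

lemma path_prob: "0 \<le> t \<Longrightarrow> \<nu> t \<in> space (prob_algebra borel)"
  using \<nu> unfolding continuous_paths_def continuous_map_def by (auto simp: topspace_weak_topology)

lemma continuous_on_path_integral: "continuous_on {0..} (\<lambda>t. \<langle>f, \<nu> t\<rangle>)" for f :: "'a \<Rightarrow>\<^sub>C real"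
proof -
  have "continuous_map (top_of_set {0..}) weak_topology \<nu>"
    using \<nu> by (simp add: continuous_paths_def)
  from continuous_map_compose[OF this continuous_map_weak_integral[of f]]
  show ?thesis by (simp add: o_def)
qed

lemma path_integral_integrable:
  fixes f :: "'a \<Rightarrow>\<^sub>C real"
  assumes "0 \<le> a"
  shows "(\<lambda>t. \<langle>f, \<nu> t\<rangle>) absolutely_integrable_on {a..b}"
  using assms
  by (intro absolutely_integrable_continuous_real continuous_on_subset[OF continuous_on_path_integral]) auto

text \<open>Norm continuity of \<open>h\<close> and weak continuity of \<nu> make the pairing
  jointly continuous on a compact square. This allows \<nu> to be frozen at one end of a short
  interval, uniformly over the functions \<open>h s\<close>.\<close>

lemma path_integral_uniform:
  fixes h :: "real \<Rightarrow> 'a \<Rightarrow>\<^sub>C real"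
  assumes h: "continuous_on {0..T} h" and "0 < e"
  shows "\<exists>d>0. \<forall>s r a. s \<in> {0..T} \<and> r \<in> {0..T} \<and> a \<in> {0..T} \<and> \<bar>r - a\<bar> < d \<longrightarrow>
    \<bar>\<langle>h s, \<nu> r\<rangle> - \<langle>h s, \<nu> a\<rangle>\<bar> < e"
proof -
  let ?F = "\<lambda>p. \<langle>h (fst p), \<nu> (snd p)\<rangle>"
  have "continuous_on ({0..T} \<times> {0..T}) ?F"
    unfolding continuous_on_def
  proof
    fix p assume p: "p \<in> {0..T} \<times> {0..T}"
    let ?L = "at p within {0..T} \<times> {0..T}"
    have T: "0 \<le> fst p" "0 \<le> snd p" "fst p \<le> T" "snd p \<le> T" using p by auto
    have "((\<lambda>q. h (fst q)) \<longlongrightarrow> h (fst p)) ?L"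
    proof -
      have "continuous_on ({0..T} \<times> {0..T}) (\<lambda>q. h (fst q))"
        by (rule continuous_on_compose2[OF h]) (auto intro: continuous_intros)
      then show ?thesis using p unfolding continuous_on_def by (rule bspec)
    qed
    from tendsto_norm[OF tendsto_diff[OF this tendsto_const[of "h (fst p)"]]]
    have 1: "((\<lambda>q. norm (h (fst q) - h (fst p))) \<longlongrightarrow> 0) ?L" by simp
    have 2: "((\<lambda>q. \<langle>h (fst p), \<nu> (snd q)\<rangle>) \<longlongrightarrow> ?F p) ?L"
    proof -
      have "continuous_on ({0..T} \<times> {0..T}) (\<lambda>q. \<langle>h (fst p), \<nu> (snd q)\<rangle>)"
        by (rule continuous_on_compose2[OF continuous_on_path_integral[of "h (fst p)"]]) (auto intro: continuous_intros)
      then show ?thesis using p unfolding continuous_on_def by (rule bspec)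
    qed
    have "((\<lambda>q. ?F q - \<langle>h (fst p), \<nu> (snd q)\<rangle>) \<longlongrightarrow> 0) ?L"
    proof (rule Lim_null_comparison[OF _ 1])
      show "\<forall>\<^sub>F q in ?L. norm (?F q - \<langle>h (fst p), \<nu> (snd q)\<rangle>) \<le> norm (h (fst q) - h (fst p))"
        unfolding eventually_at_filter
        by (rule always_eventually) (auto intro!: abs_integral_bcontfun_diff_le path_prob)
    qed
    from tendsto_add[OF this 2] show "(?F \<longlongrightarrow> ?F p) ?L" by simp
  qed
  then have "uniformly_continuous_on ({0..T} \<times> {0..T}) ?F"
    by (intro compact_uniformly_continuous compact_Times compact_Icc)
  then obtain d where d: "0 < d"
    "\<forall>p\<in>{0..T} \<times> {0..T}. \<forall>q\<in>{0..T} \<times> {0..T}. dist q p < d \<longrightarrow> dist (?F q) (?F p) < e"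
    using \<open>0 < e\<close> unfolding uniformly_continuous_on_def by meson
  show ?thesis
  proof (intro exI[of _ d] conjI allI impI d(1))
    fix s r a assume *: "s \<in> {0..T} \<and> r \<in> {0..T} \<and> a \<in> {0..T} \<and> \<bar>r - a\<bar> < d"
    then have "dist (?F (s, r)) (?F (s, a)) < e"
      using d(2)[rule_format, of "(s, a)" "(s, r)"] by (simp add: dist_Pair_Pair dist_real_def)
    then show "\<bar>\<langle>h s, \<nu> r\<rangle> - \<langle>h s, \<nu> a\<rangle>\<bar> < e"
      by (simp add: dist_real_def)
  qed
qed

end

section \<open>Continuity of the Hamiltonian and countable dense subsets of D\<close>

lemma continuous_on_quot_pair:
  assumes "0 < c"
  shows "continuous_on {p :: ('a::topological_space \<Rightarrow>\<^sub>C real) \<times> ('a \<Rightarrow>\<^sub>C real). \<forall>x. c \<le> 1 + apply_bcontfun (snd p) x}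
    (\<lambda>p. quot (fst p) (snd p))"
  unfolding continuous_on_def
proof
  fix p :: "('a \<Rightarrow>\<^sub>C real) \<times> ('a \<Rightarrow>\<^sub>C real)"
  assume p: "p \<in> {p. \<forall>x. c \<le> 1 + apply_bcontfun (snd p) x}"
  let ?L = "at p within {p. \<forall>x. c \<le> 1 + apply_bcontfun (snd p) x}"
  have "(fst \<longlongrightarrow> fst p) ?L" "(snd \<longlongrightarrow> snd p) ?L"
    by (auto intro!: tendsto_intros)
  then show "((\<lambda>p. quot (fst p) (snd p)) \<longlongrightarrow> quot (fst p) (snd p)) ?L"
    using p by (intro tendsto_quot[where c = c] assms) (auto simp: eventually_at_filter)
qed

context feller_core
begin

lemma continuous_map_inclusion: "continuous_map \<tau> euclidean (\<lambda>f. f)"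
  unfolding continuous_map_def
proof (intro conjI allI impI)
  fix U :: "('a \<Rightarrow>\<^sub>C real) set" assume "openin euclidean U"
  then have "openin (top_of_set D) (D \<inter> U)" by (simp add: openin_open_Int)
  from \<tau>_finer[OF this] show "openin \<tau> {f \<in> topspace \<tau>. f \<in> U}"
    by (simp add: topspace_\<tau> Int_def)
qed simp

text \<open>Core condition (6) gives continuity of \<open>expm1\<close> only on functions with
  values in a fixed interval. The sets \<open>W n\<close> are open, since \<tau> is finer than the
  sup norm topology, and they cover \<open>D\<close>, so continuity on each of them
  suffices.\<close>

lemma continuous_map_hamiltonian: "continuous_map \<tau> euclidean H"
  unfolding continuous_map_def
proof (intro conjI allI impI)
  fix V :: "('a \<Rightarrow>\<^sub>C real) set" assume V: "openin euclidean V"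
  define W where "W n = {f \<in> D. norm f < real n}" for n
  have W: "openin \<tau> (W n)" for n
  proof -
    have "W n = D \<inter> ball 0 (real n)" by (auto simp: W_def)
    then show ?thesis using \<tau>_finer[of "W n"] by (simp add: openin_open_Int)
  qed
  have "openin \<tau> {f \<in> W n. H f \<in> V}" for n
  proof -
    let ?X = "subtopology \<tau> (W n)" and ?I = "{- real n..real n}"
    have sub: "W n \<subseteq> {f \<in> D. range (apply_bcontfun f) \<subseteq> ?I}"
    proof
      fix f assume "f \<in> W n"
      then show "f \<in> {f \<in> D. range (apply_bcontfun f) \<subseteq> ?I}"
        using order_trans[OF range_subset_norm[of f], of ?I] by (auto simp: W_def)
    qed
    have "continuous_map (subtopology \<tau> {f \<in> D. range (apply_bcontfun f) \<subseteq> ?I}) \<tau> expm1"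
      unfolding expm1_def by (intro \<tau>_comp smooth_on_exp) auto
    then have e: "continuous_map ?X \<tau> expm1"
      using continuous_map_from_subtopology_mono[OF _ sub] by blast
    have "continuous_map \<tau> euclidean A"
      using A_cont by (rule continuous_map_into_fulltopology)
    from continuous_map_compose[OF e this] have 1: "continuous_map ?X euclidean (\<lambda>f. A (expm1 f))"
      by (simp add: o_def)
    from continuous_map_compose[OF e continuous_map_inclusion] have 2: "continuous_map ?X euclidean expm1"
      by (simp add: o_def)
    have "continuous_map ?X (prod_topology euclidean euclidean) (\<lambda>f. (A (expm1 f), expm1 f))"
      by (rule continuous_map_pairedI[OF 1 2])
    moreover have "(\<lambda>f. (A (expm1 f), expm1 f)) \<in> topspace ?X \<rightarrow> {p. \<forall>x. exp (- real n) \<le> 1 + apply_bcontfun (snd p) x}"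
    proof
      fix f assume "f \<in> topspace ?X"
      then have "norm f < real n" by (simp add: W_def)
      then have "exp (- real n) \<le> exp (- norm f)" by simp
      then show "(A (expm1 f), expm1 f) \<in> {p. \<forall>x. exp (- real n) \<le> 1 + apply_bcontfun (snd p) x}"
        using order_trans[OF _ expm1_ge[of f]] by auto
    qed
    ultimately have 3: "continuous_map ?X (top_of_set {p. \<forall>x. exp (- real n) \<le> 1 + apply_bcontfun (snd p) x}) (\<lambda>f. (A (expm1 f), expm1 f))"
      by (simp add: continuous_map_in_subtopology euclidean_product_topology image_subset_iff_funcset)
    have 4: "continuous_map (top_of_set {p :: ('a \<Rightarrow>\<^sub>C real) \<times> ('a \<Rightarrow>\<^sub>C real). \<forall>x. exp (- real n) \<le> 1 + apply_bcontfun (snd p) x}) euclidean (\<lambda>p. quot (fst p) (snd p))"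
      using continuous_on_quot_pair[of "exp (- real n)"] by simp
    from continuous_map_compose[OF 3 4] have "continuous_map ?X euclidean (\<lambda>f. quot (A (expm1 f)) (expm1 f))"
      by (simp add: o_def)
    then have "openin ?X {f \<in> topspace ?X. quot (A (expm1 f)) (expm1 f) \<in> V}"
      using V by (auto simp: continuous_map_def)
    moreover have "{f \<in> topspace ?X. quot (A (expm1 f)) (expm1 f) \<in> V} = {f \<in> W n. H f \<in> V}"
      by (auto simp: topspace_\<tau> W_def hamiltonian_eq)
    ultimately show ?thesis using openin_trans_full[OF _ W] by simp
  qed
  then have "openin \<tau> (\<Union>n. {f \<in> W n. H f \<in> V})" by blast
  moreover have "(\<Union>n. {f \<in> W n. H f \<in> V}) = {f \<in> topspace \<tau>. H f \<in> V}"
    using reals_Archimedean2 by (auto simp: topspace_\<tau> W_def)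
  ultimately show "openin \<tau> {f \<in> topspace \<tau>. H f \<in> V}" by simp
qed simp

text \<open>The quantity under the supremum is \<tau>-continuous in \<open>f\<close>, as both
  \<open>u\<close> and \<open>H\<close> are. Measurability in time and monotone convergence rely on
  the supremum being countable.\<close>

lemma lagrangian_dense:
  assumes Q: "Q \<subseteq> D" "D \<subseteq> \<tau> closure_of Q" and u: "u \<in> dual_space \<tau>" and \<mu>: "\<mu> \<in> space (prob_algebra borel)"
  shows "lagrangian P D \<mu> u = (SUP f\<in>Q. ereal (u f - \<langle>H f, \<mu>\<rangle>))"
    (is "_ = (SUP f\<in>Q. ereal (?F f))")
  unfolding lagrangian_def
proof (rule antisym)
  have 1: "continuous_map \<tau> euclideanreal u" using u by (simp add: dual_space_def)
  have "continuous_map euclidean euclideanreal (\<lambda>g. \<langle>g, \<mu>\<rangle>)"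
    unfolding continuous_map_iff_continuous2
  proof (rule continuous_onI)
    fix g :: "'a \<Rightarrow>\<^sub>C real" and e :: real assume "0 < e"
    then show "\<exists>d>0. \<forall>h\<in>UNIV. dist h g < d \<longrightarrow> dist \<langle>h, \<mu>\<rangle> \<langle>g, \<mu>\<rangle> \<le> e"
      using order_trans[OF abs_integral_bcontfun_diff_le[OF \<mu>] less_imp_le]
      by (intro exI[of _ e]) (simp add: dist_norm)
  qed
  from continuous_map_compose[OF continuous_map_hamiltonian this]
  have "continuous_map \<tau> euclideanreal (\<lambda>f. \<langle>H f, \<mu>\<rangle>)" by (simp add: o_def)
  then have F: "continuous_map \<tau> euclideanreal ?F"
    by (intro continuous_map_diff 1)
  show "(SUP f\<in>D. ereal (?F f)) \<le> (SUP f\<in>Q. ereal (?F f))"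
  proof (rule SUP_least)
    fix f assume f: "f \<in> D"
    show "ereal (?F f) \<le> (SUP f\<in>Q. ereal (?F f))"
      unfolding le_SUP_iff
    proof (intro allI impI)
      fix y assume "y < ereal (?F f)"
      then obtain z where z: "y < ereal z" "ereal z < ereal (?F f)" using ereal_dense2 by blast
      have "openin \<tau> {g \<in> topspace \<tau>. ?F g \<in> {z<..}}"
        by (rule openin_continuous_map_preimage[OF F]) simp
      moreover have "f \<in> {g \<in> topspace \<tau>. ?F g \<in> {z<..}}"
        using f z by (simp add: topspace_\<tau>)
      moreover have "f \<in> \<tau> closure_of Q" using f Q(2) by blast
      ultimately have "\<exists>g. g \<in> Q \<and> g \<in> {g \<in> topspace \<tau>. ?F g \<in> {z<..}}"
        unfolding in_closure_of by (elim conjE allE impE) (rule conjI)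
      then have "\<exists>g\<in>Q. z < ?F g" by auto
      then show "\<exists>g\<in>Q. y < ereal (?F g)"
        using z(1) less_trans[OF z(1)] by (elim bexE, intro bexI) simp_all
    qed
  qed
  show "(SUP f\<in>Q. ereal (?F f)) \<le> (SUP f\<in>D. ereal (?F f))"
    using Q(1) by (intro SUP_subset_mono) auto
qed

text \<open>Closure under sums and rational multiples makes linearity on \<open>Q\<close> a
  countable family of identities, so that identities valid almost everywhere can be collected off
  one null set.\<close>

lemma ex_dense_rational_space:
  "\<exists>Q. countable Q \<and> Q \<subseteq> D \<and> D \<subseteq> \<tau> closure_of Q \<and> 0 \<in> Q \<and>
    (\<forall>f\<in>Q. \<forall>g\<in>Q. f + g \<in> Q) \<and> (\<forall>r\<in>\<rat>. \<forall>f\<in>Q. r *\<^sub>R f \<in> Q)"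
proof -
  obtain C where C: "countable C" "C \<subseteq> D" "\<tau> closure_of C = D"
    using \<tau>_separable unfolding separable_space_def topspace_\<tau> by blast
  \<comment> \<open>Lists encode finite rational combinations: over a countable set there are
    countably many, and appending two lists adds their values.\<close>
  define ev where "ev l = sum_list (map (\<lambda>(r, f). real_of_rat r *\<^sub>R f) l)" for l :: "(rat \<times> ('a \<Rightarrow>\<^sub>C real)) list"
  define Q where "Q = ev ` lists (UNIV \<times> C)"
  have "countable Q" unfolding Q_def using C(1) by (intro countable_image countable_lists) simp
  moreover have "ev l \<in> D" if "l \<in> lists (UNIV \<times> C)" for l
    using that
  proof (induction l)
    case Nil
    then show ?case using subspace_0[OF D_subspace] by (simp add: ev_def)
  next
    case (Cons a l)
    have "ev (a # l) = real_of_rat (fst a) *\<^sub>R snd a + ev l" by (simp add: ev_def split_def)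
    then show ?case
      using Cons C(2) by (auto intro!: subspace_add[OF D_subspace] subspace_scale[OF D_subspace])
  qed
  then have "Q \<subseteq> D" unfolding Q_def by auto
  moreover have "C \<subseteq> Q"
  proof
    fix f assume "f \<in> C"
    then have "[(1, f)] \<in> lists (UNIV \<times> C)" "ev [(1, f)] = f" by (auto simp: ev_def)
    then show "f \<in> Q" unfolding Q_def using imageI[of "[(1, f)]" _ ev] by simp
  qed
  then have "D \<subseteq> \<tau> closure_of Q" using closure_of_mono[of C Q \<tau>] C(3) by simp
  moreover have "0 \<in> Q"
  proof -
    have "ev [] = 0" "[] \<in> lists (UNIV \<times> C)" by (simp_all add: ev_def)
    then show ?thesis unfolding Q_def using imageI[of "[]" _ ev] by simp
  qed
  moreover have "f + g \<in> Q" if fg: "f \<in> Q" "g \<in> Q" for f g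
  proof -
    obtain l k where lk: "l \<in> lists (UNIV \<times> C)" "k \<in> lists (UNIV \<times> C)" "f = ev l" "g = ev k"
      using fg unfolding Q_def by auto
    then have "f + g = ev (l @ k)" "l @ k \<in> lists (UNIV \<times> C)" by (auto simp: ev_def)
    then show ?thesis unfolding Q_def by blast
  qed
  moreover have "r *\<^sub>R f \<in> Q" if rf: "r \<in> \<rat>" "f \<in> Q" for r f
  proof -
    obtain l where l: "l \<in> lists (UNIV \<times> C)" "f = ev l" using rf unfolding Q_def by auto
    obtain q where q: "r = real_of_rat q" using rf(1) by (auto elim: Rats_cases)
    let ?k = "map (\<lambda>(p, g). (q * p, g)) l"
    have "r *\<^sub>R f = ev ?k"
      unfolding l(2) q ev_def by (induction l) (auto simp: scaleR_add_right of_rat_mult)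
    moreover have "?k \<in> lists (UNIV \<times> C)" using l(1) by auto
    ultimately show ?thesis unfolding Q_def by blast
  qed
  ultimately show ?thesis by (intro exI[of _ Q]) blast
qed

end

section \<open>The action of a path\<close>

text \<open>Monotone convergence along maxima of finitely many \<open>w i\<close>, truncated to
  \<open>{0..real n}\<close>; each maximum is controlled by \<open>integral_MAX_le\<close>.\<close>

lemma nn_integral_SUP_le:
  fixes w :: "'i \<Rightarrow> real \<Rightarrow> real" and m :: "real \<Rightarrow> real"
  assumes Q: "countable Q"
    and int: "\<And>i t. i \<in> Q \<Longrightarrow> w i absolutely_integrable_on {0..t}"
    and m: "\<And>x y. 0 \<le> x \<Longrightarrow> x \<le> y \<Longrightarrow> m x \<le> m y" "0 \<le> m 0" "\<And>x. 0 \<le> x \<Longrightarrow> m x \<le> J"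
    and le: "\<And>i x y. i \<in> Q \<Longrightarrow> 0 \<le> x \<Longrightarrow> x \<le> y \<Longrightarrow> integral {x..y} (w i) \<le> m y - m x"
  shows "(\<integral>\<^sup>+s\<in>{0..}. (SUP i\<in>Q. ennreal (w i s)) \<partial>lebesgue) \<le> ennreal J"
proof (cases "Q = {}")
  case False
  \<comment> \<open>The zero function is added because \<open>ennreal\<close> keeps only positive
    parts; its integrals satisfy the bound since \<open>m\<close> is increasing.\<close>
  define I where "I n = insert (\<lambda>_. 0) (w ` from_nat_into Q ` {..n})" for n
  have I: "finite (I n)" "I n \<noteq> {}" for n by (auto simp: I_def)
  have eQ: "from_nat_into Q k \<in> Q" for k using False by (rule from_nat_into)
  define G where "G n s = (MAX g\<in>I n. g s)" for n s
  have G_ge: "g s \<le> G n s" if "g \<in> I n" for g n s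
    unfolding G_def using I that by (intro Max_ge) auto
  have G0: "0 \<le> G n s" for n s using G_ge[of "\<lambda>_. 0" n s] by (simp add: I_def)
  have G_in: "\<exists>g\<in>I n. G n s = g s" for n s
  proof -
    have "G n s \<in> (\<lambda>g. g s) ` I n" unfolding G_def using I[of n] by (intro Max_in) auto
    then show ?thesis by auto
  qed
  have I_int: "g absolutely_integrable_on {0..t}" if "g \<in> I n" for g n t
    using that int eQ unfolding I_def by auto
  have G_int: "G n absolutely_integrable_on {0..t}" for n t
    unfolding G_def[abs_def] using I I_int by (intro absolutely_integrable_MAX) auto
  have I_le: "integral {x..y} g \<le> m y - m x" if "g \<in> I n" "0 \<le> x" "x \<le> y" for g n x y
    using that le eQ m(1)[of x y] unfolding I_def by auto
  define F where "F n s = ennreal (G n s) * indicator {0..real n} s" for n s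
  have F_meas: "F n \<in> borel_measurable lebesgue" and F_le: "integral\<^sup>N lebesgue (F n) \<le> ennreal J" for n
  proof -
    have i: "integrable lebesgue (\<lambda>s. indicator {0..real n} s *\<^sub>R G n s)"
      using G_int[where n = n and t = "real n"] by (simp add: set_integrable_def)
    have F_eq: "F n = (\<lambda>s. ennreal (indicator {0..real n} s *\<^sub>R G n s))"
      by (auto simp: F_def fun_eq_iff split: split_indicator)
    show "F n \<in> borel_measurable lebesgue"
      unfolding F_eq using borel_measurable_integrable[OF i] by measurable
    have "integral\<^sup>N lebesgue (F n) = ennreal (LINT s:{0..real n}|lebesgue. G n s)"
      unfolding F_eq set_lebesgue_integral_def using i G0 by (intro nn_integral_eq_integral) auto
    also have "(LINT s:{0..real n}|lebesgue. G n s) = integral {0..real n} (G n)"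
      using G_int by (rule set_lebesgue_integral_eq_integral(2))
    also have "\<dots> \<le> m (real n) - m 0"
      unfolding G_def[abs_def] using I[of n] I_int[where n = n] I_le[where n = n]
      by (intro integral_MAX_le) auto
    also have "\<dots> \<le> J" using m(2) m(3)[of "real n"] by simp
    finally show "integral\<^sup>N lebesgue (F n) \<le> ennreal J" by (simp add: ennreal_leI)
  qed
  have inc: "incseq F"
  proof (rule incseq_SucI, rule le_funI)
    fix n s
    obtain g where g: "g \<in> I n" "G n s = g s" using G_in by blast
    have "g \<in> I (Suc n)" using g(1) by (auto simp: I_def)
    then have "G n s \<le> G (Suc n) s" using G_ge g(2) by simp
    then show "F n s \<le> F (Suc n) s"
      unfolding F_def by (auto intro!: mult_mono ennreal_leI split: split_indicator)
  qed
  have "(SUP i\<in>Q. ennreal (w i s)) * indicator {0..} s \<le> (SUP n. F n s)" for s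
  proof (cases "0 \<le> s")
    case True
    have "ennreal (w i s) \<le> (SUP n. F n s)" if i: "i \<in> Q" for i
    proof -
      obtain k where k: "from_nat_into Q k = i" using from_nat_into_surj[OF Q i] by blast
      obtain l where l: "s \<le> real l" using real_arch_simple by blast
      have "w i \<in> I (max k l)" unfolding I_def using k by (auto simp: image_iff)
      then have "ennreal (w i s) \<le> F (max k l) s"
        using G_ge True l by (auto simp: F_def intro!: ennreal_leI split: split_indicator)
      also have "\<dots> \<le> (SUP n. F n s)" by (rule SUP_upper) simp
      finally show ?thesis .
    qed
    then show ?thesis using True by (simp add: SUP_least)
  qed simp
  then have "(\<integral>\<^sup>+s\<in>{0..}. (SUP i\<in>Q. ennreal (w i s)) \<partial>lebesgue) \<le> (\<integral>\<^sup>+s. (SUP n. F n s) \<partial>lebesgue)"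
    by (intro nn_integral_mono) simp
  also have "\<dots> = (SUP n. integral\<^sup>N lebesgue (F n))"
    by (intro nn_integral_monotone_convergence_SUP inc F_meas)
  also have "\<dots> \<le> ennreal J" by (intro SUP_least F_le)
  finally show ?thesis .
qed (simp add: bot_ennreal)

text \<open>Both conversions into \<open>ennreal\<close> cut off at 0, which commutes with
  suprema.\<close>

lemma e2ennreal_SUP_ereal: "e2ennreal (SUP i\<in>Q. ereal (g i)) = (SUP i\<in>Q. ennreal (g i))"
proof (rule antisym)
  have "(SUP i\<in>Q. ereal (g i)) \<le> enn2ereal (SUP i\<in>Q. ennreal (g i))"
  proof (rule SUP_least)
    fix i assume "i \<in> Q"
    have "ereal (g i) \<le> enn2ereal (ennreal (g i))" by (simp add: ennreal.rep_eq)
    also have "\<dots> \<le> enn2ereal (SUP i\<in>Q. ennreal (g i))"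
      unfolding less_eq_ennreal.rep_eq[symmetric] using \<open>i \<in> Q\<close> by (rule SUP_upper)
    finally show "ereal (g i) \<le> enn2ereal (SUP i\<in>Q. ennreal (g i))" .
  qed
  from e2ennreal_mono[OF this] show "e2ennreal (SUP i\<in>Q. ereal (g i)) \<le> (SUP i\<in>Q. ennreal (g i))" by simp
  show "(SUP i\<in>Q. ennreal (g i)) \<le> e2ennreal (SUP i\<in>Q. ereal (g i))"
  proof (rule SUP_least)
    fix i assume "i \<in> Q"
    then have "ereal (g i) \<le> (SUP i\<in>Q. ereal (g i))" by (rule SUP_upper)
    from e2ennreal_mono[OF this] show "ennreal (g i) \<le> e2ennreal (SUP i\<in>Q. ereal (g i))" by simp
  qed
qed

lemma partition_append:
  assumes "(k, t) \<in> partitions" "t k < y"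
  shows "(Suc k, t(Suc k := y)) \<in> partitions"
proof -
  have "t i < y" if "i \<le> k" for i
  proof (cases "i = k")
    case False
    then have "t i < t k" using assms(1) that by (auto simp: partitions_def strict_mono_on_def)
    then show ?thesis using assms(2) by simp
  qed (use assms in simp)
  then show ?thesis
    using assms(1) by (auto simp: partitions_def strict_mono_on_def le_Suc_eq)
qed

lemma partition_nonneg: "(k, t) \<in> partitions \<Longrightarrow> i \<le> k \<Longrightarrow> 0 \<le> t i"
proof (cases "i = 0")
  case False
  assume "(k, t) \<in> partitions" "i \<le> k"
  with False have "t 0 < t i" "t 0 = 0"
    using strict_mono_onD[of "{..k}" t 0 i] by (auto simp: partitions_def)
  then show ?thesis by simp
qed (auto simp: partitions_def)

lemma partition_less: "(k, t) \<in> partitions \<Longrightarrow> i \<in> {1..k} \<Longrightarrow> t (i - 1) < t i"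
  by (auto simp: partitions_def strict_mono_on_def)

context feller
begin

definition path_cost :: "(real \<Rightarrow> 'a measure) \<Rightarrow> nat \<Rightarrow> (nat \<Rightarrow> real) \<Rightarrow> ereal" where
  "path_cost \<nu> k t = (\<Sum>i=1..k. conditional_rate P (t i - t (i - 1)) (\<nu> (t i)) (\<nu> (t (i - 1))))"

definition action :: "(real \<Rightarrow> 'a measure) \<Rightarrow> ereal" where
  "action \<nu> = (SUP (k, t)\<in>partitions. path_cost \<nu> k t)"

definition action_upto :: "(real \<Rightarrow> 'a measure) \<Rightarrow> real \<Rightarrow> ereal" where
  "action_upto \<nu> y = (SUP (k, t)\<in>{(k, t). (k, t) \<in> partitions \<and> t k = y}. path_cost \<nu> k t)"

lemma conditional_rate_nonneg:
  assumes "0 \<le> t"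
  shows "0 \<le> conditional_rate P t \<mu> \<mu>'"
proof -
  have "log_semigroup P t 0 x = 0" for x
  proof -
    interpret prob_space "P t x" using prob_algebraD(1)[OF P_prob[OF assms]] .
    show ?thesis by (simp add: log_semigroup_def prob_space)
  qed
  then have "ereal 0 = ereal (\<langle>0, \<mu>\<rangle> - (\<integral>x. log_semigroup P t 0 x \<partial>\<mu>'))" by simp
  also have "\<dots> \<le> conditional_rate P t \<mu> \<mu>'" unfolding conditional_rate_def by (rule SUP_upper) simp
  finally show ?thesis by (simp only: zero_ereal_def)
qed

lemma path_cost_nonneg: "(k, t) \<in> partitions \<Longrightarrow> 0 \<le> path_cost \<nu> k t"
  unfolding path_cost_def
  by (intro sum_nonneg conditional_rate_nonneg) (use partition_less in force)

lemma action_upto_le: "action_upto \<nu> y \<le> action \<nu>"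
  unfolding action_upto_def action_def by (rule SUP_subset_mono) auto

lemma action_upto_nonneg:
  assumes "0 \<le> y"
  shows "0 \<le> action_upto \<nu> y"
proof -
  have "\<exists>k t. (k, t) \<in> partitions \<and> t k = y"
  proof (cases "y = 0")
    case True
    then show ?thesis by (intro exI[of _ 0] exI[of _ "\<lambda>_. 0"]) (auto simp: partitions_def strict_mono_on_def)
  next
    case False
    with assms show ?thesis
      by (intro exI[of _ 1] exI[of _ "\<lambda>i. if i = 0 then 0 else y"]) (auto simp: partitions_def strict_mono_on_def)
  qed
  then obtain k t where kt: "(k, t) \<in> partitions" "t k = y" by blast
  have "0 \<le> path_cost \<nu> k t" by (rule path_cost_nonneg[OF kt(1)])
  also have "\<dots> \<le> action_upto \<nu> y"
    unfolding action_upto_def using kt by (intro SUP_upper2[of "(k, t)"]) auto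
  finally show ?thesis .
qed

text \<open>A real lower bound \<open>v\<close>, in practice the value at one test function, avoids
  differences of infinite values.\<close>

lemma action_upto_step:
  assumes "x < y" "ereal v \<le> conditional_rate P (y - x) (\<nu> y) (\<nu> x)"
  shows "action_upto \<nu> x + ereal v \<le> action_upto \<nu> y"
proof -
  have "path_cost \<nu> k t \<le> action_upto \<nu> y - ereal v" if kt: "(k, t) \<in> partitions" "t k = x" for k t
  proof -
    let ?t = "t(Suc k := y)"
    have p: "(Suc k, ?t) \<in> partitions" using partition_append[OF kt(1)] assms(1) kt(2) by simp
    have "path_cost \<nu> (Suc k) ?t = path_cost \<nu> k t + conditional_rate P (y - x) (\<nu> y) (\<nu> x)"
    proof -
      have "path_cost \<nu> (Suc k) ?t = (\<Sum>i=1..k. conditional_rate P (?t i - ?t (i - 1)) (\<nu> (?t i)) (\<nu> (?t (i - 1))))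
          + conditional_rate P (y - x) (\<nu> y) (\<nu> x)"
        unfolding path_cost_def using kt(2) by simp
      also have "(\<Sum>i=1..k. conditional_rate P (?t i - ?t (i - 1)) (\<nu> (?t i)) (\<nu> (?t (i - 1)))) = path_cost \<nu> k t"
        unfolding path_cost_def by (rule sum.cong) auto
      finally show ?thesis .
    qed
    moreover have "path_cost \<nu> (Suc k) ?t \<le> action_upto \<nu> y"
      unfolding action_upto_def using p by (intro SUP_upper2[of "(Suc k, ?t)"]) auto
    ultimately have "path_cost \<nu> k t + ereal v \<le> action_upto \<nu> y"
      using add_left_mono[OF assms(2)] order_trans by metis
    then show ?thesis by (simp add: ereal_le_minus)
  qed
  then have "action_upto \<nu> x \<le> action_upto \<nu> y - ereal v"
    unfolding action_upto_def[of \<nu> x] by (intro SUP_least) auto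
  then show ?thesis by (simp add: ereal_le_minus)
qed

text \<open>Infinite values become 0 here, so this represents the action only when the latter is
  finite. It is the increasing function of time whose increments dominate those of the test
  functions.\<close>

definition action_fun :: "(real \<Rightarrow> 'a measure) \<Rightarrow> real \<Rightarrow> real" where
  "action_fun \<nu> y = real_of_ereal (action_upto \<nu> y)"

context
  fixes \<nu> assumes fin: "action \<nu> \<noteq> \<infinity>"
begin

lemma action_eq: "0 \<le> y \<Longrightarrow> action_upto \<nu> y = ereal (action_fun \<nu> y)"
  using action_upto_nonneg[of y \<nu>] action_upto_le[of \<nu> y] fin
  unfolding action_fun_def by (cases "action_upto \<nu> y") auto

lemma action_fun_nonneg: "0 \<le> y \<Longrightarrow> 0 \<le> action_fun \<nu> y"
  using action_upto_nonneg[of y \<nu>] by (simp add: action_eq)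

lemma action_fun_le: "0 \<le> y \<Longrightarrow> action_fun \<nu> y \<le> real_of_ereal (action \<nu>)"
proof -
  assume y: "0 \<le> y"
  have "ereal (action_fun \<nu> y) \<le> action \<nu>" using action_upto_le[of \<nu> y] action_eq[OF y] by simp
  then show ?thesis using fin by (cases "action \<nu>") auto
qed

lemma action_fun_step:
  assumes "0 \<le> x" "x < y" "ereal v \<le> conditional_rate P (y - x) (\<nu> y) (\<nu> x)"
  shows "action_fun \<nu> x + v \<le> action_fun \<nu> y"
  using action_upto_step[OF assms(2,3)] assms(1,2) by (simp add: action_eq)

lemma action_fun_mono: "0 \<le> x \<Longrightarrow> x \<le> y \<Longrightarrow> action_fun \<nu> x \<le> action_fun \<nu> y"
  using action_fun_step[of x y 0] conditional_rate_nonneg[of "y - x" "\<nu> y" "\<nu> x"]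
  by (cases "x = y") (auto simp: zero_ereal_def)

end

lemma log_semigroup_eq:
  assumes f: "expm1 f \<in> C0" and "0 \<le> t"
  shows "log_semigroup P t f x = ln (1 + apply_bcontfun (S t (expm1 f)) x)"
proof -
  interpret prob_space "P t x" using prob_algebraD(1)[OF P_prob[OF assms(2)]] .
  have "(\<integral>y. exp (apply_bcontfun f y) \<partial>P t x) = (\<integral>y. 1 + apply_bcontfun (expm1 f) y \<partial>P t x)"
    by (simp add: apply_expm1)
  also have "\<dots> = 1 + apply_bcontfun (S t (expm1 f)) x"
    using integrable_bcontfun[OF P_prob[OF assms(2)]] assms by (simp add: apply_S prob_space)
  finally show ?thesis by (simp add: log_semigroup_def)
qed

lemma log_semigroup_log1p:
  assumes f: "expm1 f \<in> C0" and t: "0 \<le> t"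
  shows "log_semigroup P t f x = apply_bcontfun (log1p (S t (expm1 f))) x"
  unfolding log_semigroup_eq[OF assms]
  by (rule apply_log1p[symmetric, OF exp_gt_zero one_plus_S_ge[OF f t expm1_ge]])

end

section \<open>Lower bound for the action\<close>

lemma integral_const_bcontfun:
  assumes "\<mu> \<in> space (prob_algebra borel)"
  shows "\<langle>const_bcontfun c, \<mu>\<rangle> = (c :: real)"
proof -
  interpret prob_space \<mu> using prob_algebraD(1)[OF assms] .
  show ?thesis by (simp add: const_bcontfun.rep_eq prob_space)
qed

lemma integral_bcontfun_mono:
  fixes f g :: "'a::topological_space \<Rightarrow>\<^sub>C real"
  assumes "\<mu> \<in> space (prob_algebra borel)" "\<And>x. apply_bcontfun f x \<le> apply_bcontfun g x"
  shows "\<langle>f, \<mu>\<rangle> \<le> \<langle>g, \<mu>\<rangle>"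
  using assms by (intro integral_mono integrable_bcontfun) auto

lemma integral_ge_const_mult:
  fixes F :: "real \<Rightarrow> real"
  assumes "F integrable_on {x..y}" "x \<le> y" "\<And>r. r \<in> {x..y} \<Longrightarrow> c \<le> F r"
  shows "(y - x) * c \<le> integral {x..y} F"
proof -
  have "integral {x..y} (\<lambda>_. c) \<le> integral {x..y} F"
    using assms by (intro integral_le integrable_const_ivl) auto
  then show ?thesis using assms(2) by simp
qed

context feller_core
begin

text \<open>On a short interval from \<open>a\<close> to \<open>b\<close> the conditional rate is at
  least \<open><f, \<nu> b> - <V(b - a) f, \<nu> a>\<close>. Here \<open>V(b - a) f\<close> is
  \<open>f + (b - a) Hf\<close> up to a small multiple of \<open>b - a\<close>, and
  \<open><Hf, \<nu> a>\<close> is close to \<open><Hf, \<nu> r>\<close> for \<open>r\<close> in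
  between. The estimates add up by \<open>mono_if_locally_mono\<close>.\<close>

lemma action_fun_ge:
  assumes \<nu>: "\<nu> \<in> continuous_paths weak_topology" and fin: "action \<nu> \<noteq> \<infinity>"
    and f: "f \<in> D" and xy: "0 \<le> x" "x \<le> y"
  shows "\<langle>f, \<nu> y\<rangle> - \<langle>f, \<nu> x\<rangle>
      - integral {x..y} (\<lambda>r. \<langle>H f, \<nu> r\<rangle>)
    \<le> action_fun \<nu> y - action_fun \<nu> x"
proof -
  let ?h = "\<lambda>r. \<langle>H f, \<nu> r\<rangle>"
  let ?f = "\<lambda>r. \<langle>f, \<nu> r\<rangle>"
  let ?m = "action_fun \<nu>"
  have h_int: "?h integrable_on {a..b}" if "0 \<le> a" for a b
    using path_integral_integrable[OF \<nu> that, where f = "H f" and b = b] by (simp add: absolutely_integrable_on_def)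
  have g: "expm1 f \<in> generator_domain P" using expm1_D[OF f] D_domain by blast
  have gC0: "expm1 f \<in> C0" by (rule D_C0[OF expm1_D[OF f]])
  have "?f y - ?f x - integral {x..y} ?h \<le> ?m y - ?m x + e" if "0 < e" for e
  proof -
    \<comment> \<open>Two errors arise per unit of time, one from expanding \<open>V\<close> and one
      from freezing \<nu>; adding 1 covers \<open>x = y\<close>.\<close>
    define e' where "e' = e / (2 * (y - x) + 1)"
    have e': "0 < e'" "2 * e' * (y - x) \<le> e"
      using that xy by (simp_all add: e'_def field_simps)
    obtain d1 where d1: "0 < d1" "\<forall>a b r z. 0 \<le> a \<and> a \<le> r \<and> r \<le> b \<and> b \<le> y \<and> b - a < d1 \<longrightarrow>
      \<bar>ln (1 + apply_bcontfun (S b (expm1 f)) z) - ln (1 + apply_bcontfun (S a (expm1 f)) z)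
          - (b - a) * apply_bcontfun (log_rate (expm1 f) r) z\<bar> \<le> e' * (b - a)"
      using log_S_step[OF g exp_gt_zero expm1_ge e'(1), of y] by blast
    obtain d2 where d2: "0 < d2" "\<forall>s r a. s \<in> {0..y} \<and> r \<in> {0..y} \<and> a \<in> {0..y} \<and> \<bar>r - a\<bar> < d2 \<longrightarrow> \<bar>?h r - ?h a\<bar> < e'"
      using path_integral_uniform[OF \<nu> _ e'(1), where h = "\<lambda>_. H f" and T = y] by auto
    define G where "G = (\<lambda>s. ?m s - ?f s + integral {0..s} ?h + 2 * e' * s)"
    have "G x \<le> G y"
    proof (rule mono_if_locally_mono[OF _ xy(2)])
      show "0 < min d1 d2" using d1 d2 by simp
      fix a b assume ab: "x \<le> a" "a \<le> b" "b \<le> y" "b - a < min d1 d2"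
      show "G a \<le> G b"
      proof (cases "a = b")
        case False
        then have "a < b" "0 \<le> a" using ab xy by auto
        define t where "t = b - a"
        have t: "0 < t" "t \<le> y" "t < d1" using \<open>a < b\<close> \<open>0 \<le> a\<close> ab by (auto simp: t_def)
        note \<nu>a = path_prob[OF \<nu> \<open>0 \<le> a\<close>]
        let ?V = "log1p (S t (expm1 f))"
        have V: "apply_bcontfun ?V = log_semigroup P t f"
          using t by (intro ext) (simp add: log_semigroup_log1p[OF gC0])
        have "apply_bcontfun ?V z \<le> apply_bcontfun (f + (t *\<^sub>R H f + const_bcontfun (e' * t))) z" for z
        proof -
          have "\<bar>ln (1 + apply_bcontfun (S t (expm1 f)) z) - ln (1 + apply_bcontfun (S 0 (expm1 f)) z)
              - (t - 0) * apply_bcontfun (log_rate (expm1 f) 0) z\<bar> \<le> e' * (t - 0)"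
            using d1(2) t by (intro d1(2)[rule_format]) auto
          moreover have "ln (1 + apply_bcontfun (S 0 (expm1 f)) z) = apply_bcontfun f z"
            by (simp add: S_0[OF gC0] apply_expm1)
          moreover have "ln (1 + apply_bcontfun (S t (expm1 f)) z) = apply_bcontfun ?V z"
            using t V log_semigroup_eq[OF gC0, of t z] by simp
          ultimately show ?thesis
            by (simp add: hamiltonian_log_rate[OF f] const_bcontfun.rep_eq abs_le_iff algebra_simps)
        qed
        from integral_bcontfun_mono[OF \<nu>a this]
        have "\<langle>?V, \<nu> a\<rangle> \<le> ?f a + (t * ?h a + e' * t)"
          unfolding integral_bcontfun_add[OF \<nu>a] integral_bcontfun_scaleR[OF \<nu>a] integral_const_bcontfun[OF \<nu>a] .
        moreover have "?m a + (?f b - \<langle>?V, \<nu> a\<rangle>) \<le> ?m b"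
        proof (rule action_fun_step[OF fin \<open>0 \<le> a\<close> \<open>a < b\<close>])
          show "ereal (?f b - \<langle>?V, \<nu> a\<rangle>) \<le> conditional_rate P (b - a) (\<nu> b) (\<nu> a)"
            unfolding V unfolding conditional_rate_def t_def by (rule SUP_upper) simp
        qed
        moreover have "t * (?h a - e') \<le> integral {a..b} ?h"
          unfolding t_def
        proof (rule integral_ge_const_mult[OF h_int[OF \<open>0 \<le> a\<close>] ab(2)])
          fix r assume r: "r \<in> {a..b}"
          have "\<bar>?h r - ?h a\<bar> < e'"
            using r ab xy by (intro d2(2)[rule_format, of 0]) auto
          then show "?h a - e' \<le> ?h r" by linarith
        qed
        moreover have "integral {0..b} ?h = integral {0..a} ?h + integral {a..b} ?h"
          using h_int[of 0 b] \<open>0 \<le> a\<close> ab(2) by (simp add: Henstock_Kurzweil_Integration.integral_combine)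
        ultimately show ?thesis
          unfolding G_def t_def by (simp add: algebra_simps)
      qed simp
    qed
    moreover have "integral {0..y} ?h = integral {0..x} ?h + integral {x..y} ?h"
      using h_int[of 0 y] xy by (simp add: Henstock_Kurzweil_Integration.integral_combine)
    ultimately show ?thesis using e'(2) unfolding G_def by (simp add: algebra_simps)
  qed
  then show ?thesis by (rule field_le_epsilon)
qed

lemma velocity_integrable:
  assumes u: "has_velocity \<tau> \<nu> u" and f: "f \<in> D"
  shows "(\<lambda>s. u s f) absolutely_integrable_on {0..t}"
proof (cases "0 \<le> t")
  case True
  have "(\<lambda>s. u s f) \<in> borel_measurable (lebesgue_on {0..})"
    using u f unfolding has_velocity_def topspace_\<tau> by blast
  then have "(\<lambda>s. u s f * indicator {0..} s) \<in> borel_measurable lebesgue"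
    by (subst (asm) borel_measurable_restrict_space_iff) (auto simp: mult.commute)
  then have "(\<lambda>s. (u s f * indicator {0..} s) * indicator {0..t} s) \<in> borel_measurable lebesgue"
    by (rule borel_measurable_times) (rule borel_measurable_indicator, simp)
  also have "(\<lambda>s. (u s f * indicator {0..} s) * indicator {0..t} s) = (\<lambda>s. indicator {0..t} s *\<^sub>R u s f)"
    by (auto simp: fun_eq_iff split: split_indicator)
  finally have "(\<lambda>s. indicator {0..t} s *\<^sub>R u s f) \<in> borel_measurable lebesgue" .
  moreover have "(\<integral>\<^sup>+s. ennreal (norm (indicator {0..t} s *\<^sub>R u s f)) \<partial>lebesgue) < \<infinity>"
  proof -
    have "(\<integral>\<^sup>+s\<in>{0..t}. ennreal \<bar>u s f\<bar> \<partial>lebesgue) < \<infinity>"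
      using u f True unfolding has_velocity_def topspace_\<tau> by blast
    moreover have "(\<integral>\<^sup>+s\<in>{0..t}. ennreal \<bar>u s f\<bar> \<partial>lebesgue) = (\<integral>\<^sup>+s. ennreal (norm (indicator {0..t} s *\<^sub>R u s f)) \<partial>lebesgue)"
      by (rule nn_integral_cong) (auto split: split_indicator)
    ultimately show ?thesis by simp
  qed
  ultimately show ?thesis unfolding set_integrable_def by (intro integrableI_bounded)
qed simp

lemma velocity_integral:
  assumes u: "has_velocity \<tau> \<nu> u" and f: "f \<in> D" and xy: "0 \<le> x" "x \<le> y"
  shows "integral {x..y} (\<lambda>s. u s f) = \<langle>f, \<nu> y\<rangle> - \<langle>f, \<nu> x\<rangle>"
proof -
  have *: "integral {0..t} (\<lambda>s. u s f) = \<langle>f, \<nu> t\<rangle> - \<langle>f, \<nu> 0\<rangle>" if "0 \<le> t" for t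
  proof -
    have "\<langle>f, \<nu> t\<rangle> - \<langle>f, \<nu> 0\<rangle> = (LINT s:{0..t}|lebesgue. u s f)"
      using u f that unfolding has_velocity_def topspace_\<tau> by blast
    also have "\<dots> = integral {0..t} (\<lambda>s. u s f)"
      by (rule set_lebesgue_integral_eq_integral(2)[OF velocity_integrable[OF u f]])
    finally show ?thesis by simp
  qed
  have "integral {0..x} (\<lambda>s. u s f) + integral {x..y} (\<lambda>s. u s f) = integral {0..y} (\<lambda>s. u s f)"
    using xy velocity_integrable[OF u f, of y]
    by (intro Henstock_Kurzweil_Integration.integral_combine) (auto simp: absolutely_integrable_on_def)
  with *[of x] *[of y] xy show ?thesis by simp
qed

lemma action_ge_lagrangian:
  assumes \<nu>: "\<nu> \<in> continuous_paths weak_topology" and u: "has_velocity \<tau> \<nu> u"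
  shows "enn2ereal (\<integral>\<^sup>+s\<in>{0..}. e2ennreal (lagrangian P D (\<nu> s) (u s)) \<partial>lebesgue) \<le> action \<nu>"
proof (cases "action \<nu> = \<infinity>")
  case fin: False
  let ?J = "real_of_ereal (action \<nu>)"
  obtain Q where Q: "countable Q" "Q \<subseteq> D" "D \<subseteq> \<tau> closure_of Q"
    using ex_dense_rational_space by blast
  define w where "w f s = u s f - \<langle>H f, \<nu> s\<rangle>" for f s
  have L: "e2ennreal (lagrangian P D (\<nu> s) (u s)) = (SUP f\<in>Q. ennreal (w f s))" if "0 \<le> s" for s
  proof -
    have "u s \<in> dual_space \<tau>" using u that by (simp add: has_velocity_def)
    then show ?thesis
      unfolding w_def by (simp add: lagrangian_dense[OF Q(2,3) _ path_prob[OF \<nu> that]] e2ennreal_SUP_ereal)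
  qed
  have w_int: "w f absolutely_integrable_on {0..t}" if "f \<in> D" for f t
    unfolding w_def[abs_def] using that
    by (intro set_integral_diff(1) velocity_integrable[OF u] path_integral_integrable[OF \<nu>]) auto
  have "(\<integral>\<^sup>+s\<in>{0..}. e2ennreal (lagrangian P D (\<nu> s) (u s)) \<partial>lebesgue) = (\<integral>\<^sup>+s\<in>{0..}. (SUP f\<in>Q. ennreal (w f s)) \<partial>lebesgue)"
    by (rule nn_integral_cong) (simp add: L split: split_indicator)
  also have "\<dots> \<le> ennreal ?J"
  proof (rule nn_integral_SUP_le[where m = "action_fun \<nu>"])
    fix f x y assume f: "f \<in> Q" and xy: "0 \<le> x" "x \<le> (y::real)"
    have fD: "f \<in> D" using f Q by blast
    have "integral {x..y} (w f) = integral {x..y} (\<lambda>s. u s f) - integral {x..y} (\<lambda>s. \<langle>H f, \<nu> s\<rangle>)"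
      unfolding w_def[abs_def]
    proof (rule Henstock_Kurzweil_Integration.integral_diff)
      have "(\<lambda>s. u s f) integrable_on {0..y}"
        using velocity_integrable[OF u fD, of y] by (simp add: absolutely_integrable_on_def)
      then show "(\<lambda>s. u s f) integrable_on {x..y}"
        by (rule integrable_subinterval_real) (use xy in auto)
      show "(\<lambda>s. \<langle>H f, \<nu> s\<rangle>) integrable_on {x..y}"
        using path_integral_integrable[OF \<nu> xy(1), where f = "H f" and b = y] by (simp add: absolutely_integrable_on_def)
    qed
    then show "integral {x..y} (w f) \<le> action_fun \<nu> y - action_fun \<nu> x"
      using action_fun_ge[OF \<nu> fin fD xy] velocity_integral[OF u fD xy] by simp
  qed (use Q w_int action_fun_mono[OF fin] action_fun_nonneg[OF fin] action_fun_le[OF fin] in auto)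
  finally have "enn2ereal (\<integral>\<^sup>+s\<in>{0..}. e2ennreal (lagrangian P D (\<nu> s) (u s)) \<partial>lebesgue) \<le> enn2ereal (ennreal ?J)"
    by (simp only: less_eq_ennreal.rep_eq)
  also have "\<dots> = action \<nu>"
    using order_trans[OF action_upto_nonneg[of 0 \<nu>] action_upto_le] fin
    by (cases "action \<nu>") (auto simp: ennreal.rep_eq max_def)
  finally show ?thesis .
qed simp

end

section \<open>Upper bound for the action\<close>

context feller
begin

text \<open>\<open>S r\<close> commutes with the difference quotients of \<open>g\<close> and is a
  contraction.\<close>

lemma S_domain:
  assumes g: "g \<in> generator_domain P" and r: "0 \<le> r"
  shows "S r g \<in> generator_domain P" "A (S r g) = S r (A g)"
proof -
  note d = domD[OF g]
  have lim: "((\<lambda>h. (1 / h) *\<^sub>R (S h (S r g) - S r g)) \<longlongrightarrow> S r (A g)) (at_right 0)"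
  proof (subst LIM_zero_iff[symmetric], rule Lim_null_comparison)
    show "((\<lambda>h. norm ((1 / h) *\<^sub>R (S h g - g) - A g)) \<longlongrightarrow> 0) (at_right 0)"
      using tendsto_norm[OF tendsto_diff[OF d(3) tendsto_const[of "A g"]]] by simp
    show "\<forall>\<^sub>F h in at_right 0. norm ((1 / h) *\<^sub>R (S h (S r g) - S r g) - S r (A g)) \<le> norm ((1 / h) *\<^sub>R (S h g - g) - A g)"
      using eventually_at_right_less[of "0::real"]
    proof eventually_elim
      case (elim h)
      have c: "S h g - g \<in> C0" "(1 / h) *\<^sub>R (S h g - g) \<in> C0"
        using elim d by (auto intro!: C0_diff C0_scale S_C0)
      have "S h (S r g) = S r (S h g)"
        using S_semigroup[OF d(1), of h r] S_semigroup[OF d(1), of r h] elim r by (simp add: add.commute)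
      then have "(1 / h) *\<^sub>R (S h (S r g) - S r g) - S r (A g) = S r ((1 / h) *\<^sub>R (S h g - g) - A g)"
        using c d r elim by (simp add: S_diff S_scale S_C0)
      then show ?case using norm_S_le[OF C0_diff[OF c(2) d(2)] r] by simp
    qed
  qed
  show "A (S r g) = S r (A g)" by (rule generator_eqI[OF lim])
  show "S r g \<in> generator_domain P"
    unfolding generator_domain_def using lim S_C0[OF d(1) r] S_C0[OF d(2) r] by blast
qed

text \<open>With \<open>log_rate (expm1 _) 0\<close> read as the Hamiltonian, this is the equation
  d/dr V(r) f = H V(r) f, which makes sense although \<open>V(r) f\<close> may lie outside
  \<open>D\<close>.\<close>

lemma log_rate_S:
  assumes "g \<in> generator_domain P" "0 \<le> r"
  shows "log_rate (S r g) 0 = log_rate g r"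
  using assms S_0[OF S_C0[OF domD(1)[OF assms(1)] assms(2)]] S_0[OF S_C0[OF domD(2)[OF assms(1)] assms(2)]]
  by (simp add: log_rate_def S_domain)

text \<open>\<open>V(t)\<close> is increasing and commutes with the addition of constants, hence is
  nonexpansive in sup norm; comparison with 0 then bounds it by \<open>norm f\<close>.\<close>

lemma log_semigroup_bounds:
  assumes t: "0 \<le> t" and le: "\<And>y. apply_bcontfun f y \<le> apply_bcontfun g y + e"
  shows "log_semigroup P t f x \<le> log_semigroup P t g x + e"
proof -
  interpret prob_space "P t x" using prob_algebraD(1)[OF P_prob[OF t]] .
  have i: "integrable (P t x) (\<lambda>y. exp (apply_bcontfun f y))" for f :: "'a \<Rightarrow>\<^sub>C real"
  proof -
    have "apply_bcontfun (bcomp exp f) = (\<lambda>y. exp (apply_bcontfun f y))"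
      by (rule ext) (intro apply_bcomp_continuous continuous_intros)
    then show ?thesis
      using integrable_bcontfun[OF P_prob[OF t], where f = "bcomp exp f"] by simp
  qed
  have pos: "0 < (\<integral>y. exp (apply_bcontfun f y) \<partial>P t x)" for f :: "'a \<Rightarrow>\<^sub>C real"
  proof -
    have "exp (- norm f) \<le> exp (apply_bcontfun f y)" for y
      using abs_apply_le_norm[of f y] by (simp add: abs_le_iff)
    then have "exp (- norm f) \<le> (\<integral>y. exp (apply_bcontfun f y) \<partial>P t x)"
      by (intro integral_ge_const i AE_I2)
    then show ?thesis by (rule less_le_trans[OF exp_gt_zero])
  qed
  have "(\<integral>y. exp (apply_bcontfun f y) \<partial>P t x) \<le> (\<integral>y. exp e * exp (apply_bcontfun g y) \<partial>P t x)"
    using le by (intro integral_mono i integrable_mult_right) (simp add: exp_add[symmetric] add.commute)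
  also have "\<dots> = exp e * (\<integral>y. exp (apply_bcontfun g y) \<partial>P t x)" by simp
  finally have "ln (\<integral>y. exp (apply_bcontfun f y) \<partial>P t x) \<le> ln (exp e * (\<integral>y. exp (apply_bcontfun g y) \<partial>P t x))"
    using pos by (subst ln_le_cancel_iff) auto
  then show ?thesis
    using pos[of g] by (simp add: log_semigroup_def ln_mult)
qed

lemma abs_log_semigroup_le:
  assumes t: "0 \<le> t"
  shows "\<bar>log_semigroup P t f x\<bar> \<le> norm f"
proof -
  interpret prob_space "P t x" using prob_algebraD(1)[OF P_prob[OF t]] .
  have 0: "log_semigroup P t 0 x = 0" by (simp add: log_semigroup_def prob_space)
  have "apply_bcontfun f y \<le> apply_bcontfun 0 y + norm f" "apply_bcontfun 0 y \<le> apply_bcontfun f y + norm f" for y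
    using abs_apply_le_norm[of f y] by (auto simp: abs_le_iff)
  from log_semigroup_bounds[OF t this(1), of x] log_semigroup_bounds[OF t this(2), of x] show ?thesis
    using 0 by (simp add: abs_le_iff)
qed

lemma log_semigroup_measurable:
  assumes t: "0 \<le> t"
  shows "log_semigroup P t f \<in> borel_measurable borel"
proof -
  have [measurable]: "P t \<in> borel \<rightarrow>\<^sub>M subprob_algebra borel"
    using P_measurable[OF t] by (rule measurable_prob_algebraD)
  have "(\<lambda>\<mu>. \<integral>y. exp (apply_bcontfun f y) \<partial>\<mu>) \<in> subprob_algebra borel \<rightarrow>\<^sub>M borel"
    by (intro integral_measurable_subprob_algebra) measurable
  then have "(\<lambda>x. \<integral>y. exp (apply_bcontfun f y) \<partial>P t x) \<in> borel_measurable borel"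
    by (rule measurable_compose[rotated]) measurable
  then show ?thesis unfolding log_semigroup_def[abs_def] by measurable
qed

lemma integrable_log_semigroup:
  assumes t: "0 \<le> t" and \<mu>: "\<mu> \<in> space (prob_algebra borel)"
  shows "integrable \<mu> (log_semigroup P t f)"
proof -
  interpret prob_space \<mu> using prob_algebraD(1)[OF \<mu>] .
  have "log_semigroup P t f \<in> borel_measurable \<mu>"
    using log_semigroup_measurable[OF t] measurable_cong_sets[OF prob_algebraD(2)[OF \<mu>] refl] by blast
  then show ?thesis
    using abs_log_semigroup_le[OF t] by (intro integrable_const_bound[where B = "norm f"]) auto
qed

end

lemma C0_compact: "compact (UNIV :: 'a::metric_space set) \<Longrightarrow> (f :: 'a \<Rightarrow>\<^sub>C real) \<in> C0"
  by (rule C0I) (rule exI[of _ UNIV], simp)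

text \<open>The function \<open>f\<close> is multiplied by cut-offs. The Lindelof property turns
  local compactness into a countable cover by open sets \<open>V i\<close> inside compact sets
  \<open>K i\<close>, and distances to the complements of the \<open>V i\<close> give continuous
  functions that vanish off finitely many \<open>K i\<close>. Bounded pointwise convergence is
  enough for the later use of dominated convergence.\<close>

lemma C0_bounded_pointwise_dense:
  fixes f :: "'a::polish_space \<Rightarrow>\<^sub>C real"
  assumes lc: "locally_compact_space (euclidean :: 'a topology)"
  shows "\<exists>F. (\<forall>n. F n \<in> C0 \<and> norm (F n) \<le> norm f) \<and> (\<forall>x. (\<lambda>n. apply_bcontfun (F n) x) \<longlonglongrightarrow> apply_bcontfun f x)"
proof (cases "compact (UNIV :: 'a set)")
  case True
  then show ?thesis using C0_compact[OF True, of f] by (intro exI[of _ "\<lambda>_. f"]) simp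
next
  case False
  define \<U> where "\<U> = {U :: 'a set. open U \<and> (\<exists>K. compact K \<and> U \<subseteq> K)}"
  obtain \<V> where \<V>: "\<V> \<subseteq> \<U>" "countable \<V>" "\<Union>\<V> = \<Union>\<U>"
    using Lindelof[of \<U>] unfolding \<U>_def by blast
  have cov: "\<Union>\<V> = UNIV"
  proof -
    have "x \<in> \<Union>\<U>" for x :: 'a
    proof -
      obtain U K where "openin euclidean U" "compactin euclidean K" "x \<in> U" "U \<subseteq> K"
        using lc unfolding locally_compact_space_def by (metis UNIV_I topspace_euclidean)
      then show ?thesis unfolding \<U>_def by auto
    qed
    then show ?thesis using \<V>(3) by blast
  qed
  then have ne: "\<V> \<noteq> {}" by auto
  define V where "V = from_nat_into \<V>"
  have V_in: "V i \<in> \<U>" for i using from_nat_into[OF ne, of i] \<V>(1) unfolding V_def by blast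
  then have "\<forall>i. \<exists>K. compact K \<and> V i \<subseteq> K" unfolding \<U>_def by blast
  then obtain K where K: "\<And>i. compact (K i)" "\<And>i. V i \<subseteq> K i" by metis
  have V_open: "open (V i)" for i using V_in[of i] by (simp add: \<U>_def)
  \<comment> \<open>The distance \<open>infdist\<close> to the empty set is 0, so the cut-offs would
    fail if some \<open>V i\<close> were the whole space; non-compactness excludes this.\<close>
  have V_ne: "- V i \<noteq> {}" for i
  proof
    assume "- V i = {}"
    then have "K i = UNIV" using K(2)[of i] by auto
    then show False using K(1)[of i] False by simp
  qed
  \<comment> \<open>The factor \<open>real n\<close> makes the cut-off equal to 1 eventually at each
    point, since the sum there becomes positive.\<close>
  define cut where "cut n x = min 1 (real n * (\<Sum>i\<le>n. infdist x (- V i)))" for n and x :: 'a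
  have cut: "0 \<le> cut n x" "cut n x \<le> 1" for n x
    unfolding cut_def by (auto intro!: mult_nonneg_nonneg sum_nonneg infdist_nonneg)
  have cut_cont: "continuous_on UNIV (cut n)" for n
    unfolding cut_def[abs_def] by (intro continuous_intros)
  have cut_0: "cut n x = 0" if "x \<notin> (\<Union>i\<le>n. K i)" for n x
  proof -
    have "infdist x (- V i) = 0" if "i \<le> n" for i
      using K(2)[of i] \<open>x \<notin> (\<Union>i\<le>n. K i)\<close> that by (intro infdist_zero) auto
    then show ?thesis unfolding cut_def by simp
  qed
  have cut_1: "(\<lambda>n. cut n x) \<longlonglongrightarrow> 1" for x
  proof -
    obtain U where "U \<in> \<V>" "x \<in> U" using cov by blast
    then obtain j where j: "x \<in> V j" using from_nat_into_surj[OF \<V>(2)] unfolding V_def by metis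
    define \<delta> where "\<delta> = infdist x (- V j)"
    have "closed (- V j)" by (rule closed_Compl[OF V_open])
    then have "\<delta> \<noteq> 0" unfolding \<delta>_def using in_closed_iff_infdist_zero[OF _ V_ne[of j], of x] j by auto
    then have \<delta>: "0 < \<delta>" using infdist_nonneg[of x "- V j"] unfolding \<delta>_def by linarith
    obtain k where k: "1 / \<delta> \<le> real k" using real_arch_simple by blast
    have "cut n x = 1" if n: "max j k \<le> n" for n
    proof -
      have "1 \<le> real k * \<delta>" using k \<delta> by (simp add: pos_divide_le_eq)
      also have "\<dots> \<le> real n * (\<Sum>i\<le>n. infdist x (- V i))"
      proof (rule mult_mono)
        show "\<delta> \<le> (\<Sum>i\<le>n. infdist x (- V i))"
          unfolding \<delta>_def using n by (intro member_le_sum) (auto simp: infdist_nonneg)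
      qed (use n \<delta> in auto)
      finally show ?thesis unfolding cut_def by simp
    qed
    then have "\<forall>\<^sub>F n in sequentially. 1 = cut n x"
      unfolding eventually_sequentially by (intro exI[of _ "max j k"]) simp
    then show ?thesis by (rule Lim_transform_eventually[OF tendsto_const])
  qed
  define F where "F n = Bcontfun (\<lambda>x. apply_bcontfun f x * cut n x)" for n
  have le: "\<bar>apply_bcontfun f x * cut n x\<bar> \<le> norm f" for n x
    using mult_mono[OF abs_apply_le_norm[of f x] cut(2)[of n x]] cut(1)[of n x] by (simp add: abs_mult)
  have F: "apply_bcontfun (F n) x = apply_bcontfun f x * cut n x" for n x
    unfolding F_def using le cut_cont
    by (subst Bcontfun_inverse) (auto intro!: bcontfunI continuous_intros)
  show ?thesis
  proof (intro exI[of _ F] conjI allI)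
    fix n
    show "F n \<in> C0"
    proof (rule C0I)
      fix e :: real assume "0 < e"
      then show "\<exists>K. compact K \<and> (\<forall>x. x \<notin> K \<longrightarrow> \<bar>apply_bcontfun (F n) x\<bar> < e)"
        using K(1) cut_0 by (intro exI[of _ "\<Union>i\<le>n. K i"]) (simp add: F compact_UN)
    qed
    show "norm (F n) \<le> norm f" by (rule norm_bcontfun_le) (simp only: F le)
  next
    fix x
    show "(\<lambda>n. apply_bcontfun (F n) x) \<longlonglongrightarrow> apply_bcontfun f x"
      unfolding F using tendsto_mult[OF tendsto_const cut_1, of "apply_bcontfun f x" x] by simp
  qed
qed

context feller_core
begin

text \<open>The core property lets one replace \<open>f\<close> with \<open>e\<^sup>f - 1\<close> in the domain of the generator by
  an element of \<open>D\<close>; it is applied below to \<open>f = V(t) f'\<close>, which need not lie in \<open>D\<close>.\<close>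

lemma core_approx:
  assumes g: "expm1 f \<in> generator_domain P" and "0 < e"
  shows "\<exists>f'\<in>D. norm (f' - f) < e \<and> norm (H f' - log_rate (expm1 f) 0) < e"
proof -
  \<comment> \<open>\<open>?c\<close> is half of the lower bound \<open>exp (- norm f)\<close> of
    \<open>e^f\<close>: the approximants \<open>1 + F n\<close> of \<open>e^f\<close> eventually
    stay above it, so their logarithms lie in \<open>D\<close>.\<close>
  let ?g = "expm1 f" and ?c = "exp (- norm f) / 2"
  note d = domD[OF g]
  obtain F where F: "range F \<subseteq> D" "F \<longlonglongrightarrow> ?g" "(\<lambda>n. A (F n)) \<longlonglongrightarrow> A ?g"
    using D_core[OF g] by blast
  have c: "0 < ?c" by simp
  have ge: "?c \<le> 1 + apply_bcontfun ?g x" for x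
    using expm1_ge[of f x] exp_gt_zero[of "- norm f"] by linarith
  have "\<forall>\<^sub>F n in sequentially. dist (F n) ?g < ?c" using F(2) c by (rule tendstoD)
  then have Fge: "\<forall>\<^sub>F n in sequentially. \<forall>x. ?c \<le> 1 + apply_bcontfun (F n) x"
  proof eventually_elim
    case (elim n)
    show ?case
    proof
      fix x
      have "\<bar>apply_bcontfun (F n) x - apply_bcontfun ?g x\<bar> < ?c"
        using dist_fun_lt_imp_dist_val_lt[OF elim, of x] by (simp add: dist_real_def)
      then show "?c \<le> 1 + apply_bcontfun (F n) x" using expm1_ge[of f x] by linarith
    qed
  qed
  have 1: "(\<lambda>n. log1p (F n)) \<longlonglongrightarrow> f"
    using tendsto_log1p[OF F(2) c ge Fge] by (simp add: log1p_expm1)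
  \<comment> \<open>Once \<open>log1p (F n)\<close> lies in \<open>D\<close>, this quotient is its
    Hamiltonian.\<close>
  have 2: "(\<lambda>n. quot (A (F n)) (F n)) \<longlonglongrightarrow> log_rate ?g 0"
    using tendsto_quot[OF F(3,2) c ge Fge] d by (simp add: log_rate_def S_0)
  have "\<forall>\<^sub>F n in sequentially. log1p (F n) \<in> D \<and> norm (log1p (F n) - f) < e \<and> norm (H (log1p (F n)) - log_rate ?g 0) < e"
    using tendstoD[OF 1 \<open>0 < e\<close>] tendstoD[OF 2 \<open>0 < e\<close>] Fge
  proof eventually_elim
    case (elim n)
    have "F n \<in> D" using F(1) by auto
    then have "log1p (F n) \<in> D" by (rule log1p_D[OF _ c]) (use elim(3) in blast)
    moreover have "expm1 (log1p (F n)) = F n" by (rule expm1_log1p[OF c]) (use elim(3) in blast)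
    ultimately show ?case using elim(1,2) by (simp add: hamiltonian_eq dist_norm)
  qed
  from eventually_happens[OF this] show ?thesis by auto
qed

section \<open>From a bound on increments along D to the conditional rates\<close>

context
  fixes \<nu> :: "real \<Rightarrow> 'a measure" and K :: "real \<Rightarrow> real"
  assumes \<nu>: "\<nu> \<in> continuous_paths weak_topology"
    and K: "\<And>f a b. f \<in> D \<Longrightarrow> 0 \<le> a \<Longrightarrow> a \<le> b \<Longrightarrow>
      \<langle>f, \<nu> b\<rangle> - \<langle>f, \<nu> a\<rangle>
        - integral {a..b} (\<lambda>r. \<langle>H f, \<nu> r\<rangle>) \<le> K b - K a"
begin

text \<open>Passes from \<open>D\<close> to every \<open>f\<close> with \<open>e^f - 1\<close> in
  the domain of the generator, a class that contains \<open>V(r) f\<close> for all \<open>f\<close>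
  in \<open>D\<close>. The bound \<open>K\<close> will be the integral of the Lagrangian up to a
  given time.\<close>

lemma increment_le:
  assumes g: "expm1 f \<in> generator_domain P" and ab: "0 \<le> a" "a \<le> b"
  shows "\<langle>f, \<nu> b\<rangle> - \<langle>f, \<nu> a\<rangle>
        - integral {a..b} (\<lambda>r. \<langle>log_rate (expm1 f) 0, \<nu> r\<rangle>) \<le> K b - K a"
proof (rule field_le_epsilon)
  fix e :: real assume "0 < e"
  \<comment> \<open>The error \<open>e'\<close> enters over the length \<open>b - a\<close> through
    the Hamiltonian and once at each end through \<open>f'\<close>.\<close>
  define e' where "e' = e / (b - a + 2)"
  have e': "0 < e'" "(b - a + 2) * e' = e"
    using \<open>0 < e\<close> ab by (simp_all add: e'_def)
  obtain f' where f': "f' \<in> D" "norm (f' - f) < e'" "norm (H f' - log_rate (expm1 f) 0) < e'"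
    using core_approx[OF g e'(1)] by blast
  let ?h = "\<lambda>f r. \<langle>f, \<nu> r\<rangle>"
  have int: "?h k integrable_on {a..b}" for k :: "'a \<Rightarrow>\<^sub>C real"
    using path_integral_integrable[OF \<nu> ab(1), where f = k and b = b] by (simp add: absolutely_integrable_on_def)
  have "integral {a..b} (?h (H f')) \<le> integral {a..b} (\<lambda>r. ?h (log_rate (expm1 f) 0) r + e')"
  proof (rule integral_le)
    show "(\<lambda>r. ?h (log_rate (expm1 f) 0) r + e') integrable_on {a..b}"
      by (intro integrable_add int integrable_const_ivl)
    fix r assume "r \<in> {a..b}"
    then show "?h (H f') r \<le> ?h (log_rate (expm1 f) 0) r + e'"
      using abs_integral_bcontfun_diff_le[OF path_prob[OF \<nu>], of r "H f'" "log_rate (expm1 f) 0"] f'(3) ab by auto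
  qed (rule int)
  also have "\<dots> = integral {a..b} (?h (log_rate (expm1 f) 0)) + (b - a) * e'"
    using ab by (subst Henstock_Kurzweil_Integration.integral_add) (auto intro: int)
  finally have "integral {a..b} (?h (H f')) \<le> integral {a..b} (?h (log_rate (expm1 f) 0)) + (b - a) * e'" .
  moreover have "\<bar>?h f' b - ?h f b\<bar> \<le> e'" "\<bar>?h f' a - ?h f a\<bar> \<le> e'"
    using abs_integral_bcontfun_diff_le[OF path_prob[OF \<nu>], of _ f' f] f'(2) ab by (meson less_imp_le order_trans)+
  moreover have "(b - a) * e' + 2 * e' = e" using e'(2) by (simp add: algebra_simps)
  ultimately show "?h f b - ?h f a - integral {a..b} (?h (log_rate (expm1 f) 0)) \<le> K b - K a + e"
    using K[OF f'(1) ab] by linarith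
qed

text \<open>With \<open>V r\<close> for \<open>V(t - r) f\<close>, a short step of
  \<open><V r, \<nu> r>\<close> from \<open>a\<close> to \<open>b\<close> is split in two. Moving
  the measure while \<open>V b\<close> is fixed adds at most the increment of \<open>K\<close> plus
  the integral of the rate of \<open>V b\<close>, by \<open>increment_le\<close>. Changing the
  function from \<open>V a\<close> to \<open>V b\<close> against \<open>\<nu> a\<close> takes off
  \<open>b - a\<close> times the same rate. The rates cancel up to
  \<open>2 e' (b - a)\<close>.\<close>

lemma conditional_increment_le_D:
  assumes f: "f \<in> D" and st: "0 \<le> s" "s < t"
  shows "\<langle>f, \<nu> t\<rangle> - (\<integral>z. log_semigroup P (t - s) f z \<partial>\<nu> s) \<le> K t - K s"
proof -
  let ?g = "expm1 f" and ?c = "exp (- norm f)"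
  have g: "?g \<in> generator_domain P" using expm1_D[OF f] D_domain by blast
  have gC0: "?g \<in> C0" by (rule D_C0[OF expm1_D[OF f]])
  have S_ge: "?c \<le> 1 + apply_bcontfun (S r ?g) z" if "0 \<le> r" for r z
    by (rule one_plus_S_ge[OF gC0 that expm1_ge])
  define V where "V r = log1p (S (t - r) ?g)" for r
  have V_apply: "apply_bcontfun (V r) z = ln (1 + apply_bcontfun (S (t - r) ?g) z)" if "r \<le> t" for r z
    unfolding V_def by (rule apply_log1p[OF exp_gt_zero S_ge]) (use that in simp)
  have V_expm1: "expm1 (V r) = S (t - r) ?g" if "r \<le> t" for r
    unfolding V_def by (rule expm1_log1p[OF exp_gt_zero S_ge]) (use that in simp)
  let ?i = "\<lambda>k r. \<langle>k, \<nu> r\<rangle>"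
  have "?i (V t) t - ?i (V s) s \<le> (K t - K s) + e" if "0 < e" for e
  proof -
    define e' where "e' = e / (2 * (t - s))"
    have e': "0 < e'" "2 * e' * (t - s) = e" using that st by (simp_all add: e'_def field_simps)
    have vel: "continuous_on {0..t} (log_rate ?g)"
      by (rule continuous_on_subset[OF continuous_on_log_rate[OF g exp_gt_zero expm1_ge]]) auto
    obtain d1 where d1: "0 < d1" "\<forall>a b r z. 0 \<le> a \<and> a \<le> r \<and> r \<le> b \<and> b \<le> t \<and> b - a < d1 \<longrightarrow>
      \<bar>ln (1 + apply_bcontfun (S b ?g) z) - ln (1 + apply_bcontfun (S a ?g) z)
          - (b - a) * apply_bcontfun (log_rate ?g r) z\<bar> \<le> e' * (b - a)"
      using log_S_step[OF g exp_gt_zero expm1_ge e'(1), of t] by blast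
    obtain d2 where d2: "0 < d2" "\<forall>q r a. q \<in> {0..t} \<and> r \<in> {0..t} \<and> a \<in> {0..t} \<and> \<bar>r - a\<bar> < d2 \<longrightarrow>
        \<bar>?i (log_rate ?g q) r - ?i (log_rate ?g q) a\<bar> < e'"
      using path_integral_uniform[OF \<nu> vel e'(1)] by blast
    define G where "G = (\<lambda>r. K r - ?i (V r) r + 2 * e' * r)"
    have "G s \<le> G t"
    proof (rule mono_if_locally_mono[OF _ less_imp_le[OF st(2)]])
      show "0 < min d1 d2" using d1 d2 by simp
      fix a b assume ab: "s \<le> a" "a \<le> b" "b \<le> t" "b - a < min d1 d2"
      have ab0: "0 \<le> a" "0 \<le> b" using ab st by auto
      note \<nu>a = path_prob[OF \<nu> ab0(1)]
      let ?v = "log_rate ?g (t - b)"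
      have "?i (V b) b - ?i (V b) a - integral {a..b} (?i ?v) \<le> K b - K a"
      proof -
        have "expm1 (V b) \<in> generator_domain P"
          unfolding V_expm1[OF ab(3)] using ab by (intro S_domain[OF g]) simp
        moreover have "log_rate (expm1 (V b)) 0 = ?v"
          unfolding V_expm1[OF ab(3)] using ab by (intro log_rate_S[OF g]) simp
        ultimately show ?thesis using increment_le[of "V b" a b] ab0 ab(2) by simp
      qed
      moreover have "integral {a..b} (?i ?v) \<le> (b - a) * (?i ?v a + e')"
      proof -
        have int: "?i ?v integrable_on {a..b}"
          using path_integral_integrable[OF \<nu> ab0(1), where f = "?v" and b = b] by (simp add: absolutely_integrable_on_def)
        have "integral {a..b} (?i ?v) \<le> integral {a..b} (\<lambda>_. ?i ?v a + e')"
        proof (rule integral_le[OF int integrable_const_ivl])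
          fix r assume r: "r \<in> {a..b}"
          have "\<bar>?i ?v r - ?i ?v a\<bar> < e'"
            using r ab ab0 by (intro d2(2)[rule_format]) auto
          then show "?i ?v r \<le> ?i ?v a + e'" by linarith
        qed
        then show ?thesis using ab(2) by simp
      qed
      moreover have "?i (V b) a \<le> ?i (V a) a + ((- (b - a)) * ?i ?v a + e' * (b - a))"
      proof -
        have "apply_bcontfun (V b) z \<le> apply_bcontfun (V a + ((- (b - a)) *\<^sub>R ?v + const_bcontfun (e' * (b - a)))) z" for z
        proof -
          have "\<bar>ln (1 + apply_bcontfun (S (t - a) ?g) z) - ln (1 + apply_bcontfun (S (t - b) ?g) z)
              - ((t - a) - (t - b)) * apply_bcontfun ?v z\<bar> \<le> e' * ((t - a) - (t - b))"
            using ab ab0 by (intro d1(2)[rule_format]) auto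
          then show ?thesis
            using ab by (simp add: V_apply const_bcontfun.rep_eq abs_le_iff algebra_simps)
        qed
        from integral_bcontfun_mono[OF \<nu>a this] show ?thesis
          unfolding integral_bcontfun_add[OF \<nu>a] integral_bcontfun_scaleR[OF \<nu>a] integral_const_bcontfun[OF \<nu>a] .
      qed
      ultimately show "G a \<le> G b" unfolding G_def by (simp add: algebra_simps)
    qed
    then show ?thesis using e'(2) unfolding G_def by (simp add: algebra_simps)
  qed
  then have "?i (V t) t - ?i (V s) s \<le> K t - K s" by (rule field_le_epsilon)
  moreover have "V t = f"
    unfolding V_def by (simp add: S_0[OF gC0] log1p_expm1)
  moreover have "apply_bcontfun (V s) = log_semigroup P (t - s) f"
    unfolding V_def using st by (intro ext) (simp add: log_semigroup_log1p[OF gC0])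
  ultimately show ?thesis by simp
qed

text \<open>Uniform density of \<open>D\<close> in \<open>C0\<close> suffices, because
  \<open>V(t - s)\<close> is nonexpansive in sup norm.\<close>

lemma conditional_increment_le_C0:
  assumes f: "f \<in> C0" and st: "0 \<le> s" "s < t"
  shows "\<langle>f, \<nu> t\<rangle> - (\<integral>z. log_semigroup P (t - s) f z \<partial>\<nu> s) \<le> K t - K s"
proof (rule field_le_epsilon)
  fix e :: real assume "0 < e"
  then have "0 < e / 2" by simp
  moreover have "f \<in> closure D" using D_dense f by blast
  ultimately obtain f' where f': "f' \<in> D" "dist f' f < e / 2" unfolding closure_approachable by blast
  have ts: "0 \<le> t - s" "0 \<le> t" using st by auto
  note int = integrable_log_semigroup[OF ts(1) path_prob[OF \<nu> st(1)]]
  interpret prob_space "\<nu> s" using prob_algebraD(1)[OF path_prob[OF \<nu> st(1)]] .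
  have "\<bar>\<langle>f, \<nu> t\<rangle> - \<langle>f', \<nu> t\<rangle>\<bar> \<le> e / 2"
    using abs_integral_bcontfun_diff_le[OF path_prob[OF \<nu> ts(2)], of f f'] f'(2) by (simp add: dist_norm norm_minus_commute)
  moreover have "(\<integral>z. log_semigroup P (t - s) f' z \<partial>\<nu> s) \<le> (\<integral>z. log_semigroup P (t - s) f z + e / 2 \<partial>\<nu> s)"
  proof (rule integral_mono[OF int])
    fix z
    have "apply_bcontfun f' y \<le> apply_bcontfun f y + e / 2" for y
      using abs_diff_apply_le[of f' y f] f'(2) by (simp add: dist_norm abs_le_iff)
    then show "log_semigroup P (t - s) f' z \<le> log_semigroup P (t - s) f z + e / 2"
      by (rule log_semigroup_bounds[OF ts(1)])
  qed (use int in simp)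
  moreover have "(\<integral>z. log_semigroup P (t - s) f z + e / 2 \<partial>\<nu> s) = (\<integral>z. log_semigroup P (t - s) f z \<partial>\<nu> s) + e / 2"
    using int by (simp add: prob_space)
  ultimately show "\<langle>f, \<nu> t\<rangle> - (\<integral>z. log_semigroup P (t - s) f z \<partial>\<nu> s) \<le> (K t - K s) + e"
    using conditional_increment_le_D[OF f'(1) st] by linarith
qed

text \<open>Uniform limits of \<open>C0\<close> functions stay in \<open>C0\<close>, so a general
  bounded continuous \<open>f\<close> is reached by bounded pointwise limits instead. On the second
  term dominated convergence is used twice, inside \<open>V(t - s)\<close> and then against
  \<open>\<nu> s\<close>.\<close>

lemma conditional_rate_le:
  assumes lc: "locally_compact_space (euclidean :: 'a topology)" and st: "0 \<le> s" "s < t"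
  shows "conditional_rate P (t - s) (\<nu> t) (\<nu> s) \<le> ereal (K t - K s)"
  unfolding conditional_rate_def
proof (rule SUP_least)
  fix f :: "'a \<Rightarrow>\<^sub>C real"
  obtain F where F: "\<forall>n. F n \<in> C0 \<and> norm (F n) \<le> norm f" "\<forall>x. (\<lambda>n. apply_bcontfun (F n) x) \<longlonglongrightarrow> apply_bcontfun f x"
    using C0_bounded_pointwise_dense[OF lc, of f] by blast
  have ts: "0 \<le> t - s" "0 \<le> t" using st by auto
  have F_le: "\<bar>apply_bcontfun (F n) x\<bar> \<le> norm f" for n x
    using order_trans[OF abs_apply_le_norm[of "F n" x]] F(1) by blast
  have 1: "(\<lambda>n. \<langle>F n, \<nu> t\<rangle>) \<longlonglongrightarrow> \<langle>f, \<nu> t\<rangle>"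
  proof (rule integral_dominated_convergence[where w = "\<lambda>_. norm f"])
    interpret prob_space "\<nu> t" using prob_algebraD(1)[OF path_prob[OF \<nu> ts(2)]] .
    show "integrable (\<nu> t) (\<lambda>_. norm f)" by simp
  qed (use F F_le in \<open>auto intro!: borel_measurable_bcontfun_prob path_prob[OF \<nu> ts(2)]\<close>)
  have V: "(\<lambda>n. log_semigroup P (t - s) (F n) x) \<longlonglongrightarrow> log_semigroup P (t - s) f x" for x
  proof -
    interpret prob_space "P (t - s) x" using prob_algebraD(1)[OF P_prob[OF ts(1)]] .
    have m: "(\<lambda>y. exp (apply_bcontfun k y)) \<in> borel_measurable (P (t - s) x)" for k :: "'a \<Rightarrow>\<^sub>C real"
      using borel_measurable_bcontfun_prob[OF P_prob[OF ts(1)], of k x] by measurable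
    have lim: "(\<lambda>n. \<integral>y. exp (apply_bcontfun (F n) y) \<partial>P (t - s) x) \<longlonglongrightarrow> (\<integral>y. exp (apply_bcontfun f y) \<partial>P (t - s) x)"
    proof (rule integral_dominated_convergence[where w = "\<lambda>_. exp (norm f)"])
      show "AE y in P (t - s) x. (\<lambda>n. exp (apply_bcontfun (F n) y)) \<longlonglongrightarrow> exp (apply_bcontfun f y)"
        using F(2) by (intro AE_I2 tendsto_exp) auto
      show "AE y in P (t - s) x. norm (exp (apply_bcontfun (F n) y)) \<le> exp (norm f)" for n
        using F_le[of n] by (intro AE_I2) (simp add: abs_le_iff)
    qed (auto intro: m)
    have "exp (- norm f) \<le> (\<integral>y. exp (apply_bcontfun f y) \<partial>P (t - s) x)"
    proof (rule integral_ge_const)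
      show "integrable (P (t - s) x) (\<lambda>y. exp (apply_bcontfun f y))"
        using abs_apply_le_norm[of f] by (intro integrable_const_bound[where B = "exp (norm f)"] m) (auto simp: abs_le_iff)
      show "AE y in P (t - s) x. exp (- norm f) \<le> exp (apply_bcontfun f y)"
        using abs_apply_le_norm[of f] by (intro AE_I2) (simp add: abs_le_iff minus_le_iff)
    qed
    then have "(\<integral>y. exp (apply_bcontfun f y) \<partial>P (t - s) x) \<noteq> 0"
      using exp_gt_zero[of "- norm f"] by linarith
    then show ?thesis unfolding log_semigroup_def by (intro tendsto_ln lim)
  qed
  have 2: "(\<lambda>n. \<integral>z. log_semigroup P (t - s) (F n) z \<partial>\<nu> s) \<longlonglongrightarrow> (\<integral>z. log_semigroup P (t - s) f z \<partial>\<nu> s)"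
  proof (rule integral_dominated_convergence[where w = "\<lambda>_. norm f"])
    interpret prob_space "\<nu> s" using prob_algebraD(1)[OF path_prob[OF \<nu> st(1)]] .
    show "integrable (\<nu> s) (\<lambda>_. norm f)" by simp
    show "AE z in \<nu> s. norm (log_semigroup P (t - s) (F n) z) \<le> norm f" for n
      using order_trans[OF abs_log_semigroup_le[OF ts(1)]] F(1) by (intro AE_I2) auto
    show "AE z in \<nu> s. (\<lambda>n. log_semigroup P (t - s) (F n) z) \<longlonglongrightarrow> log_semigroup P (t - s) f z"
      using V by (intro AE_I2)
  qed (use integrable_log_semigroup[OF ts(1) path_prob[OF \<nu> st(1)]] in auto)
  have "\<langle>f, \<nu> t\<rangle> - (\<integral>z. log_semigroup P (t - s) f z \<partial>\<nu> s) \<le> K t - K s"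
  proof (rule LIMSEQ_le_const2[OF tendsto_diff[OF 1 2]])
    show "\<exists>N. \<forall>n\<ge>N. \<langle>F n, \<nu> t\<rangle> - (\<integral>z. log_semigroup P (t - s) (F n) z \<partial>\<nu> s) \<le> K t - K s"
      using conditional_increment_le_C0[OF _ st] F(1) by blast
  qed
  then show "ereal (\<langle>f, \<nu> t\<rangle> - (\<integral>z. log_semigroup P (t - s) f z \<partial>\<nu> s)) \<le> ereal (K t - K s)"
    by simp
qed

lemma path_cost_le:
  assumes lc: "locally_compact_space (euclidean :: 'a topology)" and kt: "(k, t) \<in> partitions"
  shows "path_cost \<nu> k t \<le> ereal (K (t k) - K 0)"
proof -
  have "path_cost \<nu> k t \<le> (\<Sum>i=1..k. ereal (K (t i) - K (t (i - 1))))"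
    unfolding path_cost_def
  proof (rule sum_mono)
    fix i assume "i \<in> {1..k}"
    then show "conditional_rate P (t i - t (i - 1)) (\<nu> (t i)) (\<nu> (t (i - 1))) \<le> ereal (K (t i) - K (t (i - 1)))"
      using partition_nonneg[OF kt, of "i - 1"] by (intro conditional_rate_le lc partition_less[OF kt]) auto
  qed
  also have "\<dots> = ereal (\<Sum>i=1..k. K (t i) - K (t (i - 1)))" by simp
  also have "(\<Sum>i=1..k. K (t i) - K (t (i - 1))) = K (t k) - K (t 0)"
    by (induction k) auto
  finally show ?thesis using kt by (simp add: partitions_def)
qed

end

text \<open>When the integral is finite, \<open>K y\<close> is its part up to time \<open>y\<close>.
  Additivity of \<open>K\<close> over intervals requires measurability of the Lagrangian in time,
  which comes from its countable form over \<open>Q\<close>.\<close>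

lemma action_le_lagrangian:
  assumes lc: "locally_compact_space (euclidean :: 'a topology)"
    and \<nu>: "\<nu> \<in> continuous_paths weak_topology" and u: "has_velocity \<tau> \<nu> u"
  shows "action \<nu> \<le> enn2ereal (\<integral>\<^sup>+s\<in>{0..}. e2ennreal (lagrangian P D (\<nu> s) (u s)) \<partial>lebesgue)"
    (is "_ \<le> enn2ereal ?I")
proof (cases "?I = \<infinity>")
  case False
  define L where "L s = e2ennreal (lagrangian P D (\<nu> s) (u s))" for s
  define N where "N X = (\<integral>\<^sup>+s\<in>X. L s \<partial>lebesgue)" for X
  define w where "w f s = u s f - \<langle>H f, \<nu> s\<rangle>" for f s
  obtain Q where Q: "countable Q" "Q \<subseteq> D" "D \<subseteq> \<tau> closure_of Q"
    using ex_dense_rational_space by blast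
  have w_le: "ennreal (w f s) \<le> L s" if "f \<in> D" for f s
  proof -
    have "ereal (w f s) \<le> lagrangian P D (\<nu> s) (u s)"
      unfolding lagrangian_def w_def by (rule SUP_upper[OF that])
    from e2ennreal_mono[OF this] show ?thesis by (simp add: L_def)
  qed
  have w_meas: "w f \<in> borel_measurable (lebesgue_on {0..})" if "f \<in> D" for f
    unfolding w_def[abs_def]
  proof (rule borel_measurable_diff)
    show "(\<lambda>s. u s f) \<in> borel_measurable (lebesgue_on {0..})"
      using u that unfolding has_velocity_def topspace_\<tau> by blast
    show "(\<lambda>s. \<langle>H f, \<nu> s\<rangle>) \<in> borel_measurable (lebesgue_on {0..})"
      by (intro continuous_imp_measurable_on_sets_lebesgue continuous_on_path_integral[OF \<nu>]) auto
  qed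
  have "(\<lambda>s. SUP f\<in>Q. ennreal (w f s)) \<in> borel_measurable (lebesgue_on {0..})"
    using Q(2) w_meas by (intro borel_measurable_SUP Q(1) measurable_compose[OF _ measurable_ennreal]) auto
  then have "(\<lambda>s. (SUP f\<in>Q. ennreal (w f s)) * indicator {0..} s) \<in> borel_measurable lebesgue"
    by (subst (asm) borel_measurable_restrict_space_iff_ennreal) auto
  also have "(\<lambda>s. (SUP f\<in>Q. ennreal (w f s)) * indicator {0..} s) = (\<lambda>s. L s * indicator {0..} s)"
  proof
    fix s
    show "(SUP f\<in>Q. ennreal (w f s)) * indicator {0..} s = L s * indicator {0..} s"
    proof (cases "0 \<le> s")
      case True
      then have "u s \<in> dual_space \<tau>" using u by (simp add: has_velocity_def)
      then show ?thesis
        unfolding w_def L_def by (simp add: lagrangian_dense[OF Q(2,3) _ path_prob[OF \<nu> True]] e2ennreal_SUP_ereal)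
    qed simp
  qed
  finally have L_meas: "(\<lambda>s. L s * indicator {0..} s) \<in> borel_measurable lebesgue" .
  have meas: "(\<lambda>s. L s * indicator X s) \<in> borel_measurable lebesgue" if "X \<in> sets borel" "X \<subseteq> {0..}" for X
  proof -
    have "(\<lambda>s. (L s * indicator {0..} s) * indicator X s) \<in> borel_measurable lebesgue"
      using that by (intro borel_measurable_times_ennreal L_meas borel_measurable_indicator) auto
    also have "(\<lambda>s. (L s * indicator {0..} s) * indicator X s) = (\<lambda>s. L s * indicator X s)"
      using that(2) by (auto simp: fun_eq_iff split: split_indicator)
    finally show ?thesis .
  qed
  have N_fin: "N X \<noteq> \<infinity>" "N X \<le> ?I" if "X \<subseteq> {0..}" for X
  proof -
    show "N X \<le> ?I" unfolding N_def L_def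
      using that by (intro nn_integral_mono mult_left_mono) (auto split: split_indicator)
    with False show "N X \<noteq> \<infinity>" by (auto simp: top_unique)
  qed
  define K where "K y = enn2real (N {0..y})" for y
  have N_add: "N {0..b} = N {0..a} + N {a<..b}" if "0 \<le> a" "a \<le> b" for a b
  proof -
    have "N {0..b} = (\<integral>\<^sup>+s. L s * indicator {0..a} s + L s * indicator {a<..b} s \<partial>lebesgue)"
      unfolding N_def using that by (intro nn_integral_cong) (auto split: split_indicator)
    also have "\<dots> = N {0..a} + N {a<..b}"
      unfolding N_def using that by (intro nn_integral_add meas) auto
    finally show ?thesis .
  qed
  have N_K: "N {a<..b} = ennreal (K b - K a)" if "0 \<le> a" "a \<le> b" for a b
  proof -
    have e: "N {0..x} = ennreal (K x)" for x
      unfolding K_def using N_fin(1)[of "{0..x}"] by (auto simp: less_top)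
    have k: "0 \<le> K x" for x unfolding K_def by simp
    have "{a<..b} \<subseteq> {0..}" using that by auto
    from N_fin(1)[OF this] have "N {a<..b} = ennreal (enn2real (N {a<..b}))"
      by (simp add: less_top)
    moreover from N_add[OF that] have "ennreal (K b) = ennreal (K a + enn2real (N {a<..b}))"
      unfolding e using calculation k by (simp add: ennreal_plus)
    then have "K b = K a + enn2real (N {a<..b})"
      using k by (subst (asm) ennreal_inj) auto
    ultimately show ?thesis by simp
  qed
  have K: "\<langle>f, \<nu> b\<rangle> - \<langle>f, \<nu> a\<rangle>
        - integral {a..b} (\<lambda>r. \<langle>H f, \<nu> r\<rangle>) \<le> K b - K a"
    if f: "f \<in> D" and ab: "0 \<le> a" "a \<le> b" for f a b
  proof -
    have ui: "(\<lambda>s. u s f) absolutely_integrable_on {a..b}"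
      using set_integrable_subset[OF velocity_integrable[OF u f, of b], of "{a..b}"] ab by auto
    note hi = path_integral_integrable[OF \<nu> ab(1), where f = "H f" and b = b]
    have wi: "w f absolutely_integrable_on {a..b}"
      unfolding w_def[abs_def] by (intro set_integral_diff(1) ui hi)
    have "integral {a..b} (w f) = integral {a..b} (\<lambda>s. u s f) - integral {a..b} (\<lambda>r. \<langle>H f, \<nu> r\<rangle>)"
      unfolding w_def[abs_def] using ui hi
      by (intro Henstock_Kurzweil_Integration.integral_diff) (auto simp: absolutely_integrable_on_def)
    then have eq: "\<langle>f, \<nu> b\<rangle> - \<langle>f, \<nu> a\<rangle>
        - integral {a..b} (\<lambda>r. \<langle>H f, \<nu> r\<rangle>) = integral {a..b} (w f)"
      using velocity_integral[OF u f ab] by simp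
    have "ennreal (integral {a..b} (w f)) \<le> N {a<..b}"
    proof -
      have i: "integrable lebesgue (\<lambda>s. indicator {a..b} s *\<^sub>R w f s)"
        using wi by (simp add: set_integrable_def)
      have "integral {a..b} (w f) = (\<integral>s. indicator {a..b} s *\<^sub>R w f s \<partial>lebesgue)"
        using set_lebesgue_integral_eq_integral(2)[OF wi] by (simp add: set_lebesgue_integral_def)
      \<comment> \<open>\<open>L s\<close> dominates \<open>ennreal (w f s)\<close>, that is, the
        positive part of \<open>w f s\<close>.\<close>
      also have "\<dots> \<le> (\<integral>s. max 0 (indicator {a..b} s *\<^sub>R w f s) \<partial>lebesgue)"
        using i by (intro integral_mono integrable_max) auto
      finally have "ennreal (integral {a..b} (w f)) \<le> ennreal (\<integral>s. max 0 (indicator {a..b} s *\<^sub>R w f s) \<partial>lebesgue)"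
        by (rule ennreal_leI)
      also have "\<dots> = (\<integral>\<^sup>+s. ennreal (max 0 (indicator {a..b} s *\<^sub>R w f s)) \<partial>lebesgue)"
        using i by (intro nn_integral_eq_integral[symmetric] integrable_max) auto
      also have "\<dots> \<le> (\<integral>\<^sup>+s\<in>{a<..b}. L s \<partial>lebesgue)"
      proof (rule nn_integral_mono_AE)
        \<comment> \<open>The half-open interval, chosen for additivity, misses only the null set
          consisting of \<open>a\<close>.\<close>
        have "AE s in lebesgue. s \<noteq> a"
          by (rule AE_completion) (rule AE_lborel_singleton)
        then show "AE s in lebesgue. ennreal (max 0 (indicator {a..b} s *\<^sub>R w f s)) \<le> L s * indicator {a<..b} s"
        proof eventually_elim
          case (elim s)
          then show ?case using w_le[OF f, of s]
            by (auto simp: max_def ennreal_neg split: split_indicator)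
        qed
      qed
      finally show ?thesis by (simp add: N_def)
    qed
    moreover have "K a \<le> K b"
      unfolding K_def using N_add[OF ab] N_fin(1)[of "{0..b}"] by (intro enn2real_mono) (auto simp: less_top)
    ultimately show ?thesis
      unfolding eq N_K[OF ab] by (subst (asm) ennreal_le_iff) simp_all
  qed
  show ?thesis
    unfolding action_def
  proof (rule SUP_least, clarify)
    fix k t assume kt: "(k, t) \<in> partitions"
    have tk: "0 \<le> t k" by (rule partition_nonneg[OF kt]) simp
    have "path_cost \<nu> k t \<le> ereal (K (t k) - K 0)" by (rule path_cost_le[OF \<nu> K lc kt])
    also have "\<dots> \<le> ereal (K (t k))" by (simp add: K_def)
    also have "\<dots> = enn2ereal (N {0..t k})"
      unfolding K_def using N_fin(1)[of "{0..t k}"] by (cases "N {0..t k}") (auto simp: ennreal.rep_eq)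
    also have "\<dots> \<le> enn2ereal ?I"
      using N_fin(2)[of "{0..t k}"] by (simp add: less_eq_ennreal.rep_eq)
    finally show "path_cost \<nu> k t \<le> enn2ereal ?I" .
  qed
qed simp

end

section \<open>Existence of a velocity\<close>

text \<open>The supremum over the pair \<open>v\<close>, \<open>- v\<close> is the absolute value of
  \<open>v\<close>, and \<open>nn_integral_SUP_le\<close> with \<open>m = 0\<close> shows that its
  integral over the half line vanishes.\<close>

lemma AE_zero_if_integrals_zero:
  fixes v :: "real \<Rightarrow> real"
  assumes v: "v \<in> borel_measurable borel"
    and int: "\<And>t. v absolutely_integrable_on {0..t}"
    and zero: "\<And>x y. 0 \<le> x \<Longrightarrow> x \<le> y \<Longrightarrow> integral {x..y} v = 0"
  shows "AE s in lebesgue. 0 \<le> s \<longrightarrow> v s = 0"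
proof -
  let ?w = "\<lambda>(b::bool) s. if b then v s else - v s"
  have int': "?w b absolutely_integrable_on {0..t}" for b t
    using int[of t] set_integrable_mult_right[of "- 1" lebesgue "{0..t}" v] by (cases b) auto
  have "(\<integral>\<^sup>+s\<in>{0..}. (SUP b\<in>UNIV. ennreal (?w b s)) \<partial>lebesgue) \<le> ennreal 0"
  proof (rule nn_integral_SUP_le[where m = "\<lambda>_. 0"])
    show "integral {x..y} (?w b) \<le> 0 - 0" if "0 \<le> x" "x \<le> y" for b x y
      using zero[OF that] by (cases b) auto
  qed (use int' in auto)
  moreover have m: "(\<lambda>s. (SUP b\<in>UNIV. ennreal (?w b s)) * indicator {0..} s) \<in> borel_measurable lebesgue"
  proof (rule measurable_completion)
    have [measurable]: "v \<in> borel_measurable lborel" using v by simp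
    show "(\<lambda>s. (SUP b\<in>UNIV. ennreal (?w b s)) * indicator {0..} s) \<in> borel_measurable lborel"
      by (intro borel_measurable_times_ennreal borel_measurable_SUP) auto
  qed
  ultimately have "AE s in lebesgue. (SUP b\<in>UNIV. ennreal (?w b s)) * indicator {0..} s = 0"
    unfolding nn_integral_0_iff_AE[OF m, symmetric] by simp
  then show ?thesis
  proof eventually_elim
    case (elim s)
    show ?case
    proof
      assume "0 \<le> s"
      with elim have z: "(SUP b\<in>UNIV. ennreal (?w b s)) = 0" by simp
      have "ennreal (?w b s) \<le> 0" for b
        unfolding z[symmetric] by (rule SUP_upper) simp
      from this[of True] this[of False] show "v s = 0" by (simp add: ennreal_eq_0_iff)
    qed
  qed
qed

context feller_core
begin

text \<open>The increment bound is applied to \<open>c f\<close> and \<open>- c f\<close>. Since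
  \<open>H\<close> of either is bounded in sup norm, this yields for every \<open>c\<close> the
  domination that \<open>density_of_superlinearly_dominated\<close> asks for.\<close>

lemma action_density:
  assumes \<nu>: "\<nu> \<in> continuous_paths weak_topology" and fin: "action \<nu> \<noteq> \<infinity>" and f: "f \<in> D"
  shows "\<exists>w \<in> borel_measurable borel. \<forall>x y. 0 \<le> x \<and> x \<le> y \<longrightarrow> w absolutely_integrable_on {x..y} \<and>
    integral {x..y} w = \<langle>f, \<nu> y\<rangle> - \<langle>f, \<nu> x\<rangle>"
proof -
  let ?i = "\<lambda>f t. \<langle>f, \<nu> t\<rangle>"
  \<comment> \<open>Continuation by a constant to negative times, since the density lemma works on
    the whole line.\<close>
  define F where "F t = ?i f (max 0 t)" for t
  define m where "m t = action_fun \<nu> (max 0 t)" for t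
  have one: "?i k y - ?i k x \<le> action_fun \<nu> y - action_fun \<nu> x + norm (H k) * (y - x)"
    if "k \<in> D" "0 \<le> x" "x \<le> y" for k x y
  proof -
    have "integral {x..y} (?i (H k)) \<le> integral {x..y} (\<lambda>_. norm (H k))"
    proof (rule integral_le)
      show "?i (H k) integrable_on {x..y}"
        using path_integral_integrable[OF \<nu> that(2), where f = "H k" and b = y] by (simp add: absolutely_integrable_on_def)
      fix r assume "r \<in> {x..y}"
      then show "?i (H k) r \<le> norm (H k)"
        using abs_integral_bcontfun_le[OF path_prob[OF \<nu>], of r "H k"] that by (auto simp: abs_le_iff)
    qed auto
    then show ?thesis using action_fun_ge[OF \<nu> fin that] that(3) by (simp add: mult.commute)
  qed
  have ac: "\<exists>C\<ge>0. \<forall>x y. x \<le> y \<longrightarrow> c * \<bar>F y - F x\<bar> \<le> m y - m x + C * (y - x)" if c: "0 < c" for c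
  proof -
    have cD: "c *\<^sub>R f \<in> D" "(- c) *\<^sub>R f \<in> D" using f subspace_scale[OF D_subspace] by blast+
    define C where "C = max (norm (H (c *\<^sub>R f))) (norm (H ((- c) *\<^sub>R f)))"
    have "0 \<le> C" by (simp add: C_def le_max_iff_disj)
    moreover have "c * \<bar>F y - F x\<bar> \<le> m y - m x + C * (y - x)" if "x \<le> y" for x y
    proof -
      let ?x = "max 0 x" and ?y = "max 0 y"
      have xy: "0 \<le> ?x" "?x \<le> ?y" "?y - ?x \<le> y - x" using that by auto
      have C: "norm (H (c *\<^sub>R f)) * (?y - ?x) \<le> C * (y - x)" "norm (H ((- c) *\<^sub>R f)) * (?y - ?x) \<le> C * (y - x)"
        using xy \<open>0 \<le> C\<close> by (auto intro!: mult_mono simp: C_def)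
      have "c * (F y - F x) \<le> m y - m x + C * (y - x)" "- c * (F y - F x) \<le> m y - m x + C * (y - x)"
        using one[OF cD(1) xy(1,2)] one[OF cD(2) xy(1,2)] C
        by (simp_all add: F_def m_def right_diff_distrib)
      moreover have "c * \<bar>F y - F x\<bar> = \<bar>c * (F y - F x)\<bar>" using c by (simp add: abs_mult)
      ultimately show ?thesis by (simp add: abs_le_iff)
    qed
    ultimately show ?thesis by blast
  qed
  obtain w where w: "w \<in> borel_measurable borel" "\<And>x y. x \<le> y \<Longrightarrow> set_integrable lborel {x<..y} w"
    "\<And>x y. x \<le> y \<Longrightarrow> F y - F x = (LINT s:{x<..y}|lborel. w s)"
  proof (rule density_of_superlinearly_dominated[OF _ _ _ _ ac])
    show "mono m" unfolding m_def by (intro monoI action_fun_mono[OF fin]) auto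
    show "m x \<le> real_of_ereal (action \<nu>)" "0 \<le> m x" for x
      unfolding m_def by (auto intro: action_fun_le[OF fin] action_fun_nonneg[OF fin])
    have "continuous_on UNIV F"
      unfolding F_def[abs_def]
      by (rule continuous_on_compose2[OF continuous_on_path_integral[OF \<nu>, of f]]) (auto intro!: continuous_intros)
    then have "isCont F x" for x by (simp add: continuous_on_eq_continuous_at)
    then show "continuous (at_right x) F" for x by (rule continuous_at_imp_continuous_within)
  qed (assumption, (rule that; simp))
  show ?thesis
  proof (intro bexI[OF _ w(1)] allI impI)
    fix x y :: real assume xy: "0 \<le> x \<and> x \<le> y"
    \<comment> \<open>Integrability is given on half-open intervals; starting at
      \<open>x - 1\<close> includes the point \<open>x\<close>.\<close>
    have "set_integrable lborel {x..y} w"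
      by (rule set_integrable_subset[OF w(2)[of "x - 1" y]]) (use xy in auto)
    then have 1: "w absolutely_integrable_on {x..y}"
      unfolding set_integrable_def by (intro integrable_completion[THEN iffD2]) auto
    have "integral {x..y} w = integral {x<..y} w"
      by (rule integral_subset_negligible[symmetric]) (auto intro: negligible_subset[of "{x}"])
    also have "\<dots> = (LINT s:{x<..y}|lborel. w s)"
      using xy by (intro set_borel_integral_eq_integral(2)[symmetric] w(2)) simp
    also have "\<dots> = ?i f y - ?i f x" using w(3)[of x y] xy by (simp add: F_def max_def)
    finally show "w absolutely_integrable_on {x..y} \<and> integral {x..y} w = ?i f y - ?i f x" using 1 by simp
  qed
qed

section \<open>The gauge of a barrel and functionals bounded by it\<close>

lemma continuous_map_affine:
  assumes f: "f \<in> D"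
  shows "continuous_map \<tau> \<tau> (\<lambda>g. c *\<^sub>R (g - f))"
proof -
  have add: "continuous_map (prod_topology \<tau> \<tau>) \<tau> (\<lambda>(f, g). f + g)"
    and scale: "continuous_map (prod_topology euclideanreal \<tau>) \<tau> (\<lambda>(c, f). c *\<^sub>R f)"
    using \<tau>_lcs by (simp_all add: locally_convex_space_def)
  have "- f \<in> D" using subspace_neg[OF D_subspace f] .
  then have "continuous_map \<tau> (prod_topology \<tau> \<tau>) (\<lambda>g. (g, - f))"
    by (intro continuous_map_pairedI) (simp_all add: topspace_\<tau>)
  from continuous_map_compose[OF this add] have "continuous_map \<tau> \<tau> (\<lambda>g. g - f)" by (simp add: o_def)
  then have "continuous_map \<tau> (prod_topology euclideanreal \<tau>) (\<lambda>g. (c, g - f))"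
    by (intro continuous_map_pairedI) simp_all
  from continuous_map_compose[OF this scale] show ?thesis by (simp add: o_def)
qed

context
  fixes B assumes B: "barrel \<tau> B"
begin

text \<open>Stands for the bound by \<open>r\<close> of the Minkowski gauge of \<open>B\<close> at
  \<open>f\<close>, stated by membership so that no infimum has to be taken. Homogeneity,
  monotonicity and the triangle inequality of the gauge follow below.\<close>

definition inB :: "real \<Rightarrow> ('a \<Rightarrow>\<^sub>C real) \<Rightarrow> bool" where
  "inB r f \<longleftrightarrow> 0 \<le> r \<and> (\<exists>b\<in>B. f = r *\<^sub>R b)"

lemma barrel_balanced: "\<bar>c\<bar> \<le> 1 \<Longrightarrow> f \<in> B \<Longrightarrow> c *\<^sub>R f \<in> B"
  using B unfolding barrel_def by blast

lemma barrel_absorbing: "f \<in> D \<Longrightarrow> \<exists>r>0. inB r f"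
proof -
  assume "f \<in> D"
  then obtain r where r: "r > 0" "\<forall>c. r \<le> \<bar>c\<bar> \<longrightarrow> f \<in> (\<lambda>g. c *\<^sub>R g) ` B"
    using B unfolding barrel_def topspace_\<tau> by blast
  then have "f \<in> (\<lambda>g. r *\<^sub>R g) ` B" by simp
  then show ?thesis using r(1) unfolding inB_def by (intro exI[of _ r]) auto
qed

lemma barrel_zero: "0 \<in> B"
proof -
  obtain r where "inB r 0" using barrel_absorbing subspace_0[OF D_subspace] by blast
  then obtain b where "b \<in> B" unfolding inB_def by blast
  then show ?thesis using barrel_balanced[of 0 b] by simp
qed

lemma inB_scale: "inB r f \<Longrightarrow> inB (\<bar>c\<bar> * r) (c *\<^sub>R f)"
proof -
  assume "inB r f"
  then obtain b where b: "0 \<le> r" "b \<in> B" "f = r *\<^sub>R b" unfolding inB_def by blast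
  have eq: "c *\<^sub>R f = (\<bar>c\<bar> * r) *\<^sub>R (sgn c *\<^sub>R b)"
    unfolding b(3) by (simp add: mult.commute mult.left_commute abs_mult_sgn mult.assoc[symmetric])
  have "sgn c *\<^sub>R b \<in> B" by (rule barrel_balanced[OF _ b(2)]) (simp add: sgn_if)
  with b(1) show ?thesis
    unfolding inB_def by (intro conjI bexI[where x = "sgn c *\<^sub>R b"] eq) simp_all
qed

lemma inB_uminus: "inB r f \<Longrightarrow> inB r (- f)"
  using inB_scale[of r f "- 1"] by simp

lemma inB_mono: "inB r f \<Longrightarrow> r \<le> s \<Longrightarrow> inB s f"
proof -
  assume "inB r f" and rs: "r \<le> s"
  then obtain b where b: "0 \<le> r" "b \<in> B" "f = r *\<^sub>R b" unfolding inB_def by blast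
  show ?thesis
  proof (cases "s = 0")
    case True
    then show ?thesis using b rs unfolding inB_def by auto
  next
    case False
    then have eq: "f = s *\<^sub>R ((r / s) *\<^sub>R b)" using b(3) by simp
    have "0 \<le> r / s" "r / s \<le> 1" using b(1) rs False by auto
    then have "(r / s) *\<^sub>R b \<in> B" by (intro barrel_balanced[OF _ b(2)]) simp
    with b(1) rs show ?thesis
      unfolding inB_def by (intro conjI bexI[where x = "(r / s) *\<^sub>R b"] eq) simp_all
  qed
qed

lemma inB_add: "inB r f \<Longrightarrow> inB s g \<Longrightarrow> inB (r + s) (f + g)"
proof -
  assume "inB r f" "inB s g"
  then obtain b d where b: "0 \<le> r" "b \<in> B" "f = r *\<^sub>R b" and d: "0 \<le> s" "d \<in> B" "g = s *\<^sub>R d"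
    unfolding inB_def by blast
  show ?thesis
  proof (cases "r + s = 0")
    case True
    then have "r = 0" "s = 0" using b(1) d(1) by auto
    then show ?thesis using b d barrel_zero unfolding inB_def by auto
  next
    case False
    have "convex B" using B unfolding barrel_def by blast
    then have "(r / (r + s)) *\<^sub>R b + (s / (r + s)) *\<^sub>R d \<in> B"
      using b d False by (intro convexD) (auto simp: add_divide_distrib[symmetric])
    moreover have "f + g = (r + s) *\<^sub>R ((r / (r + s)) *\<^sub>R b + (s / (r + s)) *\<^sub>R d)"
      using False b(3) d(3) by (simp add: scaleR_add_right)
    ultimately show ?thesis unfolding inB_def using b(1) d(1) by auto
  qed
qed

lemma barrel_nhd: "\<exists>U. openin \<tau> U \<and> 0 \<in> U \<and> U \<subseteq> B"
  using \<tau>_barrelled B unfolding barrelled_def by blast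

text \<open>Barrelledness makes \<open>B\<close> contain a neighbourhood of 0. Translating and
  shrinking it yields neighbourhoods of \<open>f\<close> that are small for the gauge, and
  intersecting with a sup norm ball makes them small in norm as well.\<close>

lemma nhd_inB:
  assumes f: "f \<in> D" and e: "0 < e"
  shows "\<exists>W. openin \<tau> W \<and> f \<in> W \<and> (\<forall>g\<in>W. g \<in> D \<and> inB e (g - f) \<and> norm (g - f) \<le> e)"
proof -
  obtain U where U: "openin \<tau> U" "0 \<in> U" "U \<subseteq> B" using barrel_nhd by blast
  have "openin \<tau> (D \<inter> ball 0 1)" using \<tau>_finer by (simp add: openin_open_Int)
  then have U': "openin \<tau> (U \<inter> (D \<inter> ball 0 1))" using U(1) by (rule openin_Int[rotated])
  let ?W = "{g \<in> topspace \<tau>. (1 / e) *\<^sub>R (g - f) \<in> U \<inter> (D \<inter> ball 0 1)}"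
  have "openin \<tau> ?W" by (rule openin_continuous_map_preimage[OF continuous_map_affine[OF f] U'])
  moreover have "f \<in> ?W" using f U(2) subspace_0[OF D_subspace] by (simp add: topspace_\<tau>)
  moreover have "g \<in> D \<and> inB e (g - f) \<and> norm (g - f) \<le> e" if g: "g \<in> ?W" for g
  proof -
    have "(1 / e) *\<^sub>R (g - f) \<in> B" "norm ((1 / e) *\<^sub>R (g - f)) < 1" using g U(3) by auto
    then have "inB e (g - f)" "norm (g - f) \<le> e"
      unfolding inB_def using e
      by (auto simp: divide_less_eq intro!: bexI[of _ "(1 / e) *\<^sub>R (g - f)"])
    then show ?thesis using g by (simp add: topspace_\<tau>)
  qed
  ultimately show ?thesis by (intro exI[of _ ?W]) blast
qed

lemma dense_approx:
  assumes Q: "D \<subseteq> \<tau> closure_of Q" and f: "f \<in> D" and e: "0 < e"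
  shows "\<exists>q\<in>Q. inB e (q - f) \<and> norm (q - f) \<le> e"
proof -
  obtain W where W: "openin \<tau> W" "f \<in> W" "\<forall>g\<in>W. g \<in> D \<and> inB e (g - f) \<and> norm (g - f) \<le> e"
    using nhd_inB[OF f e] by blast
  have "f \<in> \<tau> closure_of Q" using Q f by blast
  then have "\<exists>q. q \<in> Q \<and> q \<in> W" unfolding in_closure_of using W(1,2) by blast
  then show ?thesis using W(3) by blast
qed

text \<open>A linear functional that is bounded on the barrel is bounded on a neighbourhood of 0,
  hence continuous.\<close>

lemma dual_spaceI_barrel:
  assumes add: "\<And>f g. f \<in> D \<Longrightarrow> g \<in> D \<Longrightarrow> u (f + g) = u f + u g"
    and scale: "\<And>c f. f \<in> D \<Longrightarrow> u (c *\<^sub>R f) = c * u f"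
    and bound: "\<And>r f. f \<in> D \<Longrightarrow> inB r f \<Longrightarrow> \<bar>u f\<bar> \<le> r * K"
  shows "u \<in> dual_space \<tau>"
proof -
  have K: "0 \<le> K"
    using bound[of 0 1] barrel_zero subspace_0[OF D_subspace] unfolding inB_def by fastforce
  have "continuous_map \<tau> euclideanreal u"
    unfolding continuous_map_def
  proof (intro conjI allI impI)
    fix V :: "real set" assume "openin euclideanreal V"
    then have V: "open V" by simp
    show "openin \<tau> {f \<in> topspace \<tau>. u f \<in> V}"
    proof (subst openin_subopen, intro ballI)
      fix f assume "f \<in> {f \<in> topspace \<tau>. u f \<in> V}"
      then have f: "f \<in> D" "u f \<in> V" by (auto simp: topspace_\<tau>)
      obtain e where e: "0 < e" "ball (u f) e \<subseteq> V" using V f(2) by (meson open_contains_ball)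
      define d where "d = e / (K + 1)"
      have d: "0 < d" "d * K < e" using e(1) K by (simp_all add: d_def field_simps)
      obtain W where W: "openin \<tau> W" "f \<in> W" "\<forall>g\<in>W. g \<in> D \<and> inB d (g - f) \<and> norm (g - f) \<le> d"
        using nhd_inB[OF f(1) d(1)] by blast
      have "g \<in> {f \<in> topspace \<tau>. u f \<in> V}" if "g \<in> W" for g
      proof -
        have g: "g \<in> D" "inB d (g - f)" using W(3) that by auto
        have gf: "g - f \<in> D" using subspace_diff[OF D_subspace g(1) f(1)] .
        have "u g = u (g - f) + u f" using add[OF gf f(1)] by simp
        then have "\<bar>u g - u f\<bar> \<le> d * K" using bound[OF gf g(2)] by simp
        then have "u g \<in> ball (u f) e" using d(2) by (simp add: dist_real_def abs_minus_commute)
        then show ?thesis using e(2) g(1) by (auto simp: topspace_\<tau>)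
      qed
      then show "\<exists>T. openin \<tau> T \<and> f \<in> T \<and> T \<subseteq> {f \<in> topspace \<tau>. u f \<in> V}"
        using W(1,2) by blast
    qed
  qed simp
  then show ?thesis using add scale unfolding dual_space_def topspace_\<tau> by blast
qed

text \<open>Extension by continuity from a rational vector space, along approximants at gauge
  distance at most \<open>1 / real (Suc n)\<close>. An upper bound on \<open>Q \<inter> B\<close>
  suffices, because \<open>Q\<close> and the barrel are symmetric. The approximants are a parameter,
  so that they can later be chosen independently of time.\<close>

lemma extend_functional:
  assumes Q: "Q \<subseteq> D" "\<And>f g. f \<in> Q \<Longrightarrow> g \<in> Q \<Longrightarrow> f + g \<in> Q" "\<And>r f. r \<in> \<rat> \<Longrightarrow> f \<in> Q \<Longrightarrow> r *\<^sub>R f \<in> Q"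
    and v: "\<And>f g. f \<in> Q \<Longrightarrow> g \<in> Q \<Longrightarrow> v (f + g) = v f + v g" "\<And>r f. r \<in> \<rat> \<Longrightarrow> f \<in> Q \<Longrightarrow> v (r *\<^sub>R f) = r * v f"
    and K: "\<And>f. f \<in> Q \<Longrightarrow> f \<in> B \<Longrightarrow> v f \<le> K"
    and a: "\<And>f n. f \<in> D \<Longrightarrow> a f n \<in> Q" "\<And>f n. f \<in> D \<Longrightarrow> inB (1 / real (Suc n)) (a f n - f)"
  defines "u \<equiv> \<lambda>f. lim (\<lambda>n. v (a f n))"
  shows "u \<in> dual_space \<tau>" "\<And>f n. f \<in> D \<Longrightarrow> \<bar>u f - v (a f n)\<bar> \<le> 1 / real (Suc n) * K"
proof -
  have Qminus: "- f \<in> Q" "v (- f) = - v f" if "f \<in> Q" for f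
    using Q(3)[of "- 1" f] v(2)[of "- 1" f] that by (simp_all add: Rats_minus_iff)
  have Qdiff: "f - g \<in> Q" "v (f - g) = v f - v g" if "f \<in> Q" "g \<in> Q" for f g
    using Q(2)[OF that(1) Qminus(1)[OF that(2)]] v(1)[OF that(1) Qminus(1)[OF that(2)]] Qminus(2)[OF that(2)] by auto
  have upper: "v f \<le> r * K" if f: "f \<in> Q" "inB r f" for f r
  proof -
    \<comment> \<open>Here \<open>v\<close> is homogeneous only over the rationals, so
      \<open>f\<close> is scaled by a rational \<open>q > r\<close>, and then \<open>q\<close> tends
      to \<open>r\<close>.\<close>
    have rat: "v f \<le> q * K" if q: "q \<in> \<rat>" "r < q" for q
    proof -
      have "0 < q" using q(2) f(2) unfolding inB_def by linarith
      obtain b where b: "b \<in> B" "f = q *\<^sub>R b"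
        using inB_mono[OF f(2) less_imp_le[OF q(2)]] unfolding inB_def by blast
      have iq: "1 / q \<in> \<rat>" using q(1) by simp
      have "(1 / q) *\<^sub>R f = b" using b(2) \<open>0 < q\<close> by simp
      then have "(1 / q) * v f \<le> K" using K[OF Q(3)[OF iq f(1)]] b(1) v(2)[OF iq f(1)] by simp
      then show ?thesis using \<open>0 < q\<close> by (simp add: divide_le_eq mult.commute)
    qed
    have "\<exists>q. (\<forall>n. q n \<in> \<rat> \<and> r < q n) \<and> q \<longlonglongrightarrow> r"
    proof -
      have "\<exists>q\<in>\<rat>. r < q \<and> q < r + 1 / real (Suc n)" for n
        by (rule Rats_dense_in_real) simp
      then obtain q where q: "\<And>n. q n \<in> \<rat> \<and> r < q n \<and> q n < r + 1 / real (Suc n)" by metis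
      have "(\<lambda>n. r + 1 / real (Suc n)) \<longlonglongrightarrow> r + 0"
        by (intro tendsto_add tendsto_const LIMSEQ_Suc lim_1_over_n)
      then have lim: "(\<lambda>n. r + 1 / real (Suc n)) \<longlonglongrightarrow> r" by simp
      have "q \<longlonglongrightarrow> r"
      proof (rule tendsto_sandwich[OF _ _ tendsto_const lim])
        show "\<forall>\<^sub>F n in sequentially. r \<le> q n" "\<forall>\<^sub>F n in sequentially. q n \<le> r + 1 / real (Suc n)"
          using q by (simp_all add: less_imp_le)
      qed
      moreover have "\<forall>n. q n \<in> \<rat> \<and> r < q n" using q by simp
      ultimately show ?thesis by (intro exI[of _ q] conjI)
    qed
    then obtain q where q: "\<forall>n. q n \<in> \<rat> \<and> r < q n" "q \<longlonglongrightarrow> r" by blast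
    have "(\<lambda>n. q n * K) \<longlonglongrightarrow> r * K" by (intro tendsto_intros q)
    then show ?thesis by (rule LIMSEQ_le_const) (use rat q(1) in blast)
  qed
  have bound: "\<bar>v f\<bar> \<le> r * K" if f: "f \<in> Q" "inB r f" for f r
    using upper[OF f] upper[OF Qminus(1)[OF f(1)] inB_uminus[OF f(2)]] Qminus(2)[OF f(1)] by (simp add: abs_le_iff)
  have K0: "0 \<le> K"
  proof -
    have "0 \<in> Q" "v 0 = 0"
    proof -
      have "a 0 0 \<in> Q" using a(1) subspace_0[OF D_subspace] by blast
      then show "0 \<in> Q" "v 0 = 0" using Q(3)[of 0 "a 0 0"] v(2)[of 0 "a 0 0"] by auto
    qed
    then show ?thesis using K[of 0] barrel_zero by simp
  qed
  let ?d = "\<lambda>n. 1 / real (Suc n)"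
  have d0: "?d \<longlonglongrightarrow> 0" by (rule LIMSEQ_Suc[OF lim_1_over_n])
  have close: "\<bar>v (a f n) - v (a f k)\<bar> \<le> (?d n + ?d k) * K" if f: "f \<in> D" for f n k
  proof -
    have "inB (?d n + ?d k) ((a f n - f) + - (a f k - f))"
      by (intro inB_add inB_uminus a(2) f)
    then have "inB (?d n + ?d k) (a f n - a f k)" by simp
    from bound[OF Qdiff(1)[OF a(1)[OF f] a(1)[OF f]] this] show ?thesis
      using Qdiff(2)[OF a(1)[OF f] a(1)[OF f]] by simp
  qed
  have conv: "(\<lambda>n. v (a f n)) \<longlonglongrightarrow> u f" if f: "f \<in> D" for f
  proof -
    have "Cauchy (\<lambda>n. v (a f n))"
    proof (rule metric_CauchyI)
      fix e :: real assume e: "0 < e"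
      have "(\<lambda>n. ?d n * K) \<longlonglongrightarrow> 0"
        using tendsto_mult[OF d0 tendsto_const[of K]] unfolding mult_zero_left .
      then have "\<forall>\<^sub>F n in sequentially. ?d n * K < e / 2"
        by (rule order_tendstoD(2)) (use e in simp)
      then obtain N where N: "\<forall>n\<ge>N. ?d n * K < e / 2" unfolding eventually_sequentially by blast
      show "\<exists>N. \<forall>m\<ge>N. \<forall>n\<ge>N. dist (v (a f m)) (v (a f n)) < e"
      proof (intro exI[of _ N] allI impI)
        fix m n assume "N \<le> m" "N \<le> n"
        then have "?d m * K < e / 2" "?d n * K < e / 2" using N by auto
        then show "dist (v (a f m)) (v (a f n)) < e"
          unfolding dist_real_def using close[OF f, of m n, unfolded distrib_right] by linarith
      qed
    qed
    then show ?thesis unfolding u_def by (simp add: Cauchy_convergent convergent_LIMSEQ_iff[symmetric])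
  qed
  show close_u: "\<bar>u f - v (a f n)\<bar> \<le> ?d n * K" if f: "f \<in> D" for f n
  proof -
    have "(\<lambda>k. \<bar>v (a f k) - v (a f n)\<bar>) \<longlonglongrightarrow> \<bar>u f - v (a f n)\<bar>" by (intro tendsto_intros conv f)
    moreover have "(\<lambda>k. (?d k + ?d n) * K) \<longlonglongrightarrow> (0 + ?d n) * K" by (intro tendsto_intros d0)
    ultimately show ?thesis
      using close[OF f, of _ n] by (auto intro: LIMSEQ_le)
  qed
  \<comment> \<open>The number \<open>c\<close> counts the approximation errors in an identity: one
    for a bound, three for additivity, \<open>1 + \<bar>q\<bar>\<close> for a rational
    multiple.\<close>
  have limit_bound: "\<bar>L\<bar> \<le> r * K" if "l \<longlonglongrightarrow> L" "\<And>n. \<bar>l n\<bar> \<le> (r + c * ?d n) * K" for l L r c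
  proof -
    have "(\<lambda>n. (r + c * ?d n) * K) \<longlonglongrightarrow> (r + c * 0) * K" by (intro tendsto_intros d0)
    from LIMSEQ_le[OF tendsto_rabs[OF that(1)] this] show ?thesis using that(2) by auto
  qed
  have bound_u: "\<bar>u f\<bar> \<le> r * K" if f: "f \<in> D" "inB r f" for f r
  proof (rule limit_bound[OF conv[OF f(1)], where c = 1])
    fix n
    have "inB (?d n + r) ((a f n - f) + f)" by (intro inB_add a(2) f)
    then show "\<bar>v (a f n)\<bar> \<le> (r + 1 * ?d n) * K"
      using bound[OF a(1)[OF f(1)], of "?d n + r" n] by (simp add: add.commute)
  qed
  have add_u: "u (f + g) = u f + u g" if f: "f \<in> D" and g: "g \<in> D" for f g
  proof -
    have fg: "f + g \<in> D" by (rule subspace_add[OF D_subspace f g])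
    have "\<bar>u (f + g) - (u f + u g)\<bar> \<le> 0 * K"
    proof (rule limit_bound[where c = 3])
      show "(\<lambda>n. v (a (f + g) n) - (v (a f n) + v (a g n))) \<longlonglongrightarrow> u (f + g) - (u f + u g)"
        by (intro tendsto_intros conv f g fg)
      fix n
      have "inB (?d n + (?d n + ?d n)) ((a (f + g) n - (f + g)) + (- (a f n - f) + - (a g n - g)))"
        by (intro inB_add inB_uminus a(2) f g fg)
      moreover have "(a (f + g) n - (f + g)) + (- (a f n - f) + - (a g n - g)) = a (f + g) n - (a f n + a g n)" by simp
      ultimately have "inB (?d n + (?d n + ?d n)) (a (f + g) n - (a f n + a g n))" by (simp only:)
      from bound[OF Qdiff(1)[OF a(1)[OF fg] Q(2)[OF a(1)[OF f] a(1)[OF g]]] this]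
      show "\<bar>v (a (f + g) n) - (v (a f n) + v (a g n))\<bar> \<le> (0 + 3 * ?d n) * K"
        using Qdiff(2)[OF a(1)[OF fg] Q(2)[OF a(1)[OF f] a(1)[OF g]]] v(1)[OF a(1)[OF f] a(1)[OF g]]
        by simp
    qed
    then show ?thesis by simp
  qed
  have scale_u: "u (c *\<^sub>R f) = c * u f" if f: "f \<in> D" for c f
  proof -
    have cf: "c *\<^sub>R f \<in> D" for c by (rule subspace_scale[OF D_subspace f])
    have rat: "u (q *\<^sub>R f) = q * u f" if q: "q \<in> \<rat>" for q
    proof -
      have "\<bar>u (q *\<^sub>R f) - q * u f\<bar> \<le> 0 * K"
      proof (rule limit_bound[where c = "1 + \<bar>q\<bar>"])
        show "(\<lambda>n. v (a (q *\<^sub>R f) n) - q * v (a f n)) \<longlonglongrightarrow> u (q *\<^sub>R f) - q * u f"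
          by (intro tendsto_intros conv f cf)
        fix n
        have "inB (?d n + \<bar>- q\<bar> * ?d n) ((a (q *\<^sub>R f) n - q *\<^sub>R f) + (- q) *\<^sub>R (a f n - f))"
          by (intro inB_add inB_scale a(2) f cf)
        moreover have "(a (q *\<^sub>R f) n - q *\<^sub>R f) + (- q) *\<^sub>R (a f n - f) = a (q *\<^sub>R f) n - q *\<^sub>R a f n"
          by (simp add: scaleR_diff_right)
        ultimately have "inB (?d n + \<bar>q\<bar> * ?d n) (a (q *\<^sub>R f) n - q *\<^sub>R a f n)"
          by (simp only: abs_minus_cancel)
        from bound[OF Qdiff(1)[OF a(1)[OF cf] Q(3)[OF q a(1)[OF f]]] this]
        show "\<bar>v (a (q *\<^sub>R f) n) - q * v (a f n)\<bar> \<le> (0 + (1 + \<bar>q\<bar>) * ?d n) * K"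
          using Qdiff(2)[OF a(1)[OF cf] Q(3)[OF q a(1)[OF f]]] v(2)[OF q a(1)[OF f]]
          by (simp add: distrib_right add_divide_distrib)
      qed
      then show ?thesis by simp
    qed
    \<comment> \<open>The absorbing property bounds the gauge of \<open>f\<close>, so that
      \<open>u (c *\<^sub>R f)\<close> is Lipschitz in \<open>c\<close> and rational homogeneity
      extends to real factors.\<close>
    obtain \<rho> where \<rho>: "0 < \<rho>" "inB \<rho> f" using barrel_absorbing[OF f] by blast
    have lip: "\<bar>u (c *\<^sub>R f) - q * u f\<bar> \<le> \<bar>c - q\<bar> * \<rho> * K" if "q \<in> \<rat>" for q
    proof -
      have "u (c *\<^sub>R f) = u (q *\<^sub>R f) + u ((c - q) *\<^sub>R f)"
        using add_u[OF cf[of q] cf[of "c - q"]] by (simp add: scaleR_add_left[symmetric])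
      then show ?thesis using bound_u[OF cf inB_scale[OF \<rho>(2)], of "c - q"] rat[OF that] by simp
    qed
    have "\<exists>q. (\<forall>n. q n \<in> \<rat>) \<and> q \<longlonglongrightarrow> c"
      using closure_sequential[of c "\<rat> :: real set"] by (simp add: Rats_closure_real)
    then obtain q where q: "\<forall>n. q n \<in> \<rat>" "q \<longlonglongrightarrow> c" by blast
    have "(\<lambda>n. \<bar>u (c *\<^sub>R f) - q n * u f\<bar>) \<longlonglongrightarrow> \<bar>u (c *\<^sub>R f) - c * u f\<bar>" by (intro tendsto_intros q)
    moreover have "(\<lambda>n. \<bar>c - q n\<bar> * \<rho> * K) \<longlonglongrightarrow> \<bar>c - c\<bar> * \<rho> * K" by (intro tendsto_intros q)
    ultimately have "\<bar>u (c *\<^sub>R f) - c * u f\<bar> \<le> \<bar>c - c\<bar> * \<rho> * K"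
      by (rule LIMSEQ_le) (use lip q(1) in auto)
    then show ?thesis by simp
  qed
  show "u \<in> dual_space \<tau>" by (rule dual_spaceI_barrel[OF add_u scale_u bound_u])
qed

end

end

section \<open>Construction of the velocity\<close>

lemma abs_integral_le_of_nn_bound:
  fixes h :: "real \<Rightarrow> real"
  assumes h: "h absolutely_integrable_on S" and k: "(\<integral>\<^sup>+s\<in>S. k s \<partial>lebesgue) \<le> ennreal C" "0 \<le> C" "0 \<le> c"
    and le: "AE s in lebesgue. s \<in> S \<longrightarrow> ennreal \<bar>h s\<bar> \<le> ennreal c * k s"
    and km: "(\<lambda>s. k s * indicator S s) \<in> borel_measurable lebesgue"
  shows "\<bar>integral S h\<bar> \<le> c * C"
proof -
  have i: "integrable lebesgue (\<lambda>s. indicator S s *\<^sub>R h s)"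
    using h by (simp add: set_integrable_def)
  have "ennreal \<bar>integral S h\<bar> = ennreal (norm (\<integral>s. indicator S s *\<^sub>R h s \<partial>lebesgue))"
    using set_lebesgue_integral_eq_integral(2)[OF h] by (simp add: set_lebesgue_integral_def)
  also have "\<dots> \<le> (\<integral>\<^sup>+s. ennreal (norm (indicator S s *\<^sub>R h s)) \<partial>lebesgue)"
    by (rule integral_norm_bound_ennreal[OF i])
  also have "\<dots> \<le> (\<integral>\<^sup>+s. ennreal c * (k s * indicator S s) \<partial>lebesgue)"
    by (rule nn_integral_mono_AE, rule AE_mp[OF le]) (auto intro!: AE_I2 split: split_indicator)
  also have "\<dots> = ennreal c * (\<integral>\<^sup>+s\<in>S. k s \<partial>lebesgue)"
    by (rule nn_integral_cmult[OF km])
  also have "\<dots> \<le> ennreal c * ennreal C" by (rule mult_left_mono[OF k(1)]) simp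
  also have "\<dots> = ennreal (c * C)" using k by (simp add: ennreal_mult)
  finally show ?thesis using k by (subst (asm) ennreal_le_iff) auto
qed

context feller_core
begin

text \<open>Each density \<open>w f\<close> is determined only up to a null set, so
  \<open>w f s\<close> need not be linear in \<open>f\<close>. Linearity over \<open>Q\<close> and
  finiteness of the supremum \<open>L\<close> hold off one null set \<open>N\<close>; there
  \<open>w f s\<close> is at most \<open>L s + C\<close> for \<open>f\<close> in
  \<open>Q \<inter> B\<close>, and \<open>extend_functional\<close> applies. The integral identity
  for \<open>f\<close> in \<open>D\<close> is then recovered from the approximants in
  \<open>Q\<close>.\<close>

lemma velocity_exists:
  assumes \<nu>: "\<nu> \<in> continuous_paths weak_topology" and fin: "action \<nu> \<noteq> \<infinity>"
  shows "\<exists>u. has_velocity \<tau> \<nu> u"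
proof -
  let ?i = "\<lambda>f t. \<langle>f, \<nu> t\<rangle>"
  obtain Q where Q: "countable Q" "Q \<subseteq> D" "D \<subseteq> \<tau> closure_of Q" "0 \<in> Q"
    "\<And>f g. f \<in> Q \<Longrightarrow> g \<in> Q \<Longrightarrow> f + g \<in> Q" "\<And>r f. r \<in> \<rat> \<Longrightarrow> f \<in> Q \<Longrightarrow> r *\<^sub>R f \<in> Q"
    using ex_dense_rational_space by metis
  \<comment> \<open>Core condition (8) with factor 1 bounds the Hamiltonian on the barrel
    itself.\<close>
  obtain B where B: "barrel \<tau> B" "bdd_above ((\<lambda>f. norm (H f)) ` ((\<lambda>g. 1 *\<^sub>R g) ` B))"
    using ex_barrel zero_less_one by blast
  then obtain C where C: "\<forall>f\<in>B. norm (H f) \<le> C" unfolding bdd_above_def by auto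
  have C0: "0 \<le> C" using C barrel_zero[OF B(1)] norm_ge_zero order_trans by blast
  have "\<forall>f\<in>D. \<exists>w. w \<in> borel_measurable borel \<and> (\<forall>x y. 0 \<le> x \<and> x \<le> y \<longrightarrow> w absolutely_integrable_on {x..y} \<and>
    integral {x..y} w = ?i f y - ?i f x)"
    using action_density[OF \<nu> fin] by blast
  from bchoice[OF this] obtain w where w: "\<forall>f\<in>D. w f \<in> borel_measurable borel \<and> (\<forall>x y. 0 \<le> x \<and> x \<le> y \<longrightarrow> w f absolutely_integrable_on {x..y} \<and>
    integral {x..y} (w f) = ?i f y - ?i f x)" by blast
  have w_meas: "w f \<in> borel_measurable borel" if "f \<in> D" for f using w that by blast
  have w_int: "w f absolutely_integrable_on {x..y}" if "f \<in> D" "0 \<le> x" for f x y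
    using w that by (cases "x \<le> y") auto
  have w_eq: "integral {x..y} (w f) = ?i f y - ?i f x" if "f \<in> D" "0 \<le> x" "x \<le> y" for f x y
    using w that by blast
  have w_hk: "w f integrable_on {x..y}" if "f \<in> D" "0 \<le> x" for f x y
    using w_int[OF that] by (simp add: absolutely_integrable_on_def)
  have QD: "f \<in> D" if "f \<in> Q" for f using Q(2) that by blast

  have ae_add: "AE s in lebesgue. 0 \<le> s \<longrightarrow> w (f + g) s = w f s + w g s" if f: "f \<in> Q" and g: "g \<in> Q" for f g
  proof -
    note D = QD[OF f] QD[OF g] QD[OF Q(5)[OF f g]]
    have "AE s in lebesgue. 0 \<le> s \<longrightarrow> w (f + g) s - (w f s + w g s) = 0"
    proof (rule AE_zero_if_integrals_zero)
      show "(\<lambda>s. w (f + g) s - (w f s + w g s)) \<in> borel_measurable borel"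
        by (intro borel_measurable_diff borel_measurable_add w_meas D)
      show "(\<lambda>s. w (f + g) s - (w f s + w g s)) absolutely_integrable_on {0..t}" for t
        by (intro set_integral_diff(1) set_integral_add(1) w_int D order_refl)
      show "integral {x..y} (\<lambda>s. w (f + g) s - (w f s + w g s)) = 0" if xy: "0 \<le> x" "x \<le> y" for x y
        using xy
        by (simp add: Henstock_Kurzweil_Integration.integral_diff Henstock_Kurzweil_Integration.integral_add
            integrable_add w_hk D w_eq integral_bcontfun_add[OF path_prob[OF \<nu>]] del: plus_bcontfun.rep_eq)
    qed
    then show ?thesis by eventually_elim auto
  qed
  have ae_scale: "AE s in lebesgue. 0 \<le> s \<longrightarrow> w (r *\<^sub>R f) s = r * w f s" if r: "r \<in> \<rat>" and f: "f \<in> Q" for r f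
  proof -
    note D = QD[OF f] QD[OF Q(6)[OF r f]]
    have "AE s in lebesgue. 0 \<le> s \<longrightarrow> w (r *\<^sub>R f) s - r * w f s = 0"
    proof (rule AE_zero_if_integrals_zero)
      show "(\<lambda>s. w (r *\<^sub>R f) s - r * w f s) \<in> borel_measurable borel"
        by (intro borel_measurable_diff borel_measurable_times borel_measurable_const w_meas D)
      show "(\<lambda>s. w (r *\<^sub>R f) s - r * w f s) absolutely_integrable_on {0..t}" for t
        by (intro set_integral_diff(1) set_integrable_mult_right w_int D order_refl)
      show "integral {x..y} (\<lambda>s. w (r *\<^sub>R f) s - r * w f s) = 0" if xy: "0 \<le> x" "x \<le> y" for x y
      proof -
        have "integral {x..y} (\<lambda>s. w (r *\<^sub>R f) s - r * w f s) = integral {x..y} (w (r *\<^sub>R f)) - r * integral {x..y} (w f)"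
          using xy by (subst Henstock_Kurzweil_Integration.integral_diff) (auto intro!: integrable_on_mult_right w_hk D)
        then show ?thesis using xy by (simp add: w_eq D algebra_simps)
      qed
    qed
    then show ?thesis by eventually_elim auto
  qed

  define v where "v f s = w f s - ?i (H f) s" for f s
  \<comment> \<open>The Lagrangian over \<open>Q\<close>, with the densities \<open>w f s\<close> in
    place of a velocity that is yet to be built.\<close>
  define L where "L s = (SUP f\<in>Q. ennreal (v f s))" for s
  let ?J = "real_of_ereal (action \<nu>)"
  have h_meas: "(\<lambda>s. ?i (H f) s) \<in> borel_measurable (lebesgue_on {0..})" for f
    by (intro continuous_imp_measurable_on_sets_lebesgue continuous_on_path_integral[OF \<nu>]) auto
  have w_meas': "w f \<in> borel_measurable (lebesgue_on {0..})" if "f \<in> D" for f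
    using w_meas[OF that] by (intro measurable_restrict_space1 measurable_completion) simp
  have L_meas: "L \<in> borel_measurable (lebesgue_on {0..})"
    unfolding L_def[abs_def] v_def[abs_def]
    by (intro borel_measurable_SUP Q(1) measurable_compose[OF _ measurable_ennreal] borel_measurable_diff w_meas' h_meas QD)
  have L_int: "(\<integral>\<^sup>+s\<in>{0..}. L s \<partial>lebesgue) \<le> ennreal ?J"
    unfolding L_def
  proof (rule nn_integral_SUP_le[OF Q(1), where m = "action_fun \<nu>"])
    fix f assume f: "f \<in> Q"
    show "v f absolutely_integrable_on {0..t}" for t
      unfolding v_def[abs_def] by (intro set_integral_diff(1) w_int QD f path_integral_integrable[OF \<nu>]) auto
    fix x y :: real assume xy: "0 \<le> x" "x \<le> y"
    have "?i (H f) integrable_on {x..y}"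
      using path_integral_integrable[OF \<nu> xy(1), where f = "H f" and b = y] by (simp add: absolutely_integrable_on_def)
    then have "integral {x..y} (v f) = integral {x..y} (w f) - integral {x..y} (?i (H f))"
      unfolding v_def[abs_def] by (intro Henstock_Kurzweil_Integration.integral_diff w_hk QD f xy)
    then show "integral {x..y} (v f) \<le> action_fun \<nu> y - action_fun \<nu> x"
      using action_fun_ge[OF \<nu> fin QD[OF f] xy] w_eq[OF QD[OF f] xy] by simp
  qed (use action_fun_mono[OF fin] action_fun_nonneg[OF fin] action_fun_le[OF fin] in auto)
  have L_meas': "(\<lambda>s. L s * indicator {0..} s) \<in> borel_measurable lebesgue"
    using L_meas by (subst (asm) borel_measurable_restrict_space_iff_ennreal) auto
  have ae_L: "AE s in lebesgue. 0 \<le> s \<longrightarrow> L s \<noteq> \<infinity>"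
  proof -
    have "(\<integral>\<^sup>+s\<in>{0..}. L s \<partial>lebesgue) \<noteq> \<infinity>" using L_int by (auto simp: top_unique)
    from nn_integral_PInf_AE[OF L_meas' this] show ?thesis by eventually_elim auto
  qed
  have "AE s in lebesgue. \<forall>f\<in>Q. \<forall>g\<in>Q. 0 \<le> s \<longrightarrow> w (f + g) s = w f s + w g s"
    by (intro AE_ball_countable[OF Q(1), THEN iffD2] ballI ae_add)
  moreover have "AE s in lebesgue. \<forall>r\<in>\<rat>. \<forall>f\<in>Q. 0 \<le> s \<longrightarrow> w (r *\<^sub>R f) s = r * w f s"
    by (intro AE_ball_countable[OF Q(1), THEN iffD2] AE_ball_countable[OF countable_rat, THEN iffD2] ballI ae_scale)
  ultimately have "AE s in lebesgue. 0 \<le> s \<longrightarrow> L s \<noteq> \<infinity> \<and> (\<forall>f\<in>Q. \<forall>g\<in>Q. w (f + g) s = w f s + w g s) \<and>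
      (\<forall>r\<in>\<rat>. \<forall>f\<in>Q. w (r *\<^sub>R f) s = r * w f s)"
    using ae_L by eventually_elim blast
  then obtain N where N: "N \<in> null_sets lebesgue" "{s \<in> space lebesgue. \<not> (0 \<le> s \<longrightarrow> L s \<noteq> \<infinity> \<and> (\<forall>f\<in>Q. \<forall>g\<in>Q. w (f + g) s = w f s + w g s) \<and>
      (\<forall>r\<in>\<rat>. \<forall>f\<in>Q. w (r *\<^sub>R f) s = r * w f s))} \<subseteq> N"
    by (elim AE_E3) blast
  have good: "L s \<noteq> \<infinity>" "\<forall>f\<in>Q. \<forall>g\<in>Q. w (f + g) s = w f s + w g s" "\<forall>r\<in>\<rat>. \<forall>f\<in>Q. w (r *\<^sub>R f) s = r * w f s"
    if "0 \<le> s" "s \<notin> N" for s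
    using N(2) that by auto

  \<comment> \<open>The approximants do not depend on \<open>s\<close>, so that off \<open>N\<close>
    the value \<open>u s f\<close> is a limit of measurable functions of \<open>s\<close>.\<close>
  have "\<forall>f\<in>D. \<exists>q. \<forall>n. q n \<in> Q \<and> inB B (1 / real (Suc n)) (q n - f) \<and> norm (q n - f) \<le> 1 / real (Suc n)"
  proof
    fix f assume f: "f \<in> D"
    have "\<forall>n. \<exists>q. q \<in> Q \<and> inB B (1 / real (Suc n)) (q - f) \<and> norm (q - f) \<le> 1 / real (Suc n)"
    proof
      fix n
      have "0 < 1 / real (Suc n)" by simp
      from dense_approx[OF B(1) Q(3) f this]
      show "\<exists>q. q \<in> Q \<and> inB B (1 / real (Suc n)) (q - f) \<and> norm (q - f) \<le> 1 / real (Suc n)" by blast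
    qed
    from choice[OF this] show "\<exists>q. \<forall>n. q n \<in> Q \<and> inB B (1 / real (Suc n)) (q n - f) \<and> norm (q n - f) \<le> 1 / real (Suc n)" .
  qed
  from bchoice[OF this] obtain a where a: "\<forall>f\<in>D. \<forall>n. a f n \<in> Q \<and> inB B (1 / real (Suc n)) (a f n - f) \<and> norm (a f n - f) \<le> 1 / real (Suc n)"
    by blast
  \<comment> \<open>Bounds the functional at time \<open>s\<close> on the barrel and hence the error
    of each approximant; its integral over \<open>{0..t}\<close> is at most
    \<open>?J + C * t\<close>.\<close>
  define k where "k s = L s + ennreal C" for s
  \<comment> \<open>The zero functional on \<open>N\<close> keeps \<open>u s\<close> in the dual at
    every time.\<close>
  define u where "u s f = (if s \<in> N then 0 else lim (\<lambda>n. w (a f n) s))" for s f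
  have ext: "u s \<in> dual_space \<tau> \<and> (\<forall>f\<in>D. \<forall>n. ennreal \<bar>u s f - w (a f n) s\<bar> \<le> ennreal (1 / real (Suc n)) * k s)"
    if s: "0 \<le> s" "s \<notin> N" for s
  proof -
    let ?K = "enn2real (L s) + C"
    have k: "k s = ennreal ?K" unfolding k_def using good(1)[OF s] C0 by (simp add: less_top)
    have bound: "w f s \<le> ?K" if "f \<in> Q" "f \<in> B" for f
    proof -
      have "ennreal (v f s) \<le> L s" unfolding L_def by (rule SUP_upper[OF that(1)])
      then have "v f s \<le> enn2real (L s)"
        using good(1)[OF s] by (metis enn2real_nonneg ennreal_enn2real ennreal_le_iff infinity_ennreal_def top.not_eq_extremum)
      moreover have "?i (H f) s \<le> C"
        using abs_integral_bcontfun_le[OF path_prob[OF \<nu> s(1)], of "H f"] C that(2) by fastforce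
      ultimately show ?thesis unfolding v_def by linarith
    qed
    have us: "u s = (\<lambda>f. lim (\<lambda>n. w (a f n) s))" using s(2) by (simp add: u_def fun_eq_iff)
    note E = extend_functional[OF B(1) Q(2,5,6), where v = "\<lambda>f. w f s" and K = ?K and a = a]
    have "u s \<in> dual_space \<tau>" unfolding us
      by (rule E(1)) (use good(2,3)[OF s] bound a in auto)
    moreover have "\<bar>u s f - w (a f n) s\<bar> \<le> 1 / real (Suc n) * ?K" if "f \<in> D" for f n
      unfolding us by (rule E(2)[OF _ _ _ _ _ _ _ _ _ that]) (use good(2,3)[OF s] bound a in auto)
    then have "ennreal \<bar>u s f - w (a f n) s\<bar> \<le> ennreal (1 / real (Suc n)) * k s" if "f \<in> D" for f n
      unfolding k using that C0 by (subst ennreal_mult[symmetric]) (auto intro!: ennreal_leI simp del: of_nat_Suc)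
    ultimately show ?thesis by blast
  qed
  have u_N: "u s f = 0" if "s \<in> N" for s f using that by (simp add: u_def)
  have N_sets: "N \<in> sets lebesgue" using N(1) by auto
  have u_meas: "(\<lambda>s. u s f) \<in> borel_measurable (lebesgue_on {0..})" if f: "f \<in> D" for f
  proof -
    have "(\<lambda>s. lim (\<lambda>n. w (a f n) s)) \<in> borel_measurable (lebesgue_on {0..})"
      using a f by (intro borel_measurable_lim_metric w_meas' QD) blast
    moreover have "{s \<in> space (lebesgue_on {0..}). s \<in> N} \<in> sets (lebesgue_on {0..})"
      using N_sets by (auto simp: space_restrict_space sets_restrict_space Int_def[symmetric] Int_commute)
    ultimately show ?thesis
      unfolding u_def by (intro measurable_If measurable_const) auto
  qed
  have ae_close: "AE s in lebesgue. s \<in> {0..t} \<longrightarrow> ennreal \<bar>u s f - w (a f n) s\<bar> \<le> ennreal (1 / real (Suc n)) * k s"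
    if f: "f \<in> D" for f n t
    using AE_not_in[OF N(1)]
  proof eventually_elim
    case (elim s)
    then show ?case using ext[of s] f by auto
  qed
  have k_meas: "(\<lambda>s. k s * indicator {0..t} s) \<in> borel_measurable lebesgue" for t
  proof -
    have "(\<lambda>s. (L s * indicator {0..} s + ennreal C) * indicator {0..t} s) \<in> borel_measurable lebesgue"
      by (intro borel_measurable_times_ennreal borel_measurable_add L_meas' borel_measurable_indicator) auto
    also have "(\<lambda>s. (L s * indicator {0..} s + ennreal C) * indicator {0..t} s) = (\<lambda>s. k s * indicator {0..t} s)"
      by (auto simp: k_def fun_eq_iff split: split_indicator)
    finally show ?thesis .
  qed
  have J0: "0 \<le> ?J" using action_fun_nonneg[OF fin, of 0] action_fun_le[OF fin, of 0] by simp
  have k_int: "(\<integral>\<^sup>+s\<in>{0..t}. k s \<partial>lebesgue) \<le> ennreal (?J + C * t)" if t: "0 \<le> t" for t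
  proof -
    have "(\<integral>\<^sup>+s\<in>{0..t}. k s \<partial>lebesgue) \<le> (\<integral>\<^sup>+s. L s * indicator {0..} s + ennreal C * indicator {0..t} s \<partial>lebesgue)"
      by (intro nn_integral_mono) (auto simp: k_def split: split_indicator)
    also have "\<dots> = (\<integral>\<^sup>+s\<in>{0..}. L s \<partial>lebesgue) + ennreal C * ennreal t"
    proof (subst nn_integral_add[OF L_meas'])
      show "(\<lambda>s. ennreal C * indicator {0..t} s) \<in> borel_measurable lebesgue"
        by (intro borel_measurable_times_ennreal borel_measurable_const borel_measurable_indicator) simp
    qed (use t in \<open>simp add: nn_integral_cmult_indicator\<close>)
    also have "\<dots> \<le> ennreal ?J + ennreal C * ennreal t" by (rule add_right_mono[OF L_int])
    also have "\<dots> = ennreal (?J + C * t)"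
      using J0 C0 t by (simp add: ennreal_mult ennreal_plus)
    finally show ?thesis .
  qed
  have u_fin: "(\<integral>\<^sup>+s\<in>{0..t}. ennreal \<bar>u s f\<bar> \<partial>lebesgue) < \<infinity>" if f: "f \<in> D" and t: "0 \<le> t" for f t
  proof -
    have aD: "a f 0 \<in> D" using a f QD by blast
    have i: "integrable lebesgue (\<lambda>s. indicator {0..t} s *\<^sub>R w (a f 0) s)"
      using w_int[OF aD, of 0 t] by (simp add: set_integrable_def)
    have ae0: "AE s in lebesgue. s \<in> {0..t} \<longrightarrow> ennreal \<bar>u s f - w (a f 0) s\<bar> \<le> ennreal (1 / real (Suc 0)) * k s"
      by (rule ae_close[OF f])
    have "(\<integral>\<^sup>+s\<in>{0..t}. ennreal \<bar>u s f\<bar> \<partial>lebesgue) \<le> (\<integral>\<^sup>+s. ennreal (norm (indicator {0..t} s *\<^sub>R w (a f 0) s)) + k s * indicator {0..t} s \<partial>lebesgue)"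
    proof (rule nn_integral_mono_AE, rule AE_mp[OF ae0], rule AE_I2, rule impI)
      fix s assume *: "s \<in> {0..t} \<longrightarrow> ennreal \<bar>u s f - w (a f 0) s\<bar> \<le> ennreal (1 / real (Suc 0)) * k s"
      show "ennreal \<bar>u s f\<bar> * indicator {0..t} s \<le> ennreal (norm (indicator {0..t} s *\<^sub>R w (a f 0) s)) + k s * indicator {0..t} s"
      proof (cases "s \<in> {0..t}")
        case True
        have "ennreal \<bar>u s f\<bar> \<le> ennreal (\<bar>w (a f 0) s\<bar> + \<bar>u s f - w (a f 0) s\<bar>)"
          by (intro ennreal_leI) linarith
        also have "\<dots> = ennreal \<bar>w (a f 0) s\<bar> + ennreal \<bar>u s f - w (a f 0) s\<bar>" by (simp add: ennreal_plus)
        also have "\<dots> \<le> ennreal \<bar>w (a f 0) s\<bar> + k s" using * True by (intro add_left_mono) simp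
        finally show ?thesis using True by simp
      qed simp
    qed
    also have "\<dots> = (\<integral>\<^sup>+s. ennreal (norm (indicator {0..t} s *\<^sub>R w (a f 0) s)) \<partial>lebesgue) + (\<integral>\<^sup>+s\<in>{0..t}. k s \<partial>lebesgue)"
      by (intro nn_integral_add k_meas
          measurable_compose[OF borel_measurable_integrable[OF integrable_norm[OF i]] measurable_ennreal])
    also have "\<dots> < \<infinity>"
      using i k_int[OF t] unfolding integrable_iff_bounded by (auto simp: less_top[symmetric] top_unique)
    finally show ?thesis .
  qed
  have u_int: "(\<lambda>s. u s f) absolutely_integrable_on {0..t}" if f: "f \<in> D" and t: "0 \<le> t" for f t
  proof -
    have "(\<lambda>s. u s f * indicator {0..} s) \<in> borel_measurable lebesgue"
      using u_meas[OF f] by (subst (asm) borel_measurable_restrict_space_iff) (auto simp: mult.commute)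
    then have "(\<lambda>s. (u s f * indicator {0..} s) * indicator {0..t} s) \<in> borel_measurable lebesgue"
      by (rule borel_measurable_times) (rule borel_measurable_indicator, simp)
    also have "(\<lambda>s. (u s f * indicator {0..} s) * indicator {0..t} s) = (\<lambda>s. indicator {0..t} s *\<^sub>R u s f)"
      by (auto simp: fun_eq_iff split: split_indicator)
    finally have m: "(\<lambda>s. indicator {0..t} s *\<^sub>R u s f) \<in> borel_measurable lebesgue" .
    have "(\<integral>\<^sup>+s. ennreal (norm (indicator {0..t} s *\<^sub>R u s f)) \<partial>lebesgue) = (\<integral>\<^sup>+s\<in>{0..t}. ennreal \<bar>u s f\<bar> \<partial>lebesgue)"
      by (rule nn_integral_cong) (auto split: split_indicator)
    then show ?thesis
      unfolding set_integrable_def using m u_fin[OF f t] by (intro integrableI_bounded) simp_all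
  qed
  have u_eq: "?i f t - ?i f 0 = integral {0..t} (\<lambda>s. u s f)" if f: "f \<in> D" and t: "0 \<le> t" for f t
  proof -
    \<comment> \<open>Two sup norm errors of the pairings, at times 0 and \<open>t\<close>, and the
      bound on the integral of \<open>k\<close>.\<close>
    let ?c = "2 + (?J + C * t)"
    have "\<bar>(?i f t - ?i f 0) - integral {0..t} (\<lambda>s. u s f)\<bar> \<le> 1 / real (Suc n) * ?c" for n
    proof -
      have aD: "a f n \<in> D" using a f QD by blast
      have nrm: "norm (a f n - f) \<le> 1 / real (Suc n)" using a f by blast
      have "\<bar>integral {0..t} (\<lambda>s. u s f - w (a f n) s)\<bar> \<le> 1 / real (Suc n) * (?J + C * t)"
      proof (rule abs_integral_le_of_nn_bound[OF _ k_int[OF t] _ _ ae_close[OF f] k_meas])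
        show "(\<lambda>s. u s f - w (a f n) s) absolutely_integrable_on {0..t}"
          by (intro set_integral_diff(1) u_int w_int f t aD order_refl)
      qed (use J0 C0 t in auto)
      moreover have "integral {0..t} (\<lambda>s. u s f - w (a f n) s) = integral {0..t} (\<lambda>s. u s f) - (?i (a f n) t - ?i (a f n) 0)"
        using u_int[OF f t] w_hk[OF aD] w_eq[OF aD order_refl t]
        by (subst Henstock_Kurzweil_Integration.integral_diff) (auto simp: absolutely_integrable_on_def)
      moreover have "\<bar>?i (a f n) t - ?i f t\<bar> \<le> 1 / real (Suc n)" "\<bar>?i (a f n) 0 - ?i f 0\<bar> \<le> 1 / real (Suc n)"
        using order_trans[OF abs_integral_bcontfun_diff_le[OF path_prob[OF \<nu> t]] nrm]
          order_trans[OF abs_integral_bcontfun_diff_le[OF path_prob[OF \<nu> order_refl]] nrm] by auto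
      moreover have "1 / real (Suc n) * ?c = 2 * (1 / real (Suc n)) + 1 / real (Suc n) * (?J + C * t)"
        by (rule trans[OF distrib_left]) simp
      ultimately show ?thesis by linarith
    qed
    moreover have "(\<lambda>n. 1 / real (Suc n) * ?c) \<longlonglongrightarrow> 0"
      using tendsto_mult[OF LIMSEQ_Suc[OF lim_1_over_n] tendsto_const[of ?c]] unfolding mult_zero_left .
    ultimately have "\<bar>(?i f t - ?i f 0) - integral {0..t} (\<lambda>s. u s f)\<bar> \<le> 0"
      by (intro LIMSEQ_le_const[of _ 0]) auto
    then show ?thesis by simp
  qed
  have "has_velocity \<tau> \<nu> u"
    unfolding has_velocity_def topspace_\<tau>
  proof (intro conjI ballI allI impI)
    fix s :: real assume s: "0 \<le> s"
    show "u s \<in> dual_space \<tau>"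
    proof (cases "s \<in> N")
      case True
      then have "u s = (\<lambda>_. 0)" by (auto simp: u_def)
      then show ?thesis by (simp add: dual_space_def)
    qed (use ext s in blast)
  next
    fix f t assume f: "f \<in> D" and t: "0 \<le> (t :: real)"
    show "?i f t - ?i f 0 = (LINT s:{0..t}|lebesgue. u s f)"
      using u_eq[OF f t] set_lebesgue_integral_eq_integral(2)[OF u_int[OF f t]] by simp
  qed (use u_meas u_fin in auto)
  then show ?thesis by blast
qed

end

theorem theorem2p8:
  fixes M :: "'w measure" and X :: "real \<Rightarrow> 'w \<Rightarrow> 'a::polish_space"
    and P :: "real \<Rightarrow> 'a \<Rightarrow> 'a measure" and P0 :: "'a measure"
    and D :: "('a \<Rightarrow>\<^sub>C real) set" and \<tau> :: "('a \<Rightarrow>\<^sub>C real) topology"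
    and N :: "'v measure" and Y :: "nat \<Rightarrow> real \<Rightarrow> 'v \<Rightarrow> 'a"
    and I :: "(real \<Rightarrow> 'a measure) \<Rightarrow> ereal"
  assumes "locally_compact_space (euclidean :: 'a topology)"
    and "cadlag_markov_process M X P"
    and "P0 = distr M borel (X 0)"
    and "strongly_continuous_on_C0 P"
    and "core_conditions P D \<tau>"
    and "independent_copies M X N Y"
    and "good_rate_function (skorokhod_topology weak_topology) I"
    and "large_deviation_principle (skorokhod_topology weak_topology) N (empirical_process Y) I"
    and "\<forall>\<nu>\<in>cadlag_paths weak_topology. I \<nu> = path_rate P P0 \<nu>"
  shows "\<forall>\<nu>\<in>cadlag_paths weak_topology.
     (\<nu> \<in> AC_paths \<tau> \<longrightarrow> (\<forall>u. has_velocity \<tau> \<nu> u \<longrightarrow>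
        I \<nu> = relative_entropy (\<nu> 0) P0 +
          enn2ereal (\<integral>\<^sup>+s\<in>{0..}. e2ennreal (lagrangian P D (\<nu> s) (u s)) \<partial>lebesgue))) \<and>
     (\<nu> \<notin> AC_paths \<tau> \<longrightarrow> I \<nu> = \<infinity>)"
proof
  fix \<nu> :: "real \<Rightarrow> 'a measure" assume \<nu>: "\<nu> \<in> cadlag_paths weak_topology"
  have "transition_function P" using assms(2) by (simp add: cadlag_markov_process_def)
  then interpret feller_core P D \<tau>
    using assms(4,5) by unfold_locales
  have I: "I \<nu> = path_rate P P0 \<nu>" using assms(9) \<nu> by blast
  have rate: "path_rate P P0 \<nu> = relative_entropy (\<nu> 0) P0 + action \<nu>"
    if "\<nu> \<in> continuous_paths weak_topology"
    using that by (simp add: path_rate_def action_def path_cost_def)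
  have "I \<nu> = relative_entropy (\<nu> 0) P0 +
      enn2ereal (\<integral>\<^sup>+s\<in>{0..}. e2ennreal (lagrangian P D (\<nu> s) (u s)) \<partial>lebesgue)"
    if "\<nu> \<in> AC_paths \<tau>" "has_velocity \<tau> \<nu> u" for u
  proof -
    have c: "\<nu> \<in> continuous_paths weak_topology" using that(1) by (simp add: AC_paths_def)
    \<comment> \<open>Both bounds hold for every velocity \<open>u\<close> of \<nu>, so the integral
      does not depend on which one is chosen.\<close>
    have "action \<nu> = enn2ereal (\<integral>\<^sup>+s\<in>{0..}. e2ennreal (lagrangian P D (\<nu> s) (u s)) \<partial>lebesgue)"
      by (rule antisym[OF action_le_lagrangian[OF assms(1) c that(2)] action_ge_lagrangian[OF c that(2)]])
    then show ?thesis using I rate[OF c] by simp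
  qed
  moreover have "I \<nu> = \<infinity>" if "\<nu> \<notin> AC_paths \<tau>"
  proof (cases "\<nu> \<in> continuous_paths weak_topology")
    case True
    then have "action \<nu> = \<infinity>" using velocity_exists[OF True] that by (auto simp: AC_paths_def)
    moreover have "relative_entropy (\<nu> 0) P0 \<noteq> - \<infinity>" by (simp add: relative_entropy_def)
    ultimately show ?thesis using I rate[OF True] by simp
  next
    case False
    then show ?thesis using I by (simp add: path_rate_def)
  qed
  ultimately show "(\<nu> \<in> AC_paths \<tau> \<longrightarrow> (\<forall>u. has_velocity \<tau> \<nu> u \<longrightarrow>
        I \<nu> = relative_entropy (\<nu> 0) P0 +
          enn2ereal (\<integral>\<^sup>+s\<in>{0..}. e2ennreal (lagrangian P D (\<nu> s) (u s)) \<partial>lebesgue))) \<and>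
     (\<nu> \<notin> AC_paths \<tau> \<longrightarrow> I \<nu> = \<infinity>)" by blast
qed

end
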